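(* Let $c>0$ and $n\geq1$. If $\mathrm{IS}_n(c)$ holds true then for any random vectors $X_1,X_2$ drawn according to log-concave distributions $\eta_1,\eta_2$ with full support on $\mathbb{R}^n$, it holds \[ N(X_1)N(X_2)\,\mathcal{T}(\nu_1,\nu_2)^2\geq\left(\frac{nc}{2\pi}\right)^2, \] where $\nu_1,\nu_2$ are the moment measures of $\eta_1,\eta_2$. If $\mathrm{IS}_{n,s}(c)$ (resp. $\mathrm{IS}_{n,u}(c)$) holds true, then the inequality above holds with the extra condition that $X_1,X_2$ are symmetric (resp. unconditional).
   Context: $\mathcal{F}(\mathbb{R}^n)$ is the set of lower semicontinuous convex functions $f:\mathbb{R}^n\to\mathbb{R}\cup\{+\infty\}$ finite at at least one point; $f^*(y)=\sup_{x\in\mathbb{R}^n}\{x\cdot y-f(x)\}$. Functions (resp. random vectors, via their laws) are symmetric if invariant under $x\mapsto-x$, unconditional if invariant under all maps $x\mapsto(\varepsilon_1x_1,\ldots,\varepsilon_nx_n)$, $\varepsilon\in\{-1,1\}^n$; $\mathcal{F}_s(\mathbb{R}^n),\mathcal{F}_u(\mathbb{R}^n)$ are the symmetric, resp. unconditional, elements of $\mathcal{F}(\mathbb{R}^n)$. $\mathrm{IS}_n(c)$ holds if $\int e^{-f}\,dx\int e^{-f^*}\,dx\geq c^n$ for all $f\in\mathcal{F}(\mathbb{R}^n)$ with $0<\int e^{-f}\,dx$ and $0<\int e^{-f^*}\,dx$; $\mathrm{IS}_{n,s}(c)$ (resp. $\mathrm{IS}_{n,u}(c)$) holds if the same is true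 for all such $f\in\mathcal{F}_s(\mathbb{R}^n)$ (resp. $\mathcal{F}_u(\mathbb{R}^n)$). A log-concave distribution with full support is a probability measure $d\eta=e^{-V}dx$ with $V:\mathbb{R}^n\to\mathbb{R}$ convex and finite everywhere. Its moment measure is the push-forward $\nu=(\nabla V)_\#\eta$ (which has finite first moment). The entropy power of a random vector $X$ with law $\eta$ on $\mathbb{R}^n$ is $N(X)=\frac{1}{2\pi e}\exp\left(-\frac2nH(\eta|\mathrm{Leb})\right)$, where $H(\eta|\mathrm{Leb})=\int h\log h\,dx$ for $d\eta=h\,dx$. For probability measures $\nu_1,\nu_2$ on $\mathbb{R}^n$ with finite first moment, $\mathcal{T}(\nu_1,\nu_2)=\inf_{f\in\mathcal{F}(\mathbb{R}^n)}\left\{\int f\,d\nu_1+\int f^*\,d\nu_2\right\}$, the integrals being well defined in $\mathbb{R}\cup\{+\infty\}$. *)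

theory Defs
  imports "HOL-Probability.Probability"
begin

definition lsc :: "('a::topological_space \<Rightarrow> ereal) \<Rightarrow> bool" where
  "lsc f \<longleftrightarrow> (\<forall>x. f x \<le> Liminf (at x) f)"

(* For functions avoiding -\<infinity>; at the endpoints t = 0, 1 the condition is trivial because 0 * \<infinity> = 0. *)
definition ereal_convex :: "('a::real_vector \<Rightarrow> ereal) \<Rightarrow> bool" where
  "ereal_convex f \<longleftrightarrow>
     (\<forall>x y. \<forall>t\<in>{0..1}. f ((1 - t) *\<^sub>R x + t *\<^sub>R y) \<le> ereal (1 - t) * f x + ereal t * f y)"

definition convex_lsc_fns :: "(real ^ 'n \<Rightarrow> ereal) set" where
  "convex_lsc_fns =
     {f. (\<forall>x. f x \<noteq> -\<infinity>) \<and> (\<exists>x. f x \<noteq> \<infinity>) \<and> lsc f \<and> ereal_convex f}"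

definition sign_change :: "real ^ 'n \<Rightarrow> real ^ 'n \<Rightarrow> real ^ 'n" where
  "sign_change \<epsilon> x = (\<chi> i. \<epsilon> $ i * x $ i)"

definition sign_vectors :: "(real ^ 'n) set" where
  "sign_vectors = {\<epsilon>. \<forall>i. \<epsilon> $ i \<in> {-1, 1}}"

definition symmetric_fns :: "(real ^ 'n \<Rightarrow> ereal) set" where
  "symmetric_fns = {f. \<forall>x. f (- x) = f x}"

definition unconditional_fns :: "(real ^ 'n \<Rightarrow> ereal) set" where
  "unconditional_fns = {f. \<forall>\<epsilon>\<in>sign_vectors. \<forall>x. f (sign_change \<epsilon> x) = f x}"

definition symmetric_law :: "(real ^ 'n) measure \<Rightarrow> bool" where
  "symmetric_law \<mu> \<longleftrightarrow> distr \<mu> borel uminus = \<mu>"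

definition unconditional_law :: "(real ^ 'n) measure \<Rightarrow> bool" where
  "unconditional_law \<mu> \<longleftrightarrow> (\<forall>\<epsilon>\<in>sign_vectors. distr \<mu> borel (sign_change \<epsilon>) = \<mu>)"

definition legendre :: "(real ^ 'n \<Rightarrow> ereal) \<Rightarrow> real ^ 'n \<Rightarrow> ereal" where
  "legendre f y = (SUP x. ereal (x \<bullet> y) - f x)"

definition exp_neg :: "ereal \<Rightarrow> ennreal" where
  "exp_neg u = (if u = \<infinity> then 0 else if u = -\<infinity> then \<infinity> else ennreal (exp (- real_of_ereal u)))"

(* The inverse functional Santalo inequality with constant c over a class F of functions. *)
definition inverse_santalo :: "(real ^ 'n \<Rightarrow> ereal) set \<Rightarrow> real \<Rightarrow> bool" where
  "inverse_santalo F c \<longleftrightarrow>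
     (\<forall>f\<in>F. 0 < (\<integral>\<^sup>+x. exp_neg (f x) \<partial>lborel) \<longrightarrow>
            0 < (\<integral>\<^sup>+x. exp_neg (legendre f x) \<partial>lborel) \<longrightarrow>
            ennreal (c ^ CARD('n))
              \<le> (\<integral>\<^sup>+x. exp_neg (f x) \<partial>lborel) * (\<integral>\<^sup>+x. exp_neg (legendre f x) \<partial>lborel))"

(* A convex V is differentiable almost everywhere; the value 0 elsewhere is irrelevant for
   push-forwards of absolutely continuous measures. *)
definition gradient :: "(real ^ 'n \<Rightarrow> real) \<Rightarrow> real ^ 'n \<Rightarrow> real ^ 'n" where
  "gradient V x = (if V differentiable (at x) then (THE D. GDERIV V x :> D) else 0)"

definition moment_measure :: "(real ^ 'n \<Rightarrow> real) \<Rightarrow> (real ^ 'n) measure" where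
  "moment_measure V =
     distr (density lborel (\<lambda>x. ennreal (exp (- V x)))) borel (gradient V)"

(* If distr M lborel X has density h, then KL_divergence (exp 1) lborel (distr M lborel X) is the
   integral of h * ln h over lborel; see KL_density. *)
definition entropy_power :: "'a measure \<Rightarrow> ('a \<Rightarrow> real ^ 'n) \<Rightarrow> real" where
  "entropy_power M X =
     1 / (2 * pi * exp 1) *
     exp (- (2 / real CARD('n)) * KL_divergence (exp 1) lborel (distr M lborel X))"

(* Integral of the positive part minus integral of the negative part; intended for functions
   whose negative part is integrable. *)
definition ereal_integral :: "'a measure \<Rightarrow> ('a \<Rightarrow> ereal) \<Rightarrow> ereal" where
  "ereal_integral \<mu> f =
     enn2ereal (\<integral>\<^sup>+x. e2ennreal (f x) \<partial>\<mu>) - enn2ereal (\<integral>\<^sup>+x. e2ennreal (- f x) \<partial>\<mu>)"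

definition transport_cost :: "(real ^ 'n) measure \<Rightarrow> (real ^ 'n) measure \<Rightarrow> ereal" where
  "transport_cost \<nu>\<^sub>1 \<nu>\<^sub>2 =
     (INF f\<in>convex_lsc_fns. ereal_integral \<nu>\<^sub>1 f + ereal_integral \<nu>\<^sub>2 (legendre f))"

end

theory Submission
  imports Defs
begin

text \<open>
  Let \<open>H\<^sub>1\<close>, \<open>H\<^sub>2\<close> be the entropies \<open>\<integral> h ln h\<close> of the two laws, and \<open>n\<close> the dimension. The
  heart of the matter is a variational inequality for one log-concave law with potential \<open>V\<close>, entropy \<open>H\<close>
  and moment measure \<open>\<nu>\<close>: for every \<open>f\<close>,
  \<open>\<integral> f d\<nu> \<ge> n + H + ln (\<integral> exp (- f\<^sup>*))\<close> (\<open>moment_measure_inequality\<close>). Applying it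
  to \<open>f\<close> with the first law and to its conjugate with the second law and adding up, the inverse Santalo
  inequality gives \<open>\<integral> f d\<nu>\<^sub>1 + \<integral> f\<^sup>* d\<nu>\<^sub>2 \<ge> 2 n + H\<^sub>1 + H\<^sub>2 + n ln c\<close>. The left-hand side is homogeneous
  of degree 1 under scaling of a moment measure, whereas the right-hand side changes logarithmically. Optimizing over
  the scale turns the bound into \<open>n c exp (1 + (H\<^sub>1 + H\<^sub>2) / n)\<close> (\<open>transport_pair_ge\<close>), and
  squaring it cancels the entropy powers exactly.

  If the laws are invariant under a group of sign changes, so are the moment measures, and \<open>f\<close>
  may be replaced by an average over the group, to which the restricted inverse Santalo inequality applies.
  The trivial group, the group generated by the reflection in the origin and the group of all sign changes give the three cases.

  The variational inequality is the first-order term of the Prekopa--Leindler inequality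
  (\<open>prekopa_leindler\<close>) along a perturbation of \<open>exp (- V)\<close> towards \<open>exp (- f\<^sup>*)\<close>: by the
  gradient inequality for \<open>V\<close>, the perturbed density is at most \<open>exp (- V + s f(\<nabla>V))\<close>
  up to a small correction (\<open>prekopa_leindler_perturbation\<close>). The dimension enters
  through a dilation of \<open>V\<close> and the entropy through Jensen's inequality. Three facts about a convex \<open>V\<close> with integrable \<open>exp (- V)\<close> support this: \<open>V\<close> grows
  at least linearly, so its entropy is finite; it is differentiable almost everywhere, so that
  the gradient push-forward makes sense; and the moment measure is not carried by a hyperplane
  (\<open>interior_nonempty_if_AE_gradient\<close>), so that the integrals in the inverse Santalo inequality are positive.
\<close>

section \<open>The Prekopa--Leindler inequality\<close>

text \<open>The one-dimensional Brunn--Minkowski inequality. For compact sets with maximum \<open>a\<close> and minimum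
  \<open>b\<close> the translates \<open>b + A\<close> and \<open>a + B\<close> both lie in the sum set and meet only in \<open>a + b\<close>; bounded
  Borel sets are approximated from inside by compact ones. Measuring a Borel set \<open>C\<close> that contains the
  sum set avoids the question of whether the sum set itself is measurable.\<close>

lemma emeasure_sum_set_ge:
  fixes A B C :: "real set"
  assumes A: "A \<in> sets borel" "bounded A" "A \<noteq> {}"
    and B: "B \<in> sets borel" "bounded B" "B \<noteq> {}"
    and C: "C \<in> sets borel" and sub: "\<And>a b. a \<in> A \<Longrightarrow> b \<in> B \<Longrightarrow> a + b \<in> C"
  shows "emeasure lborel A + emeasure lborel B \<le> emeasure lborel C"
proof (rule ennreal_le_epsilon)
  fix e :: real assume e: "0 < e"
  have approx: "\<exists>K. compact K \<and> K \<noteq> {} \<and> K \<subseteq> S \<and> emeasure lborel S \<le> emeasure lborel K + ennreal (e/2)"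
    if S: "S \<in> sets borel" "bounded S" "S \<noteq> {}" for S :: "real set"
  proof -
    have "S \<in> sets lebesgue" using S by simp
    then obtain T where T: "closed T" "T \<subseteq> S" "emeasure lebesgue (S - T) < ennreal (e/2)"
      using sets_lebesgue_inner_closed[of S "e/2"] e by (metis half_gt_zero)
    obtain s where s: "s \<in> S" using S by auto
    define K where "K = insert s T"
    have "compact T" using T S bounded_subset compact_eq_bounded_closed by blast
    then have K: "compact K" by (simp add: K_def)
    have Tb: "T \<in> sets borel" using T by simp
    have "emeasure lborel S \<le> emeasure lborel (T \<union> (S - T))"
      by (rule emeasure_mono) (use S Tb in auto)
    also have "\<dots> \<le> emeasure lborel T + emeasure lborel (S - T)"
      by (rule emeasure_subadditive) (use S Tb in auto)
    also have "\<dots> \<le> emeasure lborel K + ennreal (e/2)"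
    proof (rule add_mono)
      show "emeasure lborel T \<le> emeasure lborel K"
        by (rule emeasure_mono) (use Tb in \<open>auto simp: K_def\<close>)
      have "emeasure lborel (S - T) = emeasure lebesgue (S - T)"
        using S Tb by (simp add: emeasure_completion)
      then show "emeasure lborel (S - T) \<le> ennreal (e/2)" using T(3) by simp
    qed
    finally show ?thesis using K s T by (intro exI[of _ K]) (auto simp: K_def)
  qed
  obtain K where K: "compact K" "K \<noteq> {}" "K \<subseteq> A" "emeasure lborel A \<le> emeasure lborel K + ennreal (e/2)"
    using approx[OF A] by blast
  obtain L where L: "compact L" "L \<noteq> {}" "L \<subseteq> B" "emeasure lborel B \<le> emeasure lborel L + ennreal (e/2)"
    using approx[OF B] by blast
  obtain a where a: "a \<in> K" "\<And>x. x \<in> K \<Longrightarrow> x \<le> a" using compact_attains_sup[OF K(1,2)] by blast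
  obtain b where b: "b \<in> L" "\<And>x. x \<in> L \<Longrightarrow> b \<le> x" using compact_attains_inf[OF L(1,2)] by blast
  have Kb: "K \<in> sets borel" and Lb: "L \<in> sets borel" using K L by (auto simp: borel_compact)
  have tr: "emeasure lborel ((+) t ` S) = emeasure lborel S" if "S \<in> sets borel" for t and S :: "real set"
  proof -
    have "(+) t ` S = (+) (-t) -` S"
    proof safe
      fix x assume "- t + x \<in> S" then show "x \<in> (+) t ` S" by (intro image_eqI[of _ _ "- t + x"]) auto
    qed simp
    moreover have "emeasure (distr lborel borel ((+) (-t))) S = emeasure lborel S"
      by (simp only: lborel_distr_plus)
    ultimately show ?thesis using that by (simp add: emeasure_distr)
  qed
  let ?K = "(+) b ` K" and ?L = "(+) a ` L"
  have cK: "compact ?K" "compact ?L" using K L by (auto intro!: compact_translation)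
  have sK: "?K \<in> sets borel" "?L \<in> sets borel" using cK by (auto simp: borel_compact)
  have "emeasure lborel K + emeasure lborel L = emeasure lborel ?K + emeasure lborel ?L"
    using tr[OF Kb] tr[OF Lb] by simp
  also have "\<dots> = emeasure lborel (?K - {a + b}) + emeasure lborel ?L"
    using emeasure_Diff_null_set[of "{a + b}" lborel ?K] sK finite_imp_null_set_lborel[of "{a + b}"] by simp
  also have "\<dots> = emeasure lborel ((?K - {a + b}) \<union> ?L)"
  proof (rule plus_emeasure)
    show "(?K - {a + b}) \<inter> ?L = {}" 
    proof (rule equals0I)
      fix z assume "z \<in> (?K - {a + b}) \<inter> ?L"
      then obtain x y where "x \<in> K" "y \<in> L" "z = b + x" "z = a + y" "z \<noteq> a + b" by blast
      then show False using a(2)[of x] b(2)[of y] by linarith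
    qed
  qed (use sK in auto)
  also have "\<dots> \<le> emeasure lborel C"
  proof (rule emeasure_mono)
    show "(?K - {a + b}) \<union> ?L \<subseteq> C" 
    proof
      fix z assume "z \<in> (?K - {a + b}) \<union> ?L"
      then consider x where "x \<in> K" "z = x + b" | y where "y \<in> L" "z = a + y" by (auto simp: add.commute)
      then show "z \<in> C" using sub[of _ b] sub[of a] K(3) L(3) a(1) b(1) by cases (auto simp: subset_iff)
    qed
  qed (use C in auto)
  finally have *: "emeasure lborel K + emeasure lborel L \<le> emeasure lborel C" .
  have "emeasure lborel A + emeasure lborel B \<le>
      (emeasure lborel K + ennreal (e/2)) + (emeasure lborel L + ennreal (e/2))"
    using K L by (intro add_mono) auto
  also have "\<dots> = emeasure lborel K + emeasure lborel L + (ennreal (e/2) + ennreal (e/2))"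
    by (simp add: ac_simps)
  also have "ennreal (e/2) + ennreal (e/2) = ennreal e"
    using e by (subst ennreal_plus[symmetric]) auto
  finally show "emeasure lborel A + emeasure lborel B \<le> emeasure lborel C + ennreal e"
    using * by (meson add_right_mono order_trans)
qed

text \<open>Layer cake formula, truncated at height 1 because Brunn--Minkowski will only be applied to level
  sets that are nonempty for both functions.\<close>

lemma nn_integral_min_1_eq_level_sets:
  fixes w :: "real \<Rightarrow> ennreal"
  assumes [measurable]: "w \<in> borel_measurable borel"
  shows "(\<integral>\<^sup>+x. min (w x) 1 \<partial>lborel) =
    (\<integral>\<^sup>+t. indicator {0<..<1} t * emeasure lborel {x. ennreal t < w x} \<partial>lborel)"
proof -
  have "(\<integral>\<^sup>+t. indicator {0<..<1} t * emeasure lborel {x. ennreal t < w x} \<partial>lborel)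
     = (\<integral>\<^sup>+t. (\<integral>\<^sup>+x. indicator {0<..<1} t * indicator {x. ennreal t < w x} x \<partial>lborel) \<partial>lborel)"
    by (intro nn_integral_cong, subst nn_integral_cmult_indicator) simp_all
  also have "\<dots> = (\<integral>\<^sup>+x. (\<integral>\<^sup>+t. indicator {0<..<1} t * indicator {x. ennreal t < w x} x \<partial>lborel) \<partial>lborel)"
  proof (rule lborel_pair.Fubini')
    have "{z \<in> space (lborel \<Otimes>\<^sub>M lborel). ennreal (snd z) < w (fst z)} \<in> sets (lborel \<Otimes>\<^sub>M lborel)"
      by measurable
    then have [measurable]: "{z. ennreal (snd z) < w (fst z)} \<in> sets (lborel \<Otimes>\<^sub>M lborel)"
      by (simp add: space_pair_measure)
    have "(\<lambda>z. indicator {0<..<1::real} (snd z) * indicator {z. ennreal (snd z) < w (fst z)} z :: ennreal)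
      \<in> borel_measurable (lborel \<Otimes>\<^sub>M lborel)"
      by measurable
    then show "(\<lambda>(x, t). indicator {0<..<1::real} t * indicator {x. ennreal t < w x} x :: ennreal)
      \<in> borel_measurable (lborel \<Otimes>\<^sub>M lborel)"
      by (simp add: case_prod_beta' indicator_def)
  qed
  also have "\<dots> = (\<integral>\<^sup>+x. min (w x) 1 \<partial>lborel)"
  proof (intro nn_integral_cong)
    fix x :: real
    have *: "(\<integral>\<^sup>+t. indicator {0<..<1} t * indicator {x. ennreal t < w x} x \<partial>lborel)
      = (\<integral>\<^sup>+t. indicator {0<..<enn2real (min (w x) 1)} t \<partial>lborel)"
    proof (intro nn_integral_cong)
      fix t :: real
      show "indicator {0<..<1} t * indicator {x. ennreal t < w x} x =
        (indicator {0<..<enn2real (min (w x) 1)} t :: ennreal)"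
        by (cases "w x") (auto simp: indicator_def min_def ennreal_less_iff top_unique split: if_splits)
    qed
    have "min (w x) 1 < top" by (simp add: min_less_iff_disj)
    then show "(\<integral>\<^sup>+t. indicator {0<..<1} t * indicator {x. ennreal t < w x} x \<partial>lborel) = min (w x) 1"
      unfolding * by (simp add: nn_integral_indicator less_top)
  qed
  finally show ?thesis by simp
qed

text \<open>When both suprema are 1, the level sets of \<open>u\<close> and \<open>v\<close> at each height \<open>t < 1\<close> are nonempty and
  their sum set lies in the level set of \<open>w\<close>; integrate Brunn--Minkowski over \<open>t\<close>.\<close>

lemma prekopa_leindler_1_normalized:
  fixes u v :: "real \<Rightarrow> real" and w :: "real \<Rightarrow> ennreal"
  assumes [measurable]: "u \<in> borel_measurable borel" "v \<in> borel_measurable borel" "w \<in> borel_measurable borel"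
    and u: "\<And>x. 0 \<le> u x" "\<And>x. u x \<le> 1" "\<And>x. \<bar>x\<bar> > R \<Longrightarrow> u x = 0" "\<And>t. t < 1 \<Longrightarrow> \<exists>x. t < u x"
    and v: "\<And>x. 0 \<le> v x" "\<And>x. v x \<le> 1" "\<And>x. \<bar>x\<bar> > R \<Longrightarrow> v x = 0" "\<And>t. t < 1 \<Longrightarrow> \<exists>x. t < v x"
    and w: "\<And>x y t. 0 < t \<Longrightarrow> t < u x \<Longrightarrow> t < v y \<Longrightarrow> ennreal t < w (x + y)"
  shows "(\<integral>\<^sup>+x. u x \<partial>lborel) + (\<integral>\<^sup>+x. v x \<partial>lborel) \<le> (\<integral>\<^sup>+x. w x \<partial>lborel)"
proof -
  have one: "(\<integral>\<^sup>+x. ennreal (f x) \<partial>lborel) =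
     (\<integral>\<^sup>+t. indicator {0<..<1} t * emeasure lborel {x. t < f x} \<partial>lborel)"
    if [measurable]: "f \<in> borel_measurable borel" and f: "\<And>x. 0 \<le> f x" "\<And>x. f x \<le> 1" for f :: "real \<Rightarrow> real"
  proof -
    have "(\<integral>\<^sup>+x. ennreal (f x) \<partial>lborel) = (\<integral>\<^sup>+x. min (ennreal (f x)) 1 \<partial>lborel)"
      by (intro nn_integral_cong) (use f in \<open>auto simp: min_def ennreal_le_1\<close>)
    also have "\<dots> = (\<integral>\<^sup>+t. indicator {0<..<1} t * emeasure lborel {x. ennreal t < ennreal (f x)} \<partial>lborel)"
      by (rule nn_integral_min_1_eq_level_sets) simp
    also have "\<dots> = (\<integral>\<^sup>+t. indicator {0<..<1} t * emeasure lborel {x. t < f x} \<partial>lborel)"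
      by (intro nn_integral_cong) (auto simp: indicator_def ennreal_less_iff)
    finally show ?thesis .
  qed
  have meas: "(\<lambda>t. emeasure lborel {x. t < f x}) \<in> borel_measurable borel"
    if [measurable]: "f \<in> borel_measurable borel" for f :: "real \<Rightarrow> real"
  proof -
    have "{z \<in> space (borel \<Otimes>\<^sub>M lborel). fst z < f (snd z)} \<in> sets (borel \<Otimes>\<^sub>M lborel)"
      by measurable
    from lborel.measurable_emeasure_Pair[OF this]
    show ?thesis by (simp add: vimage_def space_pair_measure)
  qed
  have bd: "bounded {x. t < f x}" if "0 < t" "\<And>x. \<bar>x\<bar> > R \<Longrightarrow> f x = 0" for f :: "real \<Rightarrow> real" and t
  proof (rule boundedI)
    fix x assume "x \<in> {x. t < f x}"
    then have "f x \<noteq> 0" using that(1) by auto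
    then show "norm x \<le> R" using that(2)[of x] by (cases "\<bar>x\<bar> > R") auto
  qed
  have [measurable]: "(\<lambda>t. emeasure lborel {x. t < u x}) \<in> borel_measurable borel"
    "(\<lambda>t. emeasure lborel {x. t < v x}) \<in> borel_measurable borel"
    by (rule meas, fact)+
  have "(\<integral>\<^sup>+x. u x \<partial>lborel) + (\<integral>\<^sup>+x. v x \<partial>lborel) =
    (\<integral>\<^sup>+t. indicator {0<..<1} t * emeasure lborel {x. t < u x}
       + indicator {0<..<1} t * emeasure lborel {x. t < v x} \<partial>lborel)"
    unfolding one[OF assms(1) u(1,2)] one[OF assms(2) v(1,2)]
    by (rule nn_integral_add[symmetric]) simp_all
  also have "\<dots> \<le> (\<integral>\<^sup>+t. indicator {0<..<1} t * emeasure lborel {x. ennreal t < w x} \<partial>lborel)"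
  proof (intro nn_integral_mono)
    fix t :: real
    have "emeasure lborel {x. t < u x} + emeasure lborel {x. t < v x} \<le> emeasure lborel {x. ennreal t < w x}"
      if "0 < t" "t < 1"
    proof (rule emeasure_sum_set_ge)
      show "{x. t < u x} \<noteq> {}" "{x. t < v x} \<noteq> {}" using u(4) v(4) that by auto
      show "bounded {x. t < u x}" "bounded {x. t < v x}" using bd that u(3) v(3) by blast+
      show "{x. t < u x} \<in> sets borel" "{x. t < v x} \<in> sets borel" "{x. ennreal t < w x} \<in> sets borel"
        by measurable
      show "a + b \<in> {x. ennreal t < w x}" if "a \<in> {x. t < u x}" "b \<in> {x. t < v x}" for a b
        using w[OF \<open>0 < t\<close>, of a b] that by simp
    qed
    then show "indicator {0<..<1} t * emeasure lborel {x. t < u x}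
       + indicator {0<..<1} t * emeasure lborel {x. t < v x}
       \<le> indicator {0<..<1} t * emeasure lborel {x. ennreal t < w x}"
      by (auto simp: indicator_def)
  qed
  also have "\<dots> = (\<integral>\<^sup>+x. min (w x) 1 \<partial>lborel)"
    by (rule nn_integral_min_1_eq_level_sets[symmetric]) simp
  also have "\<dots> \<le> (\<integral>\<^sup>+x. w x \<partial>lborel)" by (intro nn_integral_mono) simp
  finally show ?thesis .
qed


text \<open>Dividing \<open>u\<close> and \<open>v\<close> by their suprema \<open>A\<close> and \<open>B\<close>, and \<open>w\<close> by \<open>A\<close>, \<open>B\<close> weighted geometrically,
  reduces to the normalized case, whose additive conclusion is stronger than the multiplicative one by
  Young's inequality. The hypothesis involves \<open>x + y\<close> rather than a convex combination, which moves all
  scaling factors into the constants \<open>1 - s\<close> and \<open>s\<close> of the conclusion; in this form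
  the inequality tensorizes without any change of variables.\<close>

lemma prekopa_leindler_1:
  fixes u v :: "real \<Rightarrow> real" and w :: "real \<Rightarrow> ennreal"
  assumes [measurable]: "u \<in> borel_measurable borel" "v \<in> borel_measurable borel" "w \<in> borel_measurable borel"
    and s: "0 < s" "s < 1"
    and u: "\<And>x. 0 \<le> u x" "\<And>x. u x \<le> C" "\<And>x. \<bar>x\<bar> > R \<Longrightarrow> u x = 0"
    and v: "\<And>x. 0 \<le> v x" "\<And>x. v x \<le> C" "\<And>x. \<bar>x\<bar> > R \<Longrightarrow> v x = 0"
    and w: "\<And>x y. ennreal (u x powr (1 - s) * v y powr s) \<le> w (x + y)"
    and U: "(\<integral>\<^sup>+x. u x \<partial>lborel) = ennreal U" "0 \<le> U"
    and V: "(\<integral>\<^sup>+x. v x \<partial>lborel) = ennreal V" "0 \<le> V"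
  shows "ennreal ((U / (1 - s)) powr (1 - s) * (V / s) powr s) \<le> (\<integral>\<^sup>+x. w x \<partial>lborel)"
proof (cases "U = 0 \<or> V = 0")
  case True
  then show ?thesis by auto
next
  case False
  define A where "A = Sup (range u)"
  define B where "B = Sup (range v)"
  have bdd: "bdd_above (range u)" "bdd_above (range v)" using u v by (auto intro!: bdd_aboveI[of _ C])
  have le: "u x \<le> A" "v x \<le> B" for x unfolding A_def B_def by (intro cSUP_upper bdd; simp)+
  have "A \<noteq> 0"
  proof
    assume "A = 0"
    then have "u x = 0" for x using le(1)[of x] u(1)[of x] by simp
    then show False using U False by simp
  qed
  then have A: "0 < A" using le(1)[of 0] u(1)[of 0] by simp
  have "B \<noteq> 0"
  proof
    assume "B = 0"
    then have "v x = 0" for x using le(2)[of x] v(1)[of x] by simp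
    then show False using V False by simp
  qed
  then have B: "0 < B" using le(2)[of 0] v(1)[of 0] by simp
  define G where "G = A powr (1 - s) * B powr s"
  have G: "0 < G" using A B by (simp add: G_def)
  have "(\<integral>\<^sup>+x. ennreal (u x / A) \<partial>lborel) + (\<integral>\<^sup>+x. ennreal (v x / B) \<partial>lborel) \<le> (\<integral>\<^sup>+x. w x * ennreal (1 / G) \<partial>lborel)"
  proof (rule prekopa_leindler_1_normalized[where R = R])
    show "\<exists>x. t < u x / A" if "t < 1" for t
    proof -
      have "t * A < Sup (range u)" using that A by (simp add: A_def[symmetric])
      then obtain x where "t * A < u x" using less_cSUP_iff[OF _ bdd(1)] by auto
      then show ?thesis using A by (auto simp: field_simps)
    qed
    show "\<exists>x. t < v x / B" if "t < 1" for t
    proof -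
      have "t * B < Sup (range v)" using that B by (simp add: B_def[symmetric])
      then obtain x where "t * B < v x" using less_cSUP_iff[OF _ bdd(2)] by auto
      then show ?thesis using B by (auto simp: field_simps)
    qed
    show "ennreal t < w (x + y) * ennreal (1 / G)" if t: "0 < t" "t < u x / A" "t < v y / B" for x y t
    proof -
      have 1: "t * A < u x" "t * B < v y" using t A B by (auto simp: field_simps)
      have "t * G = (t powr (1 - s) * t powr s) * G" using t by (simp flip: powr_add)
      also have "\<dots> = (t * A) powr (1 - s) * (t * B) powr s"
        using t A B by (simp add: G_def powr_mult)
      also have "\<dots> < u x powr (1 - s) * v y powr s"
        using 1 t A B s by (intro mult_strict_mono powr_less_mono2) auto
      finally have "t < (u x powr (1 - s) * v y powr s) * (1 / G)" using G by (simp add: field_simps)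
      then have "ennreal t < ennreal ((u x powr (1 - s) * v y powr s) * (1 / G))"
        using t by (simp add: ennreal_less_iff)
      also have "\<dots> = ennreal (u x powr (1 - s) * v y powr s) * ennreal (1 / G)"
        using G by (intro ennreal_mult) auto
      also have "\<dots> \<le> w (x + y) * ennreal (1 / G)" by (intro mult_right_mono w) simp
      finally show ?thesis .
    qed
  qed (use u v le A B in auto)
  also have "(\<integral>\<^sup>+x. ennreal (u x / A) \<partial>lborel) = ennreal (U / A)"
    using U A u by (simp add: divide_inverse ennreal_mult nn_integral_multc)
  also have "(\<integral>\<^sup>+x. ennreal (v x / B) \<partial>lborel) = ennreal (V / B)"
    using V B v by (simp add: divide_inverse ennreal_mult nn_integral_multc)
  also have "(\<integral>\<^sup>+x. w x * ennreal (1 / G) \<partial>lborel) = (\<integral>\<^sup>+x. w x \<partial>lborel) * ennreal (1 / G)"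
    by (simp add: nn_integral_multc)
  also have "ennreal (U / A) + ennreal (V / B) = ennreal (U / A + V / B)"
    using U V A B by (simp add: ennreal_plus)
  finally have *: "ennreal (U / A + V / B) \<le> (\<integral>\<^sup>+x. w x \<partial>lborel) * ennreal (1 / G)" .
  have "(U / A / (1 - s)) powr (1 - s) * (V / B / s) powr s
      \<le> (1 - s) * (U / A / (1 - s)) + s * (V / B / s)"
    using False U V A B s by (intro Youngs_inequality_0) auto
  also have "\<dots> = U / A + V / B" using s by simp
  finally have Y: "(U / A / (1 - s)) powr (1 - s) * (V / B / s) powr s \<le> U / A + V / B" .
  have "(U / (1 - s)) powr (1 - s) * (V / s) powr s =
     G * ((U / A / (1 - s)) powr (1 - s) * (V / B / s) powr s)"
    using A B s U V by (simp add: G_def powr_divide powr_mult)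
  also have "\<dots> \<le> G * (U / A + V / B)" using Y G by simp
  finally have "ennreal ((U / (1 - s)) powr (1 - s) * (V / s) powr s) \<le> ennreal (G * (U / A + V / B))"
    by (rule ennreal_leI)
  also have "\<dots> = ennreal (U / A + V / B) * ennreal G"
    using G U V A B by (simp add: ennreal_mult mult.commute)
  also have "\<dots> \<le> (\<integral>\<^sup>+x. w x \<partial>lborel) * ennreal (1 / G) * ennreal G"
    by (intro mult_right_mono *) simp
  also have "\<dots> = (\<integral>\<^sup>+x. w x \<partial>lborel)"
    using G by (simp add: mult.assoc flip: ennreal_mult)
  finally show ?thesis .
qed

text \<open>Keeps all partial integrals in the induction on the dimension finite, so that they are again
  bounded real functions that vanish outside an interval.\<close>

lemma nn_integral_PiM_box_bound:
  fixes f :: "('i \<Rightarrow> real) \<Rightarrow> real"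
  assumes I: "finite I" and "0 \<le> R" and C: "0 \<le> C"
    and f: "\<And>x. x \<in> space (Pi\<^sub>M I (\<lambda>_. lborel)) \<Longrightarrow> f x \<le> C"
      "\<And>x i. x \<in> space (Pi\<^sub>M I (\<lambda>_. lborel)) \<Longrightarrow> i \<in> I \<Longrightarrow> R < \<bar>x i\<bar> \<Longrightarrow> f x = 0"
  shows "(\<integral>\<^sup>+x. ennreal (f x) \<partial>Pi\<^sub>M I (\<lambda>_. lborel)) \<le> ennreal (C * (2 * R) ^ card I)"
proof -
  interpret product_sigma_finite "\<lambda>_::'i. lborel :: real measure" by standard
  have box: "(\<Pi>\<^sub>E i\<in>I. {-R..R}) \<in> sets (Pi\<^sub>M I (\<lambda>_. lborel :: real measure))"
    by (rule sets_PiM_I_finite) (use I in auto)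
  have "(\<integral>\<^sup>+x. ennreal (f x) \<partial>Pi\<^sub>M I (\<lambda>_. lborel)) \<le>
    (\<integral>\<^sup>+x. ennreal C * indicator (\<Pi>\<^sub>E i\<in>I. {-R..R}) x \<partial>Pi\<^sub>M I (\<lambda>_. lborel))"
  proof (rule nn_integral_mono)
    fix x :: "'i \<Rightarrow> real" assume x: "x \<in> space (Pi\<^sub>M I (\<lambda>_. lborel))"
    show "ennreal (f x) \<le> ennreal C * indicator (\<Pi>\<^sub>E i\<in>I. {-R..R}) x"
    proof (cases "\<exists>i\<in>I. R < \<bar>x i\<bar>")
      case True then show ?thesis using f(2)[OF x] by auto
    next
      case False
      then have "x \<in> (\<Pi>\<^sub>E i\<in>I. {-R..R})" using x by (force simp: space_PiM PiE_def)
      then show ?thesis using f(1)[OF x] by (simp add: ennreal_leI)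
    qed
  qed
  also have "\<dots> = ennreal C * (\<Prod>i\<in>I. emeasure lborel {-R..R})"
    using I box by (subst nn_integral_cmult_indicator) (auto simp: emeasure_PiM)
  also have "\<dots> = ennreal (C * (2 * R) ^ card I)"
  proof -
    have "(\<Prod>i\<in>I. emeasure lborel {-R..R}) = ennreal (2 * R) ^ card I" using \<open>0 \<le> R\<close> by simp
    also have "\<dots> = ennreal ((2 * R) ^ card I)" using \<open>0 \<le> R\<close> by (intro ennreal_power) simp
    finally show ?thesis using \<open>0 \<le> R\<close> C by (simp only: ennreal_mult zero_le_power zero_le_mult_iff zero_le_numeral simp_thms)
  qed
  finally show ?thesis .
qed

text \<open>Induction on the set of coordinates: for fixed values \<open>t\<close> and \<open>t'\<close> of the new coordinate the induction
  hypothesis compares the partial integrals of \<open>u\<close>, \<open>v\<close> and \<open>w\<close> at \<open>t\<close>, \<open>t'\<close> and \<open>t + t'\<close>, which is the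
  hypothesis of the one-dimensional inequality for the partial integrals.\<close>

lemma prekopa_leindler_PiM:
  fixes u v :: "('i \<Rightarrow> real) \<Rightarrow> real" and w :: "('i \<Rightarrow> real) \<Rightarrow> ennreal"
  assumes "finite I" and s: "0 < s" "s < 1"
    and "u \<in> borel_measurable (Pi\<^sub>M I (\<lambda>_. lborel))" "v \<in> borel_measurable (Pi\<^sub>M I (\<lambda>_. lborel))"
    "w \<in> borel_measurable (Pi\<^sub>M I (\<lambda>_. lborel))"
    and C: "0 \<le> C" and R: "0 \<le> R"
    and "\<And>x. 0 \<le> u x" "\<And>x. u x \<le> C" "\<And>x i. i \<in> I \<Longrightarrow> \<bar>x i\<bar> > R \<Longrightarrow> u x = 0"
    and "\<And>x. 0 \<le> v x" "\<And>x. v x \<le> C" "\<And>x i. i \<in> I \<Longrightarrow> \<bar>x i\<bar> > R \<Longrightarrow> v x = 0"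
    and "\<And>x y. x \<in> extensional I \<Longrightarrow> y \<in> extensional I \<Longrightarrow>
      ennreal (u x powr (1 - s) * v y powr s) \<le> w (\<lambda>i\<in>I. x i + y i)"
    and "(\<integral>\<^sup>+x. u x \<partial>Pi\<^sub>M I (\<lambda>_. lborel)) = ennreal U" "0 \<le> U"
    and "(\<integral>\<^sup>+x. v x \<partial>Pi\<^sub>M I (\<lambda>_. lborel)) = ennreal V" "0 \<le> V"
  shows "ennreal ((U / (1 - s) ^ card I) powr (1 - s) * (V / s ^ card I) powr s)
    \<le> (\<integral>\<^sup>+x. w x \<partial>Pi\<^sub>M I (\<lambda>_. lborel))"
  using assms(1,4-6,9-19)
proof (induction I arbitrary: u v w U V)
  case empty
  interpret product_sigma_finite "\<lambda>_::'i. lborel :: real measure" by standard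
  have "u (\<lambda>_. undefined) = U" "v (\<lambda>_. undefined) = V"
    using empty by (simp_all add: nn_integral_empty)
  then show ?case
    using empty(10)[of "\<lambda>_. undefined" "\<lambda>_. undefined"] by (simp add: nn_integral_empty restrict_def)
next
  case (insert i I)
  interpret product_sigma_finite "\<lambda>_::'i. lborel :: real measure" by standard
  let ?M = "Pi\<^sub>M I (\<lambda>_. lborel :: real measure)"
  let ?k = "card I"
  note [measurable] = insert.prems(1,2,3)
  define boxed where "boxed f \<longleftrightarrow> (\<forall>x. 0 \<le> f x \<and> f x \<le> C) \<and> (\<forall>x. \<forall>j\<in>insert i I. R < \<bar>x j\<bar> \<longrightarrow> f x = 0)"
    for f :: "('i \<Rightarrow> real) \<Rightarrow> real"
  have boxed: "boxed u" "boxed v" unfolding boxed_def using insert.prems by simp_all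
  define Q where "Q f t = enn2real (\<integral>\<^sup>+x. ennreal (f (x(i := t))) \<partial>?M)" for f :: "('i \<Rightarrow> real) \<Rightarrow> real" and t
  have upd: "(\<lambda>x. f (x(i := t))) \<in> borel_measurable ?M"
    if "f \<in> borel_measurable (Pi\<^sub>M (insert i I) (\<lambda>_. lborel))" for f :: "('i \<Rightarrow> real) \<Rightarrow> real" and t
    by (rule measurable_compose[OF _ that], rule measurable_fun_upd[where J = I]) auto
  have upd': "(\<lambda>x. f (x(i := t))) \<in> borel_measurable ?M"
    if "f \<in> borel_measurable (Pi\<^sub>M (insert i I) (\<lambda>_. lborel))" for f :: "('i \<Rightarrow> real) \<Rightarrow> ennreal" and t
    by (rule measurable_compose[OF _ that], rule measurable_fun_upd[where J = I]) auto
  have Q: "(\<integral>\<^sup>+x. ennreal (f (x(i := t))) \<partial>?M) = ennreal (Q f t)" "Q f t \<le> C * (2 * R) ^ ?k"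
     "R < \<bar>t\<bar> \<Longrightarrow> Q f t = 0"
    if "boxed f"
    for f :: "('i \<Rightarrow> real) \<Rightarrow> real" and t
  proof -
    have f: "\<And>x. 0 \<le> f x" "\<And>x. f x \<le> C" "\<And>x j. j \<in> insert i I \<Longrightarrow> \<bar>x j\<bar> > R \<Longrightarrow> f x = 0" for x
      using that unfolding boxed_def by auto
    have *: "(\<integral>\<^sup>+x. ennreal (f (x(i := t))) \<partial>?M) \<le> ennreal (C * (2 * R) ^ ?k)"
    proof (rule nn_integral_PiM_box_bound)
      show "f (x(i := t)) = 0" if "j \<in> I" "R < \<bar>x j\<bar>" for x j
        using f(3)[of j "x(i := t)"] that insert.hyps by (cases "j = i") auto
    qed (use insert R C f in auto)
    then have "(\<integral>\<^sup>+x. ennreal (f (x(i := t))) \<partial>?M) < top" by (rule le_less_trans) simp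
    then show 1: "(\<integral>\<^sup>+x. ennreal (f (x(i := t))) \<partial>?M) = ennreal (Q f t)" by (simp add: Q_def)
    show "Q f t \<le> C * (2 * R) ^ ?k" using * C R unfolding 1 by (simp add: ennreal_le_iff)
    show "Q f t = 0" if "R < \<bar>t\<bar>" using f(3)[of i] that by (simp add: Q_def)
  qed
  have Q0: "0 \<le> Q f t" for f t by (simp add: Q_def)
  have Qm: "Q f \<in> borel_measurable borel"
    if [measurable]: "f \<in> borel_measurable (Pi\<^sub>M (insert i I) (\<lambda>_. lborel))" for f :: "('i \<Rightarrow> real) \<Rightarrow> real"
  proof -
    have "(\<lambda>z. ennreal (f ((snd z)(i := fst z)))) \<in> borel_measurable (borel \<Otimes>\<^sub>M ?M)"
      by measurable
    then show ?thesis unfolding Q_def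
      by (intro borel_measurable_enn2real sigma_finite_measure.borel_measurable_nn_integral)
        (auto simp: case_prod_beta' intro!: sigma_finite insert.hyps)
  qed
  let ?W = "\<lambda>t. \<integral>\<^sup>+x. w (x(i := t)) \<partial>?M"
  have IH: "ennreal ((Q u t / (1 - s) ^ ?k) powr (1 - s) * (Q v t' / s ^ ?k) powr s) \<le> ?W (t + t')" for t t'
  proof (rule insert.IH)
    show "(\<lambda>x. w (x(i := t + t'))) \<in> borel_measurable ?M"
      by (rule upd', fact)
    show "u (x(i := t)) = 0" if "j \<in> I" "R < \<bar>x j\<bar>" for x j
      using insert.prems(6)[of j "x(i := t)"] that insert.hyps unfolding fun_upd_def by (cases "j = i") auto
    show "v (x(i := t')) = 0" if "j \<in> I" "R < \<bar>x j\<bar>" for x j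
      using insert.prems(9)[of j "x(i := t')"] that insert.hyps unfolding fun_upd_def by (cases "j = i") auto
    show "ennreal (u (x(i := t)) powr (1 - s) * v (y(i := t')) powr s)
      \<le> w ((\<lambda>j\<in>I. x j + y j)(i := t + t'))" if "x \<in> extensional I" "y \<in> extensional I" for x y
    proof -
      have "(\<lambda>j\<in>insert i I. (x(i := t)) j + (y(i := t')) j) = (\<lambda>j\<in>I. x j + y j)(i := t + t')"
        using insert.hyps by (auto simp: fun_eq_iff)
      then show ?thesis
        using insert.prems(10)[of "x(i := t)" "y(i := t')"] that
        by (simp add: extensional_def del: fun_upd_apply) (simp add: fun_upd_def)
    qed
    show "(\<integral>\<^sup>+x. ennreal (u (x(i := t))) \<partial>?M) = ennreal (Q u t)" by (rule Q(1)[OF boxed(1)])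
    show "(\<integral>\<^sup>+x. ennreal (v (x(i := t'))) \<partial>?M) = ennreal (Q v t')" by (rule Q(1)[OF boxed(2)])
    show "(\<lambda>x. u (x(i := t))) \<in> borel_measurable ?M" "(\<lambda>x. v (x(i := t'))) \<in> borel_measurable ?M"
      by (rule upd, fact)+
  qed (use insert.prems Q0 in simp_all)
  define C' where "C' = C * (2 * R) ^ ?k / (1 - s) ^ ?k + C * (2 * R) ^ ?k / s ^ ?k"
  have tot: "(\<integral>\<^sup>+t. ennreal (Q f t / c) \<partial>lborel) = ennreal (F / c)"
    if [measurable]: "f \<in> borel_measurable (Pi\<^sub>M (insert i I) (\<lambda>_. lborel))"
    and f: "boxed f"
    and F: "(\<integral>\<^sup>+x. f x \<partial>Pi\<^sub>M (insert i I) (\<lambda>_. lborel)) = ennreal F" "0 \<le> F" and c: "0 < c"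
    for f :: "('i \<Rightarrow> real) \<Rightarrow> real" and F c
  proof -
    have [measurable]: "Q f \<in> borel_measurable borel" by (rule Qm) fact
    have Qf: "(\<integral>\<^sup>+x. ennreal (f (x(i := t))) \<partial>?M) = ennreal (Q f t)" for t
      by (rule Q(1)[OF f])
    have "ennreal F = (\<integral>\<^sup>+t. ennreal (Q f t) \<partial>lborel)"
      unfolding F(1)[symmetric]
      by (subst product_nn_integral_insert_rev) (use insert.hyps in \<open>simp_all add: Qf del: fun_upd_apply\<close>)
    then show ?thesis
      using F c Q0 by (simp add: divide_inverse ennreal_mult nn_integral_multc)
  qed
  have "ennreal ((U / (1 - s) ^ ?k / (1 - s)) powr (1 - s) * (V / s ^ ?k / s) powr s) \<le> (\<integral>\<^sup>+t. ?W t \<partial>lborel)"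
  proof (rule prekopa_leindler_1[where C = C' and R = R])
    show "(\<lambda>t. Q u t / (1 - s) ^ ?k) \<in> borel_measurable borel" "(\<lambda>t. Q v t / s ^ ?k) \<in> borel_measurable borel"
      using Qm insert.prems by measurable
    have "(\<lambda>z. w ((snd z)(i := fst z))) \<in> borel_measurable (borel \<Otimes>\<^sub>M ?M)"
      by measurable
    then show "?W \<in> borel_measurable borel"
      by (intro sigma_finite_measure.borel_measurable_nn_integral)
        (auto simp: case_prod_beta' intro!: sigma_finite insert.hyps)
    show "Q u t / (1 - s) ^ ?k \<le> C'" for t
    proof -
      have "Q u t / (1 - s) ^ ?k \<le> C * (2 * R) ^ ?k / (1 - s) ^ ?k"
        using s by (intro divide_right_mono Q(2)[OF boxed(1)]) simp
      then show ?thesis using s C R by (simp add: C'_def add_increasing2)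
    qed
    show "Q v t / s ^ ?k \<le> C'" for t
    proof -
      have "Q v t / s ^ ?k \<le> C * (2 * R) ^ ?k / s ^ ?k"
        using s by (intro divide_right_mono Q(2)[OF boxed(2)]) simp
      then show ?thesis using s C R by (simp add: C'_def add_increasing)
    qed
    show "Q u t / (1 - s) ^ ?k = 0" if "R < \<bar>t\<bar>" for t
    proof -
      have "Q u t = 0" by (rule Q(3)[OF boxed(1) that])
      then show ?thesis by simp
    qed
    show "Q v t / s ^ ?k = 0" if "R < \<bar>t\<bar>" for t
    proof -
      have "Q v t = 0" by (rule Q(3)[OF boxed(2) that])
      then show ?thesis by simp
    qed
    show "(\<integral>\<^sup>+t. ennreal (Q u t / (1 - s) ^ ?k) \<partial>lborel) = ennreal (U / (1 - s) ^ ?k)"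
      by (rule tot[OF _ boxed(1)]) (use insert.prems s in simp_all)
    show "(\<integral>\<^sup>+t. ennreal (Q v t / s ^ ?k) \<partial>lborel) = ennreal (V / s ^ ?k)"
      by (rule tot[OF _ boxed(2)]) (use insert.prems s in simp_all)
  qed (use s Q0 IH insert.prems(12,14) in simp_all)
  also have "(\<integral>\<^sup>+t. ?W t \<partial>lborel) = (\<integral>\<^sup>+x. w x \<partial>Pi\<^sub>M (insert i I) (\<lambda>_. lborel))"
    by (rule product_nn_integral_insert_rev[symmetric]) (use insert.hyps insert.prems in simp_all)
  finally show ?case using insert.hyps by (simp add: mult.commute)
qed


lemma nn_integral_lborel_scaleR:
  fixes f :: "'a::euclidean_space \<Rightarrow> ennreal"
  assumes [measurable]: "f \<in> borel_measurable borel" and c: "0 < c"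
  shows "(\<integral>\<^sup>+x. f (c *\<^sub>R x) \<partial>lborel) = ennreal (1 / c ^ DIM('a)) * (\<integral>\<^sup>+x. f x \<partial>lborel)"
proof -
  have "(\<integral>\<^sup>+x. f x \<partial>lborel) =
    (\<integral>\<^sup>+x. f x \<partial>density (distr lborel borel (\<lambda>x. 0 + c *\<^sub>R x)) (\<lambda>_. ennreal (\<bar>c\<bar> ^ DIM('a))))"
    using lborel_affine[of c "0::'a"] c by simp
  also have "\<dots> = (\<integral>\<^sup>+x. ennreal (c ^ DIM('a)) * f (c *\<^sub>R x) \<partial>lborel)"
    using c by (simp add: nn_integral_density nn_integral_distr)
  also have "\<dots> = ennreal (c ^ DIM('a)) * (\<integral>\<^sup>+x. f (c *\<^sub>R x) \<partial>lborel)"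
    by (rule nn_integral_cmult) simp
  finally have "ennreal (1 / c ^ DIM('a)) * (\<integral>\<^sup>+x. f x \<partial>lborel) =
      (ennreal (1 / c ^ DIM('a)) * ennreal (c ^ DIM('a))) * (\<integral>\<^sup>+x. f (c *\<^sub>R x) \<partial>lborel)"
    by (simp add: mult.assoc)
  also have "ennreal (1 / c ^ DIM('a)) * ennreal (c ^ DIM('a)) = 1"
    using c by (simp flip: ennreal_mult)
  finally show ?thesis by simp
qed

lemma prekopa_leindler_bounded:
  fixes u v :: "'a::euclidean_space \<Rightarrow> real" and w :: "'a \<Rightarrow> ennreal"
  assumes [measurable]: "u \<in> borel_measurable borel" "v \<in> borel_measurable borel" "w \<in> borel_measurable borel"
    and s: "0 < s" "s < 1" and C: "0 \<le> C" and R: "0 \<le> R"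
    and u: "\<And>x. 0 \<le> u x" "\<And>x. u x \<le> C" "\<And>x. norm x > R \<Longrightarrow> u x = 0"
    and v: "\<And>x. 0 \<le> v x" "\<And>x. v x \<le> C" "\<And>x. norm x > R \<Longrightarrow> v x = 0"
    and w: "\<And>x y. ennreal (u x powr (1 - s) * v y powr s) \<le> w (x + y)"
    and U: "(\<integral>\<^sup>+x. u x \<partial>lborel) = ennreal U" "0 \<le> U"
    and V: "(\<integral>\<^sup>+x. v x \<partial>lborel) = ennreal V" "0 \<le> V"
  shows "ennreal ((U / (1 - s) ^ DIM('a)) powr (1 - s) * (V / s ^ DIM('a)) powr s) \<le> (\<integral>\<^sup>+x. w x \<partial>lborel)"
proof -
  define T where "T f = (\<Sum>b\<in>Basis. f b *\<^sub>R b)" for f :: "'a \<Rightarrow> real"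
  let ?M = "Pi\<^sub>M (Basis::'a set) (\<lambda>_. lborel :: real measure)"
  have T[measurable]: "T \<in> ?M \<rightarrow>\<^sub>M borel" unfolding T_def by measurable
  have lb: "(lborel :: 'a measure) = distr ?M borel T" unfolding T_def by (rule lborel_eq)
  have int: "(\<integral>\<^sup>+x. f x \<partial>lborel) = (\<integral>\<^sup>+x. f (T x) \<partial>?M)"
    if [measurable]: "f \<in> borel_measurable borel" for f :: "'a \<Rightarrow> ennreal"
    unfolding lb by (rule nn_integral_distr) auto
  have big: "R < norm (T x)" if "i \<in> Basis" "R < \<bar>x i\<bar>" for i x
  proof -
    have "T x \<bullet> i = x i" using that by (simp add: T_def inner_sum_left inner_Basis if_distrib cong: if_cong)
    then show ?thesis using Basis_le_norm[OF that(1), of "T x"] that by simp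
  qed
  have "ennreal ((U / (1 - s) ^ DIM('a)) powr (1 - s) * (V / s ^ DIM('a)) powr s) \<le> (\<integral>\<^sup>+x. w (T x) \<partial>?M)"
  proof (rule prekopa_leindler_PiM[where C = C and R = R])
    show "u (T x) = 0" "v (T x) = 0" if "i \<in> Basis" "R < \<bar>x i\<bar>" for i x
      using u(3) v(3) big[of i x] that by auto
    show "ennreal (u (T x) powr (1 - s) * v (T y) powr s) \<le> w (T (\<lambda>i\<in>Basis. x i + y i))" for x y
      using w[of "T x" "T y"] by (simp add: T_def sum.distrib scaleR_add_left)
    show "(\<integral>\<^sup>+x. ennreal (u (T x)) \<partial>?M) = ennreal U" "(\<integral>\<^sup>+x. ennreal (v (T x)) \<partial>?M) = ennreal V"
      using U V by (simp_all add: int)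
  qed (use s C R u v U V in auto)
  then show ?thesis by (simp add: int)
qed

text \<open>Truncation in the values and in the variable gives bounded functions with bounded support; the
  truncated integrals converge by dominated convergence. Substituting \<open>x / (1 - s)\<close> and \<open>y / s\<close>
  cancels the constants of the additive form.\<close>

theorem prekopa_leindler:
  fixes u v :: "'a::euclidean_space \<Rightarrow> real" and w :: "'a \<Rightarrow> ennreal"
  assumes u: "integrable lborel u" "\<And>x. 0 \<le> u x" and v: "integrable lborel v" "\<And>x. 0 \<le> v x"
    and w_meas[measurable]: "w \<in> borel_measurable borel"
    and s: "0 < s" "s < 1"
    and w: "\<And>x y. ennreal (u x powr (1 - s) * v y powr s) \<le> w ((1 - s) *\<^sub>R x + s *\<^sub>R y)"
  shows "ennreal ((\<integral>x. u x \<partial>lborel) powr (1 - s) * (\<integral>x. v x \<partial>lborel) powr s) \<le> (\<integral>\<^sup>+x. w x \<partial>lborel)"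
proof -
  have [measurable]: "u \<in> borel_measurable borel" "v \<in> borel_measurable borel" using u v by auto
  define tr where "tr f n x = (if norm x \<le> real n then min (f x) (real n) else 0)"
    for f :: "'a \<Rightarrow> real" and n x
  have tr_meas[measurable]: "tr f n \<in> borel_measurable borel" if [measurable]: "f \<in> borel_measurable borel" for f n
    unfolding tr_def by measurable
  have tr: "0 \<le> tr f n x" "tr f n x \<le> f x" "tr f n x \<le> real n" "norm x > real n \<Longrightarrow> tr f n x = 0"
    if "\<And>x. 0 \<le> f x" for f n x using that[of x] by (auto simp: tr_def)
  have tr_int: "integrable lborel (tr f n)" if "integrable lborel f" "\<And>x. 0 \<le> f x" for f n
  proof (rule Bochner_Integration.integrable_bound[OF that(1)])
    show "tr f n \<in> borel_measurable lborel" using that by simp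
    show "AE x in lborel. norm (tr f n x) \<le> norm (f x)" using tr[of f, OF that(2)] that(2) by simp
  qed
  have tr_lim: "(\<lambda>n. \<integral>x. tr f n x \<partial>lborel) \<longlonglongrightarrow> (\<integral>x. f x \<partial>lborel)"
    if "integrable lborel f" "\<And>x. 0 \<le> f x" for f
  proof (rule integral_dominated_convergence[where w = f])
    have "(\<lambda>n. tr f n x) \<longlonglongrightarrow> f x" for x
    proof (rule tendsto_eventually)
      obtain N :: nat where N: "norm x + f x \<le> real N" using real_arch_simple by blast
      show "\<forall>\<^sub>F n in sequentially. tr f n x = f x"
        using eventually_ge_at_top[of N]
      proof eventually_elim
        case (elim n)
        have "f x \<le> real n" "norm x \<le> real n" using elim N that(2)[of x] norm_ge_zero[of x] by linarith+
        then show ?case by (simp add: tr_def)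
      qed
    qed
    then show "AE x in lborel. (\<lambda>n. tr f n x) \<longlonglongrightarrow> f x" by simp
    show "AE x in lborel. norm (tr f n x) \<le> f x" for n using tr[of f, OF that(2)] by simp
  qed (use that in auto)
  have step: "ennreal ((\<integral>x. tr u n x \<partial>lborel) powr (1 - s) * (\<integral>x. tr v n x \<partial>lborel) powr s) \<le> (\<integral>\<^sup>+x. w x \<partial>lborel)" for n
  proof -
    define \<sigma> where "\<sigma> = min s (1 - s)"
    have \<sigma>: "0 < \<sigma>" "\<sigma> \<le> s" "\<sigma> \<le> 1 - s" using s by (auto simp: \<sigma>_def)
    have scal: "(\<integral>\<^sup>+x. ennreal (tr f n ((1/c) *\<^sub>R x)) \<partial>lborel) = ennreal (c ^ DIM('a) * (\<integral>x. tr f n x \<partial>lborel))"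
      if "integrable lborel f" "\<And>x. 0 \<le> f x" "0 < c" for f c
    proof -
      have [measurable]: "f \<in> borel_measurable borel" using that by auto
      have "(\<integral>\<^sup>+x. ennreal (tr f n ((1/c) *\<^sub>R x)) \<partial>lborel) =
        ennreal (c ^ DIM('a)) * (\<integral>\<^sup>+x. ennreal (tr f n x) \<partial>lborel)"
        using nn_integral_lborel_scaleR[of "\<lambda>x. ennreal (tr f n x)" "1/c"] that by (simp add: power_divide)
      then show ?thesis
        using tr_int[OF that(1,2)] tr[of f, OF that(2)] that
        by (simp add: nn_integral_eq_integral ennreal_mult)
    qed
    have out: "tr f n ((1/c) *\<^sub>R x) = 0" if "\<And>x. 0 \<le> f x" "0 < c" "c \<le> 1" "real n < norm x" for f c x
    proof -
      have "real n * c \<le> real n" using that by (intro mult_left_le) auto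
      then have "real n < norm ((1/c) *\<^sub>R x)" using that by (simp add: pos_less_divide_eq)
      then show ?thesis using tr(4)[of f, OF that(1)] by simp
    qed
    have int0: "0 \<le> (\<integral>x. tr u n x \<partial>lborel)" "0 \<le> (\<integral>x. tr v n x \<partial>lborel)"
      using tr u v by (auto intro!: integral_nonneg_AE)
    have "ennreal (((1 - s) ^ DIM('a) * (\<integral>x. tr u n x \<partial>lborel) / (1 - s) ^ DIM('a)) powr (1 - s)
        * (s ^ DIM('a) * (\<integral>x. tr v n x \<partial>lborel) / s ^ DIM('a)) powr s) \<le> (\<integral>\<^sup>+x. w x \<partial>lborel)"
    proof (rule prekopa_leindler_bounded[where C = "real n" and R = "real n"])
      show "ennreal (tr u n ((1/(1-s)) *\<^sub>R x) powr (1 - s) * tr v n ((1/s) *\<^sub>R y) powr s) \<le> w (x + y)" for x y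
      proof -
        have "tr u n ((1/(1-s)) *\<^sub>R x) powr (1 - s) * tr v n ((1/s) *\<^sub>R y) powr s
           \<le> u ((1/(1-s)) *\<^sub>R x) powr (1 - s) * v ((1/s) *\<^sub>R y) powr s"
          using s tr u v by (intro mult_mono powr_mono2) auto
        then show ?thesis
          using w[of "(1/(1-s)) *\<^sub>R x" "(1/s) *\<^sub>R y"] s by (auto intro: order_trans ennreal_leI)
      qed
    qed (use s u v int0 tr scal out in auto)
    then show ?thesis using s by simp
  qed
  have "(\<lambda>n. ennreal ((\<integral>x. tr u n x \<partial>lborel) powr (1 - s) * (\<integral>x. tr v n x \<partial>lborel) powr s))
    \<longlonglongrightarrow> ennreal ((\<integral>x. u x \<partial>lborel) powr (1 - s) * (\<integral>x. v x \<partial>lborel) powr s)"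
    using s tr u v
    by (intro tendsto_ennrealI tendsto_mult tendsto_powr' tr_lim tendsto_const)
      (auto intro!: always_eventually integral_nonneg_AE)
  then show ?thesis by (rule LIMSEQ_le_const2) (use step in auto)
qed

section \<open>Integrability for convex potentials\<close>

text \<open>The sublevel set \<open>{V \<le> V 0 + 1}\<close> is convex, contains a ball around 0 and has finite volume. A far
  point \<open>p\<close> of it would, by convexity, force it to contain many disjoint balls of half that radius centred
  on the segment from 0 to \<open>p / 2\<close>; so it is bounded, and convexity along rays gives linear growth
  outside of it.\<close>

lemma convex_coercive_if_exp_integrable:
  fixes V :: "'a::euclidean_space \<Rightarrow> real"
  assumes V: "convex_on UNIV V" and fin: "(\<integral>\<^sup>+x. ennreal (exp (- V x)) \<partial>lborel) < \<infinity>"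
  obtains \<alpha> \<beta> where "0 < \<alpha>" "\<And>x. \<alpha> * norm x - \<beta> \<le> V x"
proof -
  have cont: "continuous_on UNIV V" using V by (intro convex_on_continuous) auto
  have [measurable]: "V \<in> borel_measurable borel" using cont by (rule borel_measurable_continuous_onI)
  obtain r where r: "0 < r" "\<And>x. norm x < r \<Longrightarrow> V x < V 0 + 1"
  proof -
    have "isCont V 0" using cont by (simp add: continuous_on_eq_continuous_at)
    then obtain d where d: "0 < d" "\<And>x. dist x 0 < d \<Longrightarrow> dist (V x) (V 0) < 1"
      unfolding continuous_at_eps_delta by (metis zero_less_one)
    show ?thesis
    proof (intro that[of d] d(1))
      fix x :: 'a assume "norm x < d"
      then have "\<bar>V x - V 0\<bar> < 1" using d(2)[of x] by (simp add: dist_real_def)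
      then show "V x < V 0 + 1" by linarith
    qed
  qed
  define K where "K = {x. V x \<le> V 0 + 1}"
  have K[measurable]: "K \<in> sets borel" unfolding K_def by measurable
  have Kfin: "emeasure lborel K < \<infinity>"
  proof -
    have "ennreal (exp (- V 0 - 1)) * emeasure lborel K = (\<integral>\<^sup>+x. ennreal (exp (- V 0 - 1)) * indicator K x \<partial>lborel)"
      by (simp add: nn_integral_cmult_indicator)
    also have "\<dots> \<le> (\<integral>\<^sup>+x. ennreal (exp (- V x)) \<partial>lborel)"
      by (intro nn_integral_mono) (auto simp: K_def indicator_def intro!: ennreal_leI)
    also have "\<dots> < \<infinity>" by fact
    finally show ?thesis
      by (auto simp: ennreal_mult_less_top)
  qed
  let ?b = "measure lborel (ball (0::'a) (r/2))"
  have b: "0 < ?b" using r(1) by (simp add: content_ball_pos)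
  have ball_sub: "ball (t *\<^sub>R p) (r/2) \<subseteq> K" if p: "p \<in> K" and t: "0 \<le> t" "t \<le> 1/2" for p t
  proof
    fix y assume "y \<in> ball (t *\<^sub>R p) (r/2)"
    then have n: "norm (y - t *\<^sub>R p) < r/2" by (simp add: dist_norm norm_minus_commute)
    define z where "z = (1 / (1 - t)) *\<^sub>R (y - t *\<^sub>R p)"
    have "norm z \<le> 2 * norm (y - t *\<^sub>R p)"
    proof -
      have "1 / (1 - t) \<le> 2" using t by (simp add: field_simps)
      then have "1 / (1 - t) * norm (y - t *\<^sub>R p) \<le> 2 * norm (y - t *\<^sub>R p)" by (intro mult_right_mono) auto
      then show ?thesis using t by (simp only: z_def norm_scaleR) simp
    qed
    then have "V z \<le> V 0 + 1" using n r(2)[of z] by simp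
    moreover have "y = (1 - t) *\<^sub>R z + t *\<^sub>R p" using t by (simp add: z_def)
    ultimately have "V y \<le> (1 - t) * V z + t * V p" "V z \<le> V 0 + 1"
      using convex_onD[OF V, of t z p] t by simp_all
    note this(1)
    also have "(1 - t) * V z + t * V p \<le> (1 - t) * (V 0 + 1) + t * (V 0 + 1)"
      using \<open>V z \<le> V 0 + 1\<close> p t by (intro add_mono mult_left_mono) (auto simp: K_def)
    also have "\<dots> = V 0 + 1" by algebra
    finally show "y \<in> K" by (simp add: K_def)
  qed
  (* more disjoint balls than fit into K; they are placed at distance r along the segment *)
  obtain N :: nat where N: "measure lborel K < real N * ?b" "0 < N"
  proof -
    obtain N :: nat where "measure lborel K / ?b < real N" using reals_Archimedean2 by blast
    then have "measure lborel K < real N * ?b" using b by (simp add: pos_divide_less_eq)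
    also have "\<dots> \<le> real (Suc N) * ?b" using b by (intro mult_right_mono) auto
    finally have "measure lborel K < real (Suc N) * ?b" .
    then show ?thesis by (intro that[of "Suc N"]) auto
  qed
  define R where "R = 2 * r * real N"
  have R: "0 < R" using r N by (simp add: R_def)
  have bdd: "norm p < R" if p: "p \<in> K" for p
  proof (rule ccontr)
    assume "\<not> norm p < R"
    then have pR: "R \<le> norm p" by simp
    define B where "B j = ball ((real j * r / norm p) *\<^sub>R p) (r/2)" for j
    have p0: "0 < norm p" using R pR by linarith
    have sub: "B j \<subseteq> K" if "j < N" for j
      unfolding B_def
    proof (rule ball_sub[OF p])
      have "real j * (2 * r) \<le> real N * (2 * r)" using that r by (intro mult_right_mono) auto
      then have "real j * r * 2 \<le> norm p" using pR by (simp add: R_def mult_ac)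
      then show "real j * r / norm p \<le> 1/2" using p0 by (simp add: field_simps)
    qed (use r in auto)
    have disj: "disjoint_family_on B {..<N}"
      unfolding disjoint_family_on_def
    proof (intro ballI impI)
      fix i j :: nat assume ij: "i \<noteq> j"
      have "dist ((real i * r / norm p) *\<^sub>R p) ((real j * r / norm p) *\<^sub>R p) = \<bar>real i - real j\<bar> * r"
        using p0 r by (simp add: dist_norm flip: scaleR_diff_left)
          (simp add: abs_mult flip: diff_divide_distrib left_diff_distrib)
      also have "\<dots> \<ge> 1 * r" using ij r by (intro mult_right_mono) auto
      finally show "B i \<inter> B j = {}" unfolding B_def by (intro disjoint_ballI) simp
    qed
    have Bfin: "B j \<in> sets lborel" "emeasure lborel (B j) \<noteq> top" for j
      using emeasure_bounded_finite[of "B j"] by (auto simp: B_def)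
    have "(\<Sum>j<N. measure lborel (B j)) = measure lborel (\<Union>j<N. B j)"
      by (rule measure_finite_Union[symmetric]) (use disj Bfin in auto)
    also have "\<dots> \<le> measure lborel K"
      by (rule measure_mono_fmeasurable) (use sub Kfin in \<open>auto simp: B_def fmeasurable_def\<close>)
    also have "(\<Sum>j<N. measure lborel (B j)) = real N * ?b"
    proof -
      have "measure lborel (B j) = ?b" for j
        using r by (simp add: B_def content_ball)
      then show ?thesis by simp
    qed
    finally show False using N by simp
  qed
  have "compact (cball (0::'a) R)" by simp
  then obtain m where m: "\<And>x. norm x \<le> R \<Longrightarrow> m \<le> V x"
    using continuous_attains_inf[of "cball (0::'a) R" V] cont R continuous_on_subset
    by (metis less_eq_real_def cball_eq_empty mem_cball_0 not_less subset_UNIV)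
  have far: "V 0 + norm x / R \<le> V x" if x: "R \<le> norm x" for x
  proof -
    have x0: "0 < norm x" using R x by linarith
    define y where "y = (R / norm x) *\<^sub>R x"
    have "norm y = R" using x0 R by (simp add: y_def)
    then have "y \<notin> K" using bdd[of y] by auto
    then have "V 0 + 1 < V y" by (simp add: K_def)
    also have "V y \<le> (1 - R / norm x) * V 0 + (R / norm x) * V x"
      using convex_onD[OF V, of "R / norm x" 0 x] x x0 R by (simp add: y_def)
    finally have "1 < (R / norm x) * (V x - V 0)" by (simp add: algebra_simps)
    then show ?thesis using R x0 by (simp add: field_simps)
  qed
  show thesis
  proof (rule that[of "1 / R" "max (- V 0) (1 - m)"])
    fix x :: 'a
    show "1 / R * norm x - max (- V 0) (1 - m) \<le> V x"
    proof (cases "R \<le> norm x")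
      case True then show ?thesis using far[of x] by simp
    next
      case False
      then have "norm x / R \<le> 1" "m \<le> V x" using R m[of x] by auto
      then show ?thesis by simp
    qed
  qed (use R in simp)
qed

text \<open>As \<open>V\<close> is bounded below, \<open>\<bar>V\<bar> exp (- V)\<close> is dominated by \<open>exp (- V / 2)\<close>, and convexity between
  \<open>0\<close> and \<open>x\<close> compares \<open>V x / 2\<close> with \<open>V (x / 2)\<close>, whose exponential is integrable by scaling.\<close>

lemma convex_integrable_exp_times:
  fixes V :: "'a::euclidean_space \<Rightarrow> real"
  assumes V: "convex_on UNIV V" and int: "integrable lborel (\<lambda>x. exp (- V x))"
  shows "integrable lborel (\<lambda>x. exp (- V x) * V x)"
proof -
  have cont: "continuous_on UNIV V" using V by (intro convex_on_continuous) auto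
  have [measurable]: "V \<in> borel_measurable borel" using cont by (rule borel_measurable_continuous_onI)
  have fin: "(\<integral>\<^sup>+x. ennreal (exp (- V x)) \<partial>lborel) < \<infinity>"
    using int by (simp add: nn_integral_eq_integral)
  then obtain \<alpha> \<beta> where \<alpha>: "0 < \<alpha>" "\<And>x. \<alpha> * norm x - \<beta> \<le> V x"
    using convex_coercive_if_exp_integrable[OF V] by metis
  have lb: "- \<beta> \<le> V x" for x using \<alpha>(2)[of x] mult_nonneg_nonneg[of \<alpha> "norm x"] \<alpha>(1) norm_ge_zero[of x] by linarith
  have half: "integrable lborel (\<lambda>x. exp (- V x / 2))"
  proof (rule Bochner_Integration.integrable_bound)
    have "integrable lborel (\<lambda>x. exp (- V (0 + (1/2) *\<^sub>R x)))"
    proof (rule integrableI_bounded)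
      have "(\<integral>\<^sup>+x. ennreal (exp (- V ((1/2) *\<^sub>R x))) \<partial>lborel) < \<infinity>"
        using nn_integral_lborel_scaleR[of "\<lambda>x. ennreal (exp (- V x))" "1/2"] fin by (simp add: ennreal_mult_less_top)
      then show "(\<integral>\<^sup>+x. ennreal (norm (exp (- V (0 + (1/2) *\<^sub>R x)))) \<partial>lborel) < \<infinity>" by simp
    qed simp
    then show "integrable lborel (\<lambda>x. exp (V 0 / 2) * exp (- V ((1/2) *\<^sub>R x)))" by simp
    show "AE x in lborel. norm (exp (- V x / 2)) \<le> norm (exp (V 0 / 2) * exp (- V ((1/2) *\<^sub>R x)))"
    proof (rule AE_I2)
      fix x
      have "V ((1/2) *\<^sub>R x) \<le> (1/2) * V 0 + (1/2) * V x"
        using convex_onD[OF V, of "1/2" 0 x] by simp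
      then show "norm (exp (- V x / 2)) \<le> norm (exp (V 0 / 2) * exp (- V ((1/2) *\<^sub>R x)))"
        by (simp flip: exp_add)
    qed
  qed simp
  show ?thesis
  proof (rule Bochner_Integration.integrable_bound)
    show "integrable lborel (\<lambda>x. 2 * exp (\<beta> / 2) * exp (- V x / 2) + \<bar>\<beta>\<bar> * exp (- V x))"
      using half int by (intro Bochner_Integration.integrable_add integrable_mult_right) auto
    show "AE x in lborel. norm (exp (- V x) * V x) \<le> norm (2 * exp (\<beta> / 2) * exp (- V x / 2) + \<bar>\<beta>\<bar> * exp (- V x))"
    proof (rule AE_I2)
      fix x
      have "(V x + \<beta>) / 2 \<le> exp ((V x + \<beta>) / 2)" using exp_ge_add_one_self[of "(V x + \<beta>) / 2"] by linarith
      then have "\<bar>V x\<bar> \<le> 2 * exp ((V x + \<beta>) / 2) + \<bar>\<beta>\<bar>" using lb[of x] exp_gt_zero[of "(V x + \<beta>) / 2"]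
        by (cases "0 \<le> V x"; cases "0 \<le> \<beta>") (simp_all add: abs_if)
      then have "exp (- V x) * \<bar>V x\<bar> \<le> exp (- V x) * (2 * exp ((V x + \<beta>) / 2) + \<bar>\<beta>\<bar>)" by simp
      also have "\<dots> = 2 * exp (\<beta> / 2) * exp (- V x / 2) + \<bar>\<beta>\<bar> * exp (- V x)"
        by (simp add: algebra_simps flip: exp_add) (simp add: field_simps)
      finally show "norm (exp (- V x) * V x) \<le> norm (2 * exp (\<beta> / 2) * exp (- V x / 2) + \<bar>\<beta>\<bar> * exp (- V x))"
        by (simp add: abs_mult)
    qed
  qed simp
qed

section \<open>Almost everywhere differentiability of convex functions\<close>

text \<open>The one-sided derivative along the sequence \<open>1 / (m + 1)\<close>, so that its measurability is that of a
  limit of a sequence; for convex functions the difference quotients decrease along it.\<close>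

definition dir_deriv :: "('a::real_normed_vector \<Rightarrow> real) \<Rightarrow> 'a \<Rightarrow> 'a \<Rightarrow> real" where
  "dir_deriv V e x = lim (\<lambda>m. (V (x + inverse (real (Suc m)) *\<^sub>R e) - V x) / inverse (real (Suc m)))"

lemma convex_slope_mono:
  fixes V :: "'a::real_vector \<Rightarrow> real"
  assumes V: "convex_on UNIV V" and h: "0 < h" "h \<le> k"
  shows "(V (x + h *\<^sub>R e) - V x) / h \<le> (V (x + k *\<^sub>R e) - V x) / k"
proof -
  have "V (x + h *\<^sub>R e) \<le> (1 - h / k) * V x + (h / k) * V (x + k *\<^sub>R e)"
    using convex_onD[OF V, of "h / k" x "x + k *\<^sub>R e"] h
    by (simp add: algebra_simps)
  then have "V (x + h *\<^sub>R e) - V x \<le> (h / k) * (V (x + k *\<^sub>R e) - V x)" by (simp add: algebra_simps)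
  then show ?thesis using h by (simp add: field_simps)
qed

lemma convex_slope_ge:
  fixes V :: "'a::real_vector \<Rightarrow> real"
  assumes V: "convex_on UNIV V" and h: "0 < h"
  shows "V x - V (x - e) \<le> (V (x + h *\<^sub>R e) - V x) / h"
proof -
  define c where "c = 1 / (1 + h)"
  have c: "0 \<le> h * c" "h * c \<le> 1" "1 - h * c = c" "c * (1 + h) = 1" using h by (simp_all add: c_def field_simps)
  have "c *\<^sub>R (x + h *\<^sub>R e) + (h * c) *\<^sub>R (x - e) = (c * (1 + h)) *\<^sub>R x" by (simp add: algebra_simps)
  then have "V x \<le> c * V (x + h *\<^sub>R e) + (h * c) * V (x - e)"
    using convex_onD[OF V, of "h * c" "x + h *\<^sub>R e" "x - e"] c by simp
  then have "(1 + h) * V x \<le> (1 + h) * (c * V (x + h *\<^sub>R e) + (h * c) * V (x - e))"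
    using h by simp
  also have "\<dots> = (c * (1 + h)) * (V (x + h *\<^sub>R e) + h * V (x - e))" by (simp add: algebra_simps)
  finally show ?thesis using h unfolding c(4) by (simp add: field_simps)
qed

lemma dir_deriv_LIMSEQ:
  fixes V :: "'a::real_normed_vector \<Rightarrow> real"
  assumes V: "convex_on UNIV V"
  shows "(\<lambda>m. (V (x + inverse (real (Suc m)) *\<^sub>R e) - V x) / inverse (real (Suc m))) \<longlonglongrightarrow> dir_deriv V e x"
proof -
  let ?q = "\<lambda>m. (V (x + inverse (real (Suc m)) *\<^sub>R e) - V x) / inverse (real (Suc m))"
  have dec: "decseq ?q"
    by (intro decseq_SucI convex_slope_mono[OF V]) auto
  have "V x - V (x - e) \<le> ?q m" for m by (rule convex_slope_ge[OF V]) simp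
  then obtain L where "?q \<longlonglongrightarrow> L" using decseq_convergent[OF dec, of "V x - V (x - e)"] by blast
  then have "convergent ?q" by (rule convergentI)
  then show ?thesis unfolding dir_deriv_def by (simp add: convergent_LIMSEQ_iff)
qed

lemma convex_above_dir_deriv:
  fixes V :: "'a::real_normed_vector \<Rightarrow> real"
  assumes V: "convex_on UNIV V" and h: "0 < h"
  shows "V x + h * dir_deriv V e x \<le> V (x + h *\<^sub>R e)"
proof -
  have "dir_deriv V e x \<le> (V (x + h *\<^sub>R e) - V x) / h"
  proof (rule LIMSEQ_le_const2[OF dir_deriv_LIMSEQ[OF V]])
    obtain N where N: "inverse (real (Suc N)) < h" using reals_Archimedean[OF h] by blast
    show "\<exists>N. \<forall>m\<ge>N. (V (x + inverse (real (Suc m)) *\<^sub>R e) - V x) / inverse (real (Suc m)) \<le> (V (x + h *\<^sub>R e) - V x) / h"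
    proof (intro exI[of _ N] allI impI convex_slope_mono[OF V])
      fix m assume "N \<le> m"
      then have "inverse (real (Suc m)) \<le> inverse (real (Suc N))" by (intro le_imp_inverse_le) auto
      then show "inverse (real (Suc m)) \<le> h" using N by linarith
    qed simp
  qed
  then show ?thesis using h by (simp add: field_simps)
qed

lemma dir_deriv_opposite:
  fixes V :: "'a::real_normed_vector \<Rightarrow> real"
  assumes V: "convex_on UNIV V"
  shows "- dir_deriv V (- e) x \<le> dir_deriv V e x"
proof -
  let ?q = "\<lambda>e m. (V (x + inverse (real (Suc m)) *\<^sub>R e) - V x) / inverse (real (Suc m))"
  have "(\<lambda>m. ?q e m + ?q (- e) m) \<longlonglongrightarrow> dir_deriv V e x + dir_deriv V (- e) x"
    by (intro tendsto_add dir_deriv_LIMSEQ[OF V])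
  moreover have "0 \<le> ?q e m + ?q (- e) m" for m
  proof -
    have "V x - V (x - inverse (real (Suc m)) *\<^sub>R e) \<le> V (x + inverse (real (Suc m)) *\<^sub>R e) - V x"
      using convex_slope_ge[OF V, of 1 x "inverse (real (Suc m)) *\<^sub>R e"] by simp
    then show ?thesis by (simp del: of_nat_Suc add: add_divide_distrib[symmetric])
  qed
  ultimately have "0 \<le> dir_deriv V e x + dir_deriv V (- e) x" using LIMSEQ_le_const by blast
  then show ?thesis by simp
qed

lemma dir_deriv_le_opposite_shifted:
  fixes V :: "'a::real_normed_vector \<Rightarrow> real"
  assumes V: "convex_on UNIV V" and h: "0 < h"
  shows "dir_deriv V e x \<le> - dir_deriv V (- e) (x + h *\<^sub>R e)"
proof -
  have "h * dir_deriv V e x + h * dir_deriv V (- e) (x + h *\<^sub>R e) \<le> 0"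
    using convex_above_dir_deriv[OF V h, of x e] convex_above_dir_deriv[OF V h, of "x + h *\<^sub>R e" "- e"] by simp
  then have "h * (dir_deriv V e x + dir_deriv V (- e) (x + h *\<^sub>R e)) \<le> 0" by (simp add: algebra_simps)
  then show ?thesis using h by (simp add: mult_le_0_iff)
qed

lemma dir_deriv_measurable:
  fixes V :: "'a::euclidean_space \<Rightarrow> real"
  assumes V: "convex_on UNIV V"
  shows "dir_deriv V e \<in> borel_measurable borel"
proof (rule borel_measurable_LIMSEQ_real[OF dir_deriv_LIMSEQ[OF V]])
  have "continuous_on UNIV V" using V by (intro convex_on_continuous) auto
  then have [measurable]: "V \<in> borel_measurable borel" by (rule borel_measurable_continuous_onI)
  show "(\<lambda>x. (V (x + inverse (real (Suc m)) *\<^sub>R e) - V x) / inverse (real (Suc m))) \<in> borel_measurable borel" for m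
    by measurable
qed

text \<open>Almost everywhere the two one-sided derivatives in the direction \<open>e\<close> agree. The right derivative at
  \<open>x\<close> is at most the left derivative at \<open>x + h e\<close>. Passing to arctangents makes both bounded, and
  integrating against a compactly supported Lipschitz weight moves the shift by \<open>h e\<close> to the weight.
  So the integral of the nonnegative difference of the arctangents is \<open>O(h)\<close>, hence zero.\<close>

lemma AE_dir_deriv_opposite:
  fixes V :: "'a::euclidean_space \<Rightarrow> real"
  assumes V: "convex_on UNIV V"
  shows "AE x in lborel. dir_deriv V e x = - dir_deriv V (- e) x"
proof -
  note [measurable] = dir_deriv_measurable[OF V]
  have [measurable]: "(arctan :: real \<Rightarrow> real) \<in> borel_measurable borel"
    by (intro borel_measurable_continuous_onI continuous_intros)
  have cb: "emeasure lborel (cball a r) < top" for a :: 'a and r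
    using emeasure_bounded_finite[OF bounded_cball, of a r] by simp
  define P where "P x = arctan (dir_deriv V e x)" for x
  define Q where "Q x = arctan (- dir_deriv V (- e) x)" for x
  have [measurable]: "P \<in> borel_measurable borel" "Q \<in> borel_measurable borel"
    unfolding P_def Q_def by measurable
  have QP: "Q x \<le> P x" for x
    using dir_deriv_opposite[OF V] by (simp add: P_def Q_def arctan_le_iff)
  have PQ: "P x \<le> Q (x + h *\<^sub>R e)" if "0 < h" for x h
    using dir_deriv_le_opposite_shifted[OF V that] by (simp add: P_def Q_def arctan_le_iff)
  have bd: "\<bar>P x\<bar> \<le> 2" "\<bar>Q x\<bar> \<le> 2" for x
    using arctan_lbound[of "dir_deriv V e x"] arctan_ubound[of "dir_deriv V e x"]
      arctan_lbound[of "- dir_deriv V (- e) x"] arctan_ubound[of "- dir_deriv V (- e) x"] pi_less_4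
    unfolding P_def Q_def abs_le_iff by linarith+
  have "AE x in lborel. norm x < R \<longrightarrow> P x = Q x" if R: "0 < R" for R
  proof -
    (* a 1-Lipschitz weight that is positive exactly on the open ball of radius R *)
    define w where "w x = max 0 (R - norm x)" for x :: 'a
    have [measurable]: "w \<in> borel_measurable borel" unfolding w_def by measurable
    have w0: "0 \<le> w x" "w x \<le> R" "norm x > R \<Longrightarrow> w x = 0" for x using R by (auto simp: w_def)
    have wint: "integrable lborel (\<lambda>x. f x * w (x - a))"
      if [measurable]: "f \<in> borel_measurable borel" and "\<And>x. \<bar>f x\<bar> \<le> 2" for f :: "'a \<Rightarrow> real" and a
    proof (rule Bochner_Integration.integrable_bound)
      show "integrable lborel (\<lambda>x. 2 * R * indicator (cball a R) x :: real)"
        by (intro integrable_mult_right integrable_real_indicator) (auto simp: cb)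
      show "AE x in lborel. norm (f x * w (x - a)) \<le> norm (2 * R * indicator (cball a R) x :: real)"
      proof (rule AE_I2)
        fix x
        show "norm (f x * w (x - a)) \<le> norm (2 * R * indicator (cball a R) x :: real)"
        proof (cases "norm (x - a) > R")
          case True then show ?thesis using w0 by simp
        next
          case False
          then have "x \<in> cball a R" by (simp add: dist_norm norm_minus_commute)
          then show ?thesis using mult_mono[OF that(2)[of x] w0(2)[of "x - a"]] w0 R by (simp add: abs_mult)
        qed
      qed
    qed measurable
    note PI = wint[of P 0, simplified, OF bd(1)] and QI = wint[of Q, simplified, OF bd(2)]
    have QI0: "integrable lborel (\<lambda>x. Q x * w x)" using QI[of 0] by simp
    define K where "K = measure lborel (cball (0::'a) (R + norm e))"
    have est: "(\<integral>x. (P x - Q x) * w x \<partial>lborel) \<le> h * (2 * norm e * K)" if h: "0 < h" "h \<le> 1" for h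
    proof -
      have int_sh: "integrable lborel (\<lambda>x. Q (x + h *\<^sub>R e) * w x)"
        using integrable_distr_eq[of "(+) (h *\<^sub>R e)" lborel borel "\<lambda>x. Q x * w (x - h *\<^sub>R e)"] QI[of "h *\<^sub>R e"]
        by (simp add: lborel_distr_plus add.commute)
      have "(\<integral>x. P x * w x \<partial>lborel) \<le> (\<integral>x. Q (x + h *\<^sub>R e) * w x \<partial>lborel)"
        using PI int_sh PQ[OF h(1)] w0 by (intro integral_mono mult_right_mono) auto
      also have "\<dots> = (\<integral>x. Q x * w (x - h *\<^sub>R e) \<partial>lborel)"
        using integral_distr[of "(+) (h *\<^sub>R e)" lborel borel "\<lambda>x. Q x * w (x - h *\<^sub>R e)"]
        by (simp add: lborel_distr_plus add.commute)
      finally have "(\<integral>x. (P x - Q x) * w x \<partial>lborel) \<le> (\<integral>x. Q x * w (x - h *\<^sub>R e) \<partial>lborel) - (\<integral>x. Q x * w x \<partial>lborel)"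
        using PI QI0 by (simp add: left_diff_distrib)
      also have "\<dots> = (\<integral>x. Q x * (w (x - h *\<^sub>R e) - w x) \<partial>lborel)"
        using QI QI0 by (simp add: right_diff_distrib)
      also have "\<dots> \<le> (\<integral>x. (2 * (h * norm e)) * indicator (cball (0::'a) (R + norm e)) x \<partial>lborel)"
      proof (rule integral_mono)
        show "integrable lborel (\<lambda>x. Q x * (w (x - h *\<^sub>R e) - w x))"
          using QI QI0 by (simp add: right_diff_distrib)
        show "integrable lborel (\<lambda>x. (2 * (h * norm e)) * indicator (cball (0::'a) (R + norm e)) x :: real)"
          by (intro integrable_mult_right integrable_real_indicator) (auto simp: cb)
        fix x
        have he: "norm (h *\<^sub>R e) \<le> norm e" using h by (simp add: mult_left_le_one_le)
        have tri: "norm x - norm (h *\<^sub>R e) \<le> norm (x - h *\<^sub>R e)" "norm (x - h *\<^sub>R e) \<le> norm x + norm (h *\<^sub>R e)"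
          by (rule norm_triangle_ineq2, rule norm_triangle_ineq4)
        show "Q x * (w (x - h *\<^sub>R e) - w x) \<le> (2 * (h * norm e)) * indicator (cball (0::'a) (R + norm e)) x"
        proof (cases "x \<in> cball 0 (R + norm e)")
          case False
          then have "norm x > R" "norm (x - h *\<^sub>R e) > R" using tri he by auto
          then show ?thesis using False w0(3) by simp
        next
          case True
          have "\<bar>w (x - h *\<^sub>R e) - w x\<bar> \<le> norm (h *\<^sub>R e)"
            using tri unfolding w_def by (simp only: abs_le_iff max_def) auto
          then have "\<bar>Q x\<bar> * \<bar>w (x - h *\<^sub>R e) - w x\<bar> \<le> 2 * norm (h *\<^sub>R e)"
            by (intro mult_mono bd) auto
          then show ?thesis using True h by (simp flip: abs_mult)
        qed
      qed
      also have "\<dots> = h * (2 * norm e * K)" by (simp add: K_def)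
      finally show ?thesis .
    qed
    have "(\<integral>x. (P x - Q x) * w x \<partial>lborel) \<le> 0"
    proof (rule tendsto_lowerbound[of "\<lambda>h. h * (2 * norm e * K)" 0 "at_right 0"])
      show "((\<lambda>h. h * (2 * norm e * K)) \<longlongrightarrow> 0) (at_right 0)" by (auto intro!: tendsto_eq_intros)
      show "\<forall>\<^sub>F h in at_right 0. (\<integral>x. (P x - Q x) * w x \<partial>lborel) \<le> h * (2 * norm e * K)"
        using eventually_at_right_real[of 0 1] by (auto elim!: eventually_mono intro!: est)
    qed simp
    moreover have PQI: "integrable lborel (\<lambda>x. (P x - Q x) * w x)"
      using PI QI0 by (simp add: left_diff_distrib)
    moreover have nn: "AE x in lborel. 0 \<le> (P x - Q x) * w x" using QP w0 by simp
    ultimately have "AE x in lborel. (P x - Q x) * w x = 0"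
      using integral_nonneg_eq_0_iff_AE[OF PQI nn] integral_nonneg_AE[OF nn] by linarith
    then show ?thesis
    proof eventually_elim
      case (elim x) then show ?case by (auto simp: w_def)
    qed
  qed
  then have "AE x in lborel. \<forall>n::nat. norm x < real (Suc n) \<longrightarrow> P x = Q x"
    unfolding AE_all_countable by (auto simp del: of_nat_Suc)
  then show ?thesis
  proof eventually_elim
    case (elim x)
    obtain n where "norm x < real n" using reals_Archimedean2 by blast
    then have "norm x < real (Suc n)" by simp
    then have "P x = Q x" using elim by blast
    then show ?case by (simp add: P_def Q_def arctan_eq_iff)
  qed
qed

text \<open>Subtracting the candidate linear part leaves a convex function \<open>W\<close> with \<open>W 0 = 0\<close> that is \<open>o(t)\<close> along
  the coordinate axes. Jensen's inequality extends the upper bound to all directions, and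
  \<open>W h \<ge> - W (- h)\<close> turns it into a lower bound.\<close>

lemma convex_differentiable_at:
  fixes V :: "'a::euclidean_space \<Rightarrow> real"
  assumes V: "convex_on UNIV V" and eq: "\<And>i. i \<in> Basis \<Longrightarrow> dir_deriv V i x = - dir_deriv V (- i) x"
  shows "GDERIV V x :> (\<Sum>i\<in>Basis. dir_deriv V i x *\<^sub>R i)"
proof -
  define g where "g = (\<Sum>i\<in>Basis. dir_deriv V i x *\<^sub>R i)"
  have gi: "i \<bullet> g = dir_deriv V i x" if "i \<in> Basis" for i
    using that by (simp add: g_def inner_sum_right inner_Basis if_distrib cong: if_cong)
  define W where "W h = V (x + h) - V x - h \<bullet> g" for h
  let ?n = "real DIM('a)"
  have n: "0 < ?n" by simp
  have W: "convex_on UNIV W"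
  proof (rule convex_onI)
    fix t :: real and y z :: 'a assume t: "0 < t" "t < 1"
    have "x + ((1 - t) *\<^sub>R y + t *\<^sub>R z) = (1 - t) *\<^sub>R (x + y) + t *\<^sub>R (x + z)" by (simp add: algebra_simps)
    then have "V (x + ((1 - t) *\<^sub>R y + t *\<^sub>R z)) \<le> (1 - t) * V (x + y) + t * V (x + z)"
      using convex_onD[OF V, of t "x + y" "x + z"] t by simp
    then show "W ((1 - t) *\<^sub>R y + t *\<^sub>R z) \<le> (1 - t) * W y + t * W z"
      by (simp add: W_def inner_add_left algebra_simps)
  qed simp
  have W0: "W 0 = 0" by (simp add: W_def)
  have one: "\<exists>d>0. \<forall>h. 0 < h \<and> h \<le> d \<longrightarrow> W (h *\<^sub>R e) \<le> \<epsilon> * h"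
    if \<epsilon>: "0 < \<epsilon>" and e: "e \<bullet> g = dir_deriv V e x" for \<epsilon> e
  proof -
    have "\<forall>\<^sub>F m in sequentially. (V (x + inverse (real (Suc m)) *\<^sub>R e) - V x) / inverse (real (Suc m)) < dir_deriv V e x + \<epsilon>"
      using dir_deriv_LIMSEQ[OF V, of x e] \<epsilon> by (intro order_tendstoD) auto
    then obtain m where m: "(V (x + inverse (real (Suc m)) *\<^sub>R e) - V x) / inverse (real (Suc m)) < dir_deriv V e x + \<epsilon>"
      by (auto dest: eventually_happens)
    have "W (h *\<^sub>R e) \<le> \<epsilon> * h" if h: "0 < h" "h \<le> inverse (real (Suc m))" for h
    proof -
      have "(V (x + h *\<^sub>R e) - V x) / h \<le> dir_deriv V e x + \<epsilon>"
        using convex_slope_mono[OF V h, of x e] m by linarith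
      then have "V (x + h *\<^sub>R e) - V x \<le> h * (dir_deriv V e x + \<epsilon>)" using h by (simp add: field_simps)
      then show ?thesis by (simp add: W_def e algebra_simps)
    qed
    then show ?thesis by (intro exI[of _ "inverse (real (Suc m))"]) auto
  qed
  have upper: "\<exists>d>0. \<forall>h. norm h < d \<longrightarrow> W h \<le> \<epsilon> * norm h" if \<epsilon>: "0 < \<epsilon>" for \<epsilon>
  proof -
    have "\<forall>i\<in>Basis. \<exists>d>0. \<forall>t. \<bar>t\<bar> \<le> d \<longrightarrow> W (t *\<^sub>R i) \<le> (\<epsilon> / ?n) * \<bar>t\<bar>"
    proof
      fix i :: 'a assume i: "i \<in> Basis"
      obtain d1 where d1: "0 < d1" "\<forall>h. 0 < h \<and> h \<le> d1 \<longrightarrow> W (h *\<^sub>R i) \<le> (\<epsilon> / ?n) * h"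
        using one[of "\<epsilon> / ?n" i] gi[OF i] \<epsilon> n by auto
      obtain d2 where d2: "0 < d2" "\<forall>h. 0 < h \<and> h \<le> d2 \<longrightarrow> W (h *\<^sub>R (- i)) \<le> (\<epsilon> / ?n) * h"
        using one[of "\<epsilon> / ?n" "- i"] gi[OF i] eq[OF i] \<epsilon> n by auto
      have "W (t *\<^sub>R i) \<le> (\<epsilon> / ?n) * \<bar>t\<bar>" if t: "\<bar>t\<bar> \<le> min d1 d2" for t
      proof (cases t "0::real" rule: linorder_cases)
        case less
        then show ?thesis using d2(2)[rule_format, of "- t"] t by simp
      next
        case equal then show ?thesis by (simp add: W0)
      next
        case greater
        then show ?thesis using d1(2)[rule_format, of t] t by simp
      qed
      then show "\<exists>d>0. \<forall>t. \<bar>t\<bar> \<le> d \<longrightarrow> W (t *\<^sub>R i) \<le> (\<epsilon> / ?n) * \<bar>t\<bar>"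
        using d1(1) d2(1) by (intro exI[of _ "min d1 d2"]) auto
    qed
    then obtain D where D: "\<And>i. i \<in> Basis \<Longrightarrow> 0 < D i"
        "\<And>i t. i \<in> Basis \<Longrightarrow> \<bar>t\<bar> \<le> D i \<Longrightarrow> W (t *\<^sub>R i) \<le> (\<epsilon> / ?n) * \<bar>t\<bar>"
      unfolding bchoice_iff by auto
    define d where "d = Min (D ` Basis)"
    have d: "0 < d" "\<And>i. i \<in> Basis \<Longrightarrow> d \<le> D i" using D(1) by (auto simp: d_def)
    have "W h \<le> \<epsilon> * norm h" if h: "norm h < d / ?n" for h
    proof -
      have "h = (\<Sum>i\<in>Basis. (1 / ?n) *\<^sub>R ((?n * (h \<bullet> i)) *\<^sub>R i))"
        by (simp add: euclidean_representation)
      then have "W h = W (\<Sum>i\<in>Basis. (1 / ?n) *\<^sub>R ((?n * (h \<bullet> i)) *\<^sub>R i))" by simp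
      also have "\<dots> \<le> (\<Sum>i\<in>Basis. (1 / ?n) * W ((?n * (h \<bullet> i)) *\<^sub>R i))"
        by (rule convex_on_sum[OF _ _ W]) auto
      also have "\<dots> \<le> (\<Sum>i\<in>(Basis::'a set). (1 / ?n) * (\<epsilon> * norm h))"
      proof (intro sum_mono mult_left_mono)
        fix i :: 'a assume i: "i \<in> Basis"
        have "\<bar>h \<bullet> i\<bar> \<le> norm h" using i by (rule Basis_le_norm)
        then have le: "\<bar>?n * (h \<bullet> i)\<bar> \<le> ?n * norm h" by (simp add: abs_mult)
        also have "\<dots> \<le> D i" using h d(2)[OF i] n by (simp add: field_simps)
        finally have "W ((?n * (h \<bullet> i)) *\<^sub>R i) \<le> (\<epsilon> / ?n) * \<bar>?n * (h \<bullet> i)\<bar>" by (rule D(2)[OF i])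
        also have "\<dots> \<le> (\<epsilon> / ?n) * (?n * norm h)" using le \<epsilon> by (intro mult_left_mono) auto
        finally show "W ((?n * (h \<bullet> i)) *\<^sub>R i) \<le> \<epsilon> * norm h" by simp
      qed simp
      also have "\<dots> = \<epsilon> * norm h" by simp
      finally show ?thesis .
    qed
    then show ?thesis using d(1) n by (intro exI[of _ "d / ?n"]) auto
  qed
  have "(V has_derivative (\<lambda>h. h \<bullet> g)) (at x)"
    unfolding has_derivative_at_alt
  proof (intro conjI allI impI)
    show "bounded_linear (\<lambda>h. h \<bullet> g)" by (rule bounded_linear_inner_left)
    fix \<epsilon> :: real assume "0 < \<epsilon>"
    then obtain d where d: "0 < d" "\<And>h. norm h < d \<Longrightarrow> W h \<le> \<epsilon> * norm h" using upper by metis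
    show "\<exists>d>0. \<forall>y. norm (y - x) < d \<longrightarrow> norm (V y - V x - (y - x) \<bullet> g) \<le> \<epsilon> * norm (y - x)"
    proof (intro exI[of _ d] conjI allI impI d(1))
      fix y assume y: "norm (y - x) < d"
      have "W 0 \<le> (1 - 1/2) * W (y - x) + (1/2) * W (- (y - x))"
        using convex_onD[OF W, of "1/2" "y - x" "- (y - x)"] by (simp add: scaleR_minus_right del: minus_diff_eq)
      then have "- W (- (y - x)) \<le> W (y - x)" using W0 by simp
      moreover have "W (- (y - x)) \<le> \<epsilon> * norm (y - x)" using d(2)[of "- (y - x)"] y by (simp add: norm_minus_commute)
      ultimately have "\<bar>W (y - x)\<bar> \<le> \<epsilon> * norm (y - x)" using d(2)[OF y] by linarith
      then show "norm (V y - V x - (y - x) \<bullet> g) \<le> \<epsilon> * norm (y - x)" by (simp add: W_def)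
    qed
  qed
  then show ?thesis by (simp add: gderiv_def g_def)
qed

lemma dir_deriv_eq_inner:
  fixes V :: "'a::real_inner \<Rightarrow> real"
  assumes V: "convex_on UNIV V" and D: "GDERIV V x :> D"
  shows "dir_deriv V e x = e \<bullet> D"
proof -
  have "((\<lambda>t. V (x + t *\<^sub>R e)) has_derivative (\<lambda>t. t * (e \<bullet> D))) (at 0)"
  proof -
    have 1: "((\<lambda>t::real. x + t *\<^sub>R e) has_derivative (\<lambda>t. t *\<^sub>R e)) (at 0)" by (auto intro!: derivative_eq_intros)
    have 2: "(V has_derivative (\<lambda>h. h \<bullet> D)) (at (x + 0 *\<^sub>R e))" using D by (simp add: gderiv_def)
    show ?thesis using has_derivative_compose[OF 1 2] by simp
  qed
  then have "((\<lambda>t. V (x + t *\<^sub>R e)) has_field_derivative (e \<bullet> D)) (at 0)"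
    by (simp add: has_field_derivative_def mult_commute_abs)
  then have "((\<lambda>h. (V (x + h *\<^sub>R e) - V x) / h) \<longlongrightarrow> e \<bullet> D) (at 0)" by (simp add: DERIV_def)
  moreover have "filterlim (\<lambda>m. inverse (real (Suc m))) (at 0) sequentially"
    using LIMSEQ_inverse_real_of_nat by (intro filterlim_atI) auto
  ultimately have "(\<lambda>m. (V (x + inverse (real (Suc m)) *\<^sub>R e) - V x) / inverse (real (Suc m))) \<longlonglongrightarrow> e \<bullet> D"
    by (rule filterlim_compose)
  then show ?thesis using dir_deriv_LIMSEQ[OF V] LIMSEQ_unique by blast
qed

lemma GDERIV_gradient:
  fixes V :: "real ^ 'n \<Rightarrow> real"
  assumes "V differentiable (at x)"
  shows "GDERIV V x :> gradient V x"
proof -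
  obtain V' where V': "(V has_derivative V') (at x)" using assms by (auto simp: differentiable_def)
  interpret bounded_linear V' using V' by (rule has_derivative_bounded_linear)
  define D where "D = (\<Sum>i\<in>Basis. V' i *\<^sub>R i)"
  have "V' h = h \<bullet> D" for h
  proof -
    have "V' h = V' (\<Sum>i\<in>Basis. (h \<bullet> i) *\<^sub>R i)" by (simp add: euclidean_representation)
    also have "\<dots> = h \<bullet> D" by (simp add: D_def sum scaleR inner_sum_right mult.commute)
    finally show ?thesis .
  qed
  then have "V' = (\<lambda>h. h \<bullet> D)" by auto
  then have D: "GDERIV V x :> D" using V' by (simp add: gderiv_def)
  have "GDERIV V x :> (THE D. GDERIV V x :> D)"
  proof (rule theI)
    show "D' = D" if "GDERIV V x :> D'" for D'
    proof -
      have "(\<lambda>h. h \<bullet> D') = (\<lambda>h. h \<bullet> D)" using that D unfolding gderiv_def by (rule has_derivative_unique)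
      then have "(D' - D) \<bullet> D' = (D' - D) \<bullet> D" by (rule fun_cong)
      then have "(D' - D) \<bullet> (D' - D) = 0" by (simp add: inner_diff_right)
      then show ?thesis by simp
    qed
  qed (rule D)
  then show ?thesis using assms by (simp add: gradient_def)
qed

lemma differentiable_if_GDERIV: "GDERIV V x :> D \<Longrightarrow> V differentiable (at x)"
  unfolding gderiv_def by (rule differentiableI)

lemma gradient_eqI:
  fixes V :: "real ^ 'n \<Rightarrow> real"
  assumes "GDERIV V x :> D"
  shows "gradient V x = D"
proof -
  have "GDERIV V x :> gradient V x" by (rule GDERIV_gradient[OF differentiable_if_GDERIV[OF assms]])
  then have "(\<lambda>h. h \<bullet> gradient V x) = (\<lambda>h. h \<bullet> D)" using assms unfolding gderiv_def by (rule has_derivative_unique)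
  then have "(gradient V x - D) \<bullet> gradient V x = (gradient V x - D) \<bullet> D" by (rule fun_cong)
  then have "(gradient V x - D) \<bullet> (gradient V x - D) = 0" by (simp add: inner_diff_right)
  then show ?thesis by simp
qed

lemma convex_gradient_inequality:
  fixes V :: "real ^ 'n \<Rightarrow> real"
  assumes V: "convex_on UNIV V" and d: "V differentiable (at x)"
  shows "V x + gradient V x \<bullet> (z - x) \<le> V z"
  using convex_above_dir_deriv[OF V, of 1 x "z - x"] dir_deriv_eq_inner[OF V GDERIV_gradient[OF d], of "z - x"]
  by (simp add: inner_commute)

lemma convex_differentiable_iff:
  fixes V :: "real ^ 'n \<Rightarrow> real"
  assumes V: "convex_on UNIV V"
  shows "V differentiable (at x) \<longleftrightarrow> (\<forall>i\<in>Basis. dir_deriv V i x = - dir_deriv V (- i) x)"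
  using convex_differentiable_at[OF V, of x] dir_deriv_eq_inner[OF V GDERIV_gradient[of V x]]
  by (auto intro: differentiable_if_GDERIV)

lemma AE_convex_differentiable:
  fixes V :: "real ^ 'n \<Rightarrow> real"
  assumes V: "convex_on UNIV V"
  shows "AE x in lborel. V differentiable (at x)"
  unfolding convex_differentiable_iff[OF V]
  using AE_dir_deriv_opposite[OF V] by (subst AE_finite_all) auto

lemma gradient_measurable:
  fixes V :: "real ^ 'n \<Rightarrow> real"
  assumes V: "convex_on UNIV V"
  shows "gradient V \<in> borel_measurable borel"
proof -
  note [measurable] = dir_deriv_measurable[OF V]
  have "gradient V = (\<lambda>x. if \<forall>i\<in>Basis. dir_deriv V i x = - dir_deriv V (- i) x
      then (\<Sum>i\<in>Basis. dir_deriv V i x *\<^sub>R i) else 0)"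
    using convex_differentiable_iff[OF V] convex_differentiable_at[OF V, THEN gradient_eqI]
    by (auto simp: fun_eq_iff gradient_def[of V])
  also have "\<dots> \<in> borel_measurable borel" by measurable
  finally show ?thesis .
qed

section \<open>A variational inequality for moment measures\<close>

locale full_log_concave =
  fixes V :: "real ^ 'n \<Rightarrow> real"
  assumes convex: "convex_on UNIV V"
    and total_mass: "(\<integral>\<^sup>+x. ennreal (exp (- V x)) \<partial>lborel) = 1"
begin

definition law :: "(real ^ 'n) measure" where
  "law = density lborel (\<lambda>x. ennreal (exp (- V x)))"

lemma continuous: "continuous_on UNIV V"
  using convex by (intro convex_on_continuous) auto

lemma V_measurable[measurable]: "V \<in> borel_measurable borel"
  using continuous by (rule borel_measurable_continuous_onI)

lemma gradient_measurable_law[measurable]: "gradient V \<in> borel_measurable borel"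
  using convex by (rule gradient_measurable)

lemma integrable_exp: "integrable lborel (\<lambda>x. exp (- V x))"
  by (rule integrableI_nonneg) (auto simp: total_mass)

lemma coercive: obtains \<alpha> \<beta> where "0 < \<alpha>" "\<And>x. \<alpha> * norm x - \<beta> \<le> V x"
proof -
  have "(\<integral>\<^sup>+x. ennreal (exp (- V x)) \<partial>lborel) < \<infinity>" by (simp add: total_mass)
  from convex_coercive_if_exp_integrable[OF convex this] show ?thesis using that by blast
qed

lemma bounded_below: obtains \<beta> where "\<And>x. - \<beta> \<le> V x"
proof -
  obtain \<alpha> \<beta> where ab: "0 < \<alpha>" "\<And>x. \<alpha> * norm x - \<beta> \<le> V x" using coercive by blast
  have "- \<beta> \<le> V x" for x
    using ab(2)[of x] mult_nonneg_nonneg[of \<alpha> "norm x"] ab(1) norm_ge_zero[of x] by linarith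
  then show ?thesis using that by blast
qed

lemma sets_law[simp, measurable_cong]: "sets law = sets borel"
  by (simp add: law_def)

lemma space_law[simp]: "space law = UNIV"
  by (simp add: law_def)

lemma prob_space_law: "prob_space law"
  by (rule prob_spaceI) (simp add: law_def emeasure_density total_mass)

sublocale law: prob_space law by (rule prob_space_law)

lemma prob_law_UNIV[simp]: "measure law UNIV = 1"
  using law.prob_space by simp

lemma AE_law_iff: "(AE x in law. P x) \<longleftrightarrow> (AE x in lborel. P x)"
  unfolding law_def by (subst AE_density) auto

lemma nn_integral_law:
  "f \<in> borel_measurable borel \<Longrightarrow> (\<integral>\<^sup>+x. f x \<partial>law) = (\<integral>\<^sup>+x. ennreal (exp (- V x)) * f x \<partial>lborel)"
  unfolding law_def by (rule nn_integral_density) auto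

lemma integrable_V: "integrable law V"
  unfolding law_def
  using convex_integrable_exp_times[OF convex integrable_exp] by (subst integrable_real_density) auto

lemma AE_differentiable: "AE x in lborel. V differentiable (at x)"
  by (rule AE_convex_differentiable[OF convex])

lemma gradient_ineq: "V differentiable (at x) \<Longrightarrow> V x + gradient V x \<bullet> (z - x) \<le> V z"
  by (rule convex_gradient_inequality[OF convex])

text \<open>The integral equals \<open>\<kappa> ^ n\<close> times the expectation of \<open>exp (- (\<kappa> - 1) V)\<close> under the law, and Jensen's
  inequality bounds that from below. To first order at \<open>\<kappa> = 1\<close> this is where the dimension and the
  entropy \<open>- \<integral> V\<close> of the law enter.\<close>

lemma integral_exp_dilated_ge:
  assumes \<kappa>: "1 \<le> \<kappa>"
  shows "integrable lborel (\<lambda>x. exp (- \<kappa> * V ((1/\<kappa>) *\<^sub>R x)))"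
    and "\<kappa> ^ CARD('n) * exp (- (\<kappa> - 1) * (\<integral>x. V x \<partial>law)) \<le> (\<integral>x. exp (- \<kappa> * V ((1/\<kappa>) *\<^sub>R x)) \<partial>lborel)"
proof -
  obtain \<beta> where \<beta>: "\<And>x. - \<beta> \<le> V x" using bounded_below by blast
  have le: "exp (- (\<kappa> - 1) * V x) \<le> exp ((\<kappa> - 1) * \<beta>)" for x
    using mult_left_mono[OF \<beta>[of x], of "\<kappa> - 1"] \<kappa> by (simp add: algebra_simps)
  have int: "integrable law (\<lambda>x. exp (- (\<kappa> - 1) * V x))"
    by (rule law.integrable_const_bound[of _ "exp ((\<kappa> - 1) * \<beta>)"]) (use le in auto)
  have eq: "(\<integral>\<^sup>+x. ennreal (exp (- \<kappa> * V ((1/\<kappa>) *\<^sub>R x))) \<partial>lborel) =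
     ennreal (\<kappa> ^ CARD('n) * (\<integral>x. exp (- (\<kappa> - 1) * V x) \<partial>law))"
  proof -
    have "(\<integral>\<^sup>+x. ennreal (exp (- \<kappa> * V ((1/\<kappa>) *\<^sub>R x))) \<partial>lborel)
        = ennreal (\<kappa> ^ CARD('n)) * (\<integral>\<^sup>+x. ennreal (exp (- \<kappa> * V x)) \<partial>lborel)"
      using nn_integral_lborel_scaleR[of "\<lambda>x. ennreal (exp (- \<kappa> * V x))" "1/\<kappa>"] \<kappa>
      by (simp add: power_divide)
    also have "(\<integral>\<^sup>+x. ennreal (exp (- \<kappa> * V x)) \<partial>lborel) = (\<integral>\<^sup>+x. ennreal (exp (- (\<kappa> - 1) * V x)) \<partial>law)"
      by (subst nn_integral_law) (auto simp: algebra_simps simp flip: ennreal_mult exp_add)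
    also have "\<dots> = ennreal (\<integral>x. exp (- (\<kappa> - 1) * V x) \<partial>law)"
      using int by (rule nn_integral_eq_integral) simp
    finally show ?thesis using \<kappa> by (simp add: ennreal_mult)
  qed
  show int': "integrable lborel (\<lambda>x. exp (- \<kappa> * V ((1/\<kappa>) *\<^sub>R x)))"
    by (rule integrableI_nonneg) (use eq in auto)
  have "exp (\<integral>x. - (\<kappa> - 1) * V x \<partial>law) \<le> (\<integral>x. exp (- (\<kappa> - 1) * V x) \<partial>law)"
    by (rule law.jensens_inequality[where I = UNIV]) (use int integrable_V in \<open>auto intro!: exp_convex\<close>)
  then have "\<kappa> ^ CARD('n) * exp (- (\<kappa> - 1) * (\<integral>x. V x \<partial>law)) \<le> \<kappa> ^ CARD('n) * (\<integral>x. exp (- (\<kappa> - 1) * V x) \<partial>law)"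
    using \<kappa> by (intro mult_left_mono) auto
  also have "ennreal \<dots> = ennreal (\<integral>x. exp (- \<kappa> * V ((1/\<kappa>) *\<^sub>R x)) \<partial>lborel)"
    using eq int' by (simp add: nn_integral_eq_integral)
  then have "\<kappa> ^ CARD('n) * (\<integral>x. exp (- (\<kappa> - 1) * V x) \<partial>law) = (\<integral>x. exp (- \<kappa> * V ((1/\<kappa>) *\<^sub>R x)) \<partial>lborel)"
    using \<kappa> by (subst (asm) ennreal_inj) (auto intro!: mult_nonneg_nonneg integral_nonneg_AE)
  finally show "\<kappa> ^ CARD('n) * exp (- (\<kappa> - 1) * (\<integral>x. V x \<partial>law)) \<le> (\<integral>x. exp (- \<kappa> * V ((1/\<kappa>) *\<^sub>R x)) \<partial>lborel)" .
qed

text \<open>The Prekopa--Leindler inequality with \<open>u = exp (- \<kappa> V (x / \<kappa>))\<close>, the given \<open>v\<close> and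
  \<open>w = exp (- V + s G)\<close>. Here \<open>v\<close> plays the role of \<open>exp (- \<phi>)\<close>, and the hypothesis that \<open>v y\<close> is at most
  \<open>exp (g x - \<nabla>V x \<bullet> y)\<close> is the Fenchel inequality between \<open>g = f \<circ> \<nabla>V\<close> and \<open>\<phi> = f\<^sup>*\<close>. Where \<open>G\<close> is given
  by its first branch, the pointwise inequality is the gradient inequality for \<open>V\<close> at the midpoint \<open>z\<close>;
  where \<open>G = M\<close>, it is plain convexity of \<open>V\<close>. The small multiple \<open>\<epsilon>\<close> of
  \<open>\<nabla>V x \<bullet> x - V x\<close> in \<open>G\<close> is what makes a bound by a constant \<open>M\<close> possible, however fast the gradient of \<open>V\<close> grows.\<close>

lemma prekopa_leindler_perturbation:
  fixes v g :: "real ^ 'n \<Rightarrow> real"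
  assumes \<epsilon>: "0 < \<epsilon>" "\<epsilon> < 1" and s: "0 < s" "s < 1"
    and [measurable]: "g \<in> borel_measurable borel"
    and v: "integrable lborel v" "\<And>y. 0 \<le> v y"
    and vg: "AE x in lborel. \<forall>y. v y \<le> exp (g x - gradient V x \<bullet> y)"
    and vM: "\<And>y. v y \<le> exp (M - \<epsilon> * V ((1/\<epsilon>) *\<^sub>R y))"
  defines "\<kappa> \<equiv> (1 - \<epsilon> * s) / (1 - s)"
  defines "G \<equiv> \<lambda>x. min (g x - \<epsilon> * (gradient V x \<bullet> x - V x)) M"
  shows "ennreal ((\<kappa> ^ CARD('n) * exp (- (\<kappa> - 1) * (\<integral>x. V x \<partial>law))) powr (1 - s) * (\<integral>y. v y \<partial>lborel) powr s)
    \<le> (\<integral>\<^sup>+x. ennreal (exp (s * G x)) \<partial>law)"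
proof -
  define a where "a = 1 - \<epsilon> * s"
  have es: "\<epsilon> * s < s" using \<epsilon> s by simp
  then have es1: "\<epsilon> * s < 1" using s by linarith
  have a: "0 < a" "a \<le> 1" "1 - s < a" using \<epsilon> s es es1 by (auto simp: a_def)
  have \<kappa>: "\<kappa> = a / (1 - s)" "1 \<le> \<kappa>" "\<kappa> * (1 - s) = a" "a * (1/\<kappa>) = 1 - s"
    using a s by (auto simp: \<kappa>_def a_def[symmetric] field_simps)
  have [measurable]: "G \<in> borel_measurable borel" unfolding G_def by measurable
  have "AE x in lborel. V differentiable (at x) \<and> (\<forall>y. v y \<le> exp (g x - gradient V x \<bullet> y))"
    using AE_differentiable vg by eventually_elim simp
  then obtain N where N: "N \<in> null_sets lborel"
      "\<And>x. x \<notin> N \<Longrightarrow> V differentiable (at x)" "\<And>x y. x \<notin> N \<Longrightarrow> v y \<le> exp (g x - gradient V x \<bullet> y)"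
    by (rule AE_E3) auto
  have [measurable]: "N \<in> sets borel" using N(1) by auto
  (* the value infinity on the null set spares all case distinctions there *)
  define w :: "real ^ 'n \<Rightarrow> ennreal" where "w z = (if z \<in> N then \<infinity> else ennreal (exp (- V z + s * G z)))" for z
  let ?u = "\<lambda>x. exp (- \<kappa> * V ((1/\<kappa>) *\<^sub>R x))"
  have w: "ennreal (?u x powr (1 - s) * v y powr s) \<le> w ((1 - s) *\<^sub>R x + s *\<^sub>R y)" for x y
  proof -
    define z where "z = (1 - s) *\<^sub>R x + s *\<^sub>R y"
    define x' where "x' = (1/\<kappa>) *\<^sub>R x"
    define y' where "y' = (1/\<epsilon>) *\<^sub>R y"
    define p where "p = gradient V z"
    show ?thesis
    proof (cases "z \<in> N \<or> v y = 0")
      case True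
      then show ?thesis by (auto simp: w_def z_def[symmetric])
    next
      case False
      then have z: "z \<notin> N" and vy: "0 < v y" using v(2)[of y] by auto
      have z_eq: "z = a *\<^sub>R x' + (1 - a) *\<^sub>R y'"
        using \<epsilon> \<kappa>(4) by (simp add: z_def x'_def y'_def a_def)
      have ln_le: "ln c \<le> d" if "0 < c" "c \<le> exp d" for c d :: real
        using that ln_le_cancel_iff[of c "exp d"] by simp
      have l1: "s * ln (v y) \<le> s * (g z - p \<bullet> y)"
        using N(3)[OF z, of y] vy s by (intro mult_left_mono ln_le) (auto simp: p_def)
      have l2: "s * ln (v y) \<le> s * (M - \<epsilon> * V y')"
        using vM[of y] vy s by (intro mult_left_mono ln_le) (auto simp: y'_def)
      (* first branch of G: gradient inequality at z *)
      have "a * (V z + p \<bullet> (x' - z)) \<le> a * V x'"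
        using gradient_ineq[OF N(2)[OF z], of x'] a by (intro mult_left_mono) (auto simp: p_def)
      moreover have "a * (p \<bullet> (x' - z)) = \<epsilon> * s * (p \<bullet> z) - s * (p \<bullet> y)"
      proof -
        have "a *\<^sub>R x' = z - s *\<^sub>R y" using \<kappa>(4) by (simp add: x'_def z_def)
        then have "a *\<^sub>R (x' - z) = (1 - a) *\<^sub>R z - s *\<^sub>R y" by (simp add: algebra_simps)
        then have "p \<bullet> (a *\<^sub>R (x' - z)) = p \<bullet> ((1 - a) *\<^sub>R z - s *\<^sub>R y)" by simp
        then show ?thesis by (simp add: inner_diff_right a_def)
      qed
      ultimately have "a * V z + (\<epsilon> * s * (p \<bullet> z) - s * (p \<bullet> y)) \<le> a * V x'" by (simp add: distrib_left)
      then have 1: "- a * V x' + s * ln (v y) \<le> - V z + s * (g z - \<epsilon> * (p \<bullet> z - V z))"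
        using l1 by (simp add: a_def algebra_simps)
      (* second branch of G: z is a convex combination of x' and y' *)
      have "V z \<le> a * V x' + (1 - a) * V y'"
        using convex_onD[OF convex, of "1 - a" x' y'] a by (simp add: z_eq)
      then have 2: "- a * V x' + s * ln (v y) \<le> - V z + s * M"
        using l2 by (simp add: a_def algebra_simps)
      have "- a * V x' + s * ln (v y) \<le> - V z + s * G z"
        using 1 2 by (auto simp: G_def p_def[symmetric] min_def)
      then have "exp (- a * V x' + s * ln (v y)) \<le> exp (- V z + s * G z)" by simp
      moreover have "?u x powr (1 - s) * v y powr s = exp (- a * V x' + s * ln (v y))"
        using vy \<kappa>(3) by (simp add: powr_def x'_def algebra_simps flip: \<kappa>(3) exp_add)
      ultimately show ?thesis using z by (simp add: w_def z_def[symmetric] ennreal_leI)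
    qed
  qed
  have "ennreal ((\<kappa> ^ CARD('n) * exp (- (\<kappa> - 1) * (\<integral>x. V x \<partial>law))) powr (1 - s) * (\<integral>y. v y \<partial>lborel) powr s)
    \<le> ennreal ((\<integral>x. ?u x \<partial>lborel) powr (1 - s) * (\<integral>y. v y \<partial>lborel) powr s)"
    using integral_exp_dilated_ge(2)[OF \<kappa>(2)] s \<kappa>(2)
    by (intro ennreal_leI mult_right_mono powr_mono2) auto
  also have "\<dots> \<le> (\<integral>\<^sup>+x. w x \<partial>lborel)"
  proof (rule prekopa_leindler)
    show "w \<in> borel_measurable borel" unfolding w_def by measurable
    show "integrable lborel ?u" by (rule integral_exp_dilated_ge(1)[OF \<kappa>(2)])
  qed (use v s w in auto)
  also have "\<dots> = (\<integral>\<^sup>+x. ennreal (exp (- V x)) * ennreal (exp (s * G x)) \<partial>lborel)"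
  proof (rule nn_integral_cong_AE)
    show "AE x in lborel. w x = ennreal (exp (- V x)) * ennreal (exp (s * G x))"
      using AE_not_in[OF N(1)] by eventually_elim (auto simp: w_def simp flip: ennreal_mult exp_add)
  qed
  also have "\<dots> = (\<integral>\<^sup>+x. ennreal (exp (s * G x)) \<partial>law)" by (rule nn_integral_law[symmetric]) measurable
  finally show ?thesis .
qed


text \<open>For a bounded function, the exponential moment is its first-order expansion up to \<open>O(s\<^sup>2)\<close>.\<close>

lemma expectation_exp_small:
  fixes G :: "real ^ 'n \<Rightarrow> real"
  assumes [measurable]: "G \<in> borel_measurable borel" and G: "\<And>x. \<bar>G x\<bar> \<le> K"
    and s: "0 < s" "s * K \<le> 1/2"
  shows "(\<integral>\<^sup>+x. ennreal (exp (s * G x)) \<partial>law) \<le> ennreal (1 + s * (\<integral>x. G x \<partial>law) + 2 * s\<^sup>2 * K\<^sup>2)"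
proof -
  have K: "0 \<le> K" using G[of 0] by linarith
  have exp_le: "exp t \<le> 1 + t + 2 * t\<^sup>2" if "t \<le> 1/2" for t :: real
  proof -
    have "exp t * (1 - t) \<le> exp t * exp (- t)"
      using exp_ge_add_one_self[of "- t"] by (intro mult_left_mono) auto
    also have "\<dots> = 1" by (simp flip: exp_add)
    also have "1 \<le> (1 + t + 2 * t\<^sup>2) * (1 - t)"
    proof -
      have "0 \<le> t\<^sup>2 * (1 - 2 * t)" using that by (intro mult_nonneg_nonneg) auto
      then show ?thesis by (simp add: algebra_simps power2_eq_square)
    qed
    finally show ?thesis using that by simp
  qed
  have int: "integrable law G" by (rule law.integrable_const_bound[of _ K]) (use G in auto)
  have "(\<integral>\<^sup>+x. ennreal (exp (s * G x)) \<partial>law) \<le> (\<integral>\<^sup>+x. ennreal (1 + s * G x + 2 * s\<^sup>2 * K\<^sup>2) \<partial>law)"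
  proof (intro nn_integral_mono ennreal_leI)
    fix x
    have "\<bar>s * G x\<bar> \<le> s * K" using G[of x] s by (simp add: abs_mult)
    then have "s * G x \<le> 1/2" "(s * G x)\<^sup>2 \<le> (s * K)\<^sup>2"
      using s K by (auto simp: abs_le_square_iff[symmetric])
    then show "exp (s * G x) \<le> 1 + s * G x + 2 * s\<^sup>2 * K\<^sup>2"
      using exp_le[of "s * G x"] by (simp add: power_mult_distrib)
  qed
  also have "\<dots> = ennreal (\<integral>x. 1 + s * G x + 2 * s\<^sup>2 * K\<^sup>2 \<partial>law)"
  proof (rule nn_integral_eq_integral)
    show "AE x in law. 0 \<le> 1 + s * G x + 2 * s\<^sup>2 * K\<^sup>2"
    proof (rule AE_I2)
      fix x
      have "\<bar>s * G x\<bar> \<le> s * K" using G[of x] s by (simp add: abs_mult)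
      then have "0 \<le> 1 + s * G x" using s by linarith
      then show "0 \<le> 1 + s * G x + 2 * s\<^sup>2 * K\<^sup>2" by simp
    qed
  qed (use int in simp)
  also have "(\<integral>x. 1 + s * G x + 2 * s\<^sup>2 * K\<^sup>2 \<partial>law) = 1 + s * (\<integral>x. G x \<partial>law) + 2 * s\<^sup>2 * K\<^sup>2"
    using int by (simp add: law.prob_space)
  finally show ?thesis .
qed

text \<open>First-order comparison as \<open>s\<close> tends to 0 in the perturbed Prekopa--Leindler inequality. The lower
  truncation at \<open>- L\<close> makes the perturbation bounded, so that the expansion is uniform.\<close>

lemma ln_integral_le_dominated:
  fixes v g :: "real ^ 'n \<Rightarrow> real"
  assumes \<epsilon>: "0 < \<epsilon>" "\<epsilon> < 1"
    and [measurable]: "g \<in> borel_measurable borel"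
    and gint: "integrable law (\<lambda>x. max (g x) (- L))"
    and v: "integrable lborel v" "\<And>y. 0 \<le> v y" and Z: "0 < (\<integral>y. v y \<partial>lborel)"
    and vg: "AE x in lborel. \<forall>y. v y \<le> exp (g x - gradient V x \<bullet> y)"
    and vM: "\<And>y. v y \<le> exp (M - \<epsilon> * V ((1/\<epsilon>) *\<^sub>R y))"
  shows "(1 - \<epsilon>) * (real CARD('n) - (\<integral>x. V x \<partial>law)) + ln (\<integral>y. v y \<partial>lborel)
    \<le> (\<integral>x. max (g x) (- L) \<partial>law) + \<epsilon> * \<bar>V 0\<bar>"
proof -
  define G where "G x = min (g x - \<epsilon> * (gradient V x \<bullet> x - V x)) M" for x
  define H where "H x = max (G x) (- L)" for x
  have [measurable]: "G \<in> borel_measurable borel" "H \<in> borel_measurable borel"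
    unfolding H_def G_def by measurable
  define K where "K = \<bar>M\<bar> + \<bar>L\<bar> + 1"
  have K: "0 < K" "\<bar>H x\<bar> \<le> K" for x by (auto simp: K_def H_def G_def)
  let ?Z = "\<integral>y. v y \<partial>lborel" and ?m = "\<integral>x. V x \<partial>law" and ?n = "real CARD('n)"
  have step: "(1 - s) * ?n * (1 - \<epsilon>) - (1 - \<epsilon>) * ?m + ln ?Z \<le> (\<integral>x. H x \<partial>law) + 2 * s * K\<^sup>2"
    if s: "0 < s" "s < 1" "s * K \<le> 1/2" for s
  proof -
    define \<kappa> where "\<kappa> = (1 - \<epsilon> * s) / (1 - s)"
    have es: "\<epsilon> * s < s" using \<epsilon> s by simp
    have \<kappa>: "1 \<le> \<kappa>" "(1 - s) * \<kappa> = 1 - \<epsilon> * s" using s es by (auto simp: \<kappa>_def field_simps)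
    have lnk: "s * (1 - \<epsilon>) \<le> ln \<kappa>"
    proof -
      have "1 - 1 / \<kappa> \<le> ln \<kappa>"
        using ln_le_minus_one[of "1 / \<kappa>"] \<kappa> by (simp add: ln_div)
      moreover have "s * (1 - \<epsilon>) \<le> 1 - 1 / \<kappa>"
      proof -
        have "0 < 1 - \<epsilon> * s" using es s by linarith
        then have "1 - 1 / \<kappa> = s * (1 - \<epsilon>) / (1 - \<epsilon> * s)"
          using s by (simp add: \<kappa>_def field_simps)
        moreover have "s * (1 - \<epsilon>) * (1 - \<epsilon> * s) \<le> s * (1 - \<epsilon>)"
          using s \<epsilon> by (intro mult_left_le) auto
        ultimately show ?thesis using \<open>0 < 1 - \<epsilon> * s\<close> by (simp add: pos_le_divide_eq)
      qed
      ultimately show ?thesis by simp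
    qed
    have "(\<kappa> ^ CARD('n) * exp (- (\<kappa> - 1) * ?m)) powr (1 - s) * ?Z powr s
        = exp ((1 - s) * (?n * ln \<kappa> - (\<kappa> - 1) * ?m) + s * ln ?Z)"
    proof -
      have "ln (\<kappa> ^ CARD('n) * exp (- (\<kappa> - 1) * ?m)) = ?n * ln \<kappa> - (\<kappa> - 1) * ?m"
        using \<kappa> by (simp add: ln_mult ln_realpow algebra_simps)
      moreover have "0 < \<kappa> ^ CARD('n)" using \<kappa> by simp
      ultimately show ?thesis using Z \<kappa> by (simp add: powr_def exp_add)
    qed
    moreover have "s * ((1 - s) * ?n * (1 - \<epsilon>) - (1 - \<epsilon>) * ?m + ln ?Z)
       \<le> (1 - s) * (?n * ln \<kappa> - (\<kappa> - 1) * ?m) + s * ln ?Z"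
    proof -
      have "(1 - s) * ?n * (s * (1 - \<epsilon>)) \<le> (1 - s) * ?n * ln \<kappa>"
        using lnk s by (intro mult_left_mono) auto
      moreover have "(1 - s) * ((\<kappa> - 1) * ?m) = s * (1 - \<epsilon>) * ?m"
      proof -
        have "(1 - s) * (\<kappa> - 1) = s * (1 - \<epsilon>)" using \<kappa>(2) by (simp add: algebra_simps)
        then show ?thesis by (simp add: mult.assoc[symmetric])
      qed
      ultimately show ?thesis by (simp add: algebra_simps)
    qed
    moreover have "1 + s * ((1 - s) * ?n * (1 - \<epsilon>) - (1 - \<epsilon>) * ?m + ln ?Z)
       \<le> exp (s * ((1 - s) * ?n * (1 - \<epsilon>) - (1 - \<epsilon>) * ?m + ln ?Z))"
      by (rule exp_ge_add_one_self)
    ultimately have lower: "1 + s * ((1 - s) * ?n * (1 - \<epsilon>) - (1 - \<epsilon>) * ?m + ln ?Z)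
      \<le> (\<kappa> ^ CARD('n) * exp (- (\<kappa> - 1) * ?m)) powr (1 - s) * ?Z powr s"
      by (smt (verit) exp_le_cancel_iff)
    have "ennreal ((\<kappa> ^ CARD('n) * exp (- (\<kappa> - 1) * ?m)) powr (1 - s) * ?Z powr s)
      \<le> (\<integral>\<^sup>+x. ennreal (exp (s * G x)) \<partial>law)"
      unfolding \<kappa>_def G_def
      by (rule prekopa_leindler_perturbation[OF \<epsilon> s(1,2) assms(3) v vg vM])
    also have "\<dots> \<le> (\<integral>\<^sup>+x. ennreal (exp (s * H x)) \<partial>law)"
      using s by (intro nn_integral_mono ennreal_leI) (auto simp: H_def)
    also have "\<dots> \<le> ennreal (1 + s * (\<integral>x. H x \<partial>law) + 2 * s\<^sup>2 * K\<^sup>2)"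
      by (rule expectation_exp_small) (use K s in auto)
    finally have "ennreal (1 + s * ((1 - s) * ?n * (1 - \<epsilon>) - (1 - \<epsilon>) * ?m + ln ?Z)) \<le> \<dots>"
      using lower by (meson ennreal_leI order_trans)
    moreover have "0 \<le> 1 + s * (\<integral>x. H x \<partial>law) + 2 * s\<^sup>2 * K\<^sup>2"
    proof -
      have "- K \<le> (\<integral>x. H x \<partial>law)"
      proof -
        have "(\<integral>x. - K \<partial>law) \<le> (\<integral>x. H x \<partial>law)"
        proof (rule integral_mono)
          show "integrable law H" by (rule law.integrable_const_bound[of _ K]) (use K in auto)
          show "- K \<le> H x" for x using K(2)[of x] by linarith
        qed simp
        then show ?thesis by (simp add: law.prob_space)
      qed
      then have "s * (- K) \<le> s * (\<integral>x. H x \<partial>law)" using s by (intro mult_left_mono) auto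
      then have "0 \<le> 1 + s * (\<integral>x. H x \<partial>law)" using s by simp
      then show ?thesis by simp
    qed
    ultimately have "1 + s * ((1 - s) * ?n * (1 - \<epsilon>) - (1 - \<epsilon>) * ?m + ln ?Z)
      \<le> 1 + s * (\<integral>x. H x \<partial>law) + 2 * s\<^sup>2 * K\<^sup>2"
      by (simp add: ennreal_le_iff)
    then have "s * ((1 - s) * ?n * (1 - \<epsilon>) - (1 - \<epsilon>) * ?m + ln ?Z) \<le> s * ((\<integral>x. H x \<partial>law) + 2 * s * K\<^sup>2)"
      by (simp add: algebra_simps power2_eq_square)
    then show ?thesis using s by simp
  qed
  have lim: "(1 - 0) * ?n * (1 - \<epsilon>) - (1 - \<epsilon>) * ?m + ln ?Z \<le> (\<integral>x. H x \<partial>law) + 2 * 0 * K\<^sup>2"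
  proof (rule tendsto_le[of "at_right (0::real)"])
    show "((\<lambda>s. (\<integral>x. H x \<partial>law) + 2 * s * K\<^sup>2) \<longlongrightarrow> (\<integral>x. H x \<partial>law) + 2 * 0 * K\<^sup>2) (at_right 0)"
      by (intro tendsto_intros)
    show "((\<lambda>s. (1 - s) * ?n * (1 - \<epsilon>) - (1 - \<epsilon>) * ?m + ln ?Z) \<longlongrightarrow> (1 - 0) * ?n * (1 - \<epsilon>) - (1 - \<epsilon>) * ?m + ln ?Z) (at_right 0)"
      by (intro tendsto_intros)
    have "0 < min 1 (1 / (2 * K))" using K by simp
    from eventually_at_right_real[OF this]
    show "\<forall>\<^sub>F s in at_right 0. (1 - s) * ?n * (1 - \<epsilon>) - (1 - \<epsilon>) * ?m + ln ?Z \<le> (\<integral>x. H x \<partial>law) + 2 * s * K\<^sup>2"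
    proof eventually_elim
      case (elim s)
      then show ?case using K(1) by (intro step) (auto simp: field_simps)
    qed
  qed simp
  have "(\<integral>x. H x \<partial>law) \<le> (\<integral>x. max (g x) (- L) + \<epsilon> * \<bar>V 0\<bar> \<partial>law)"
  proof (rule integral_mono_AE)
    show "integrable law H" by (rule law.integrable_const_bound[of _ K]) (use K in auto)
    show "integrable law (\<lambda>x. max (g x) (- L) + \<epsilon> * \<bar>V 0\<bar>)" using gint by simp
    show "AE x in law. H x \<le> max (g x) (- L) + \<epsilon> * \<bar>V 0\<bar>"
      unfolding AE_law_iff using AE_differentiable
    proof eventually_elim
      case (elim x)
      (* the gradient inequality evaluated at 0 keeps the correction term bounded below *)
      have "- \<bar>V 0\<bar> \<le> gradient V x \<bullet> x - V x"
        using gradient_ineq[OF elim, of 0] by simp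
      then have "\<epsilon> * (- \<bar>V 0\<bar>) \<le> \<epsilon> * (gradient V x \<bullet> x - V x)" using \<epsilon> by (intro mult_left_mono) auto
      moreover have "0 \<le> \<epsilon> * \<bar>V 0\<bar>" using \<epsilon> by simp
      ultimately show ?case unfolding H_def G_def by (simp add: max_def min_def)
    qed
  qed
  also have "\<dots> = (\<integral>x. max (g x) (- L) \<partial>law) + \<epsilon> * \<bar>V 0\<bar>" using gint by (simp add: law.prob_space)
  finally show ?thesis using lim by (simp add: algebra_simps)
qed

end

text \<open>Used to turn almost-everywhere relations between continuous functions into identities.\<close>

lemma closed_AE_lborel_UNIV:
  fixes S :: "'a::euclidean_space set"
  assumes S: "closed S" and AE: "AE x in lborel. x \<in> S"
  shows "S = UNIV"
proof (rule ccontr)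
  assume "S \<noteq> UNIV"
  then obtain x0 r where r: "0 < r" "ball x0 r \<subseteq> - S"
    using S open_contains_ball[of "- S"] by blast
  have "AE x in lborel. x \<notin> ball x0 r" using AE by eventually_elim (use r in blast)
  then have "emeasure lborel (ball x0 r) = 0"
    by (subst (asm) AE_iff_measurable[OF _ refl]) (auto simp: ball_def)
  moreover have "0 < measure lborel (ball x0 r)" using r by (simp add: content_ball_pos)
  ultimately show False by (simp add: measure_def)
qed

context full_log_concave
begin

text \<open>Bounded support makes \<open>v\<close> comparable with \<open>exp (M - \<epsilon> V (y / \<epsilon>))\<close> for every \<open>\<epsilon>\<close>; then \<open>\<epsilon>\<close> tends to 0.\<close>

lemma nn_integral_le_truncated_bounded_support:
  fixes v g :: "real ^ 'n \<Rightarrow> real"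
  assumes [measurable]: "g \<in> borel_measurable borel" "v \<in> borel_measurable borel"
    and gint: "integrable law (\<lambda>x. max (g x) (- L))"
    and v: "\<And>y. 0 \<le> v y" "\<And>y. k < norm y \<Longrightarrow> v y = 0" and k: "0 \<le> k"
    and vg: "AE x in lborel. \<forall>y. v y \<le> exp (g x - gradient V x \<bullet> y)"
  shows "(\<integral>\<^sup>+y. ennreal (v y) \<partial>lborel) \<le> ennreal (exp ((\<integral>x. max (g x) (- L) \<partial>law) - (real CARD('n) - (\<integral>x. V x \<partial>law))))"
proof -
  have "AE x in law. \<forall>y. v y \<le> exp (g x - gradient V x \<bullet> y)" using vg by (simp add: AE_law_iff)
  then obtain x0 where x0: "\<And>y. v y \<le> exp (g x0 - gradient V x0 \<bullet> y)"
    using eventually_happens'[OF law.ae_filter_bot] by blast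
  define B where "B = g x0 + norm (gradient V x0) * k"
  have vB: "v y \<le> exp B" for y
  proof (cases "k < norm y")
    case True then show ?thesis using v by simp
  next
    case False
    have "- (gradient V x0 \<bullet> y) \<le> norm (gradient V x0) * norm y"
      using Cauchy_Schwarz_ineq2[of "gradient V x0" y] by linarith
    also have "\<dots> \<le> norm (gradient V x0) * k" using False by (intro mult_left_mono) auto
    finally have "exp (g x0 - gradient V x0 \<bullet> y) \<le> exp B" by (simp add: B_def)
    then show ?thesis using x0[of y] by linarith
  qed
  have vint: "integrable lborel v"
  proof (rule Bochner_Integration.integrable_bound)
    have "emeasure lborel (cball (0::real ^ 'n) k) < top"
      using emeasure_bounded_finite[OF bounded_cball, of "0::real ^ 'n" k] by simp
    then show "integrable lborel (\<lambda>y. exp B * indicator (cball (0::real ^ 'n) k) y :: real)"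
      by (intro integrable_mult_right integrable_real_indicator) auto
    show "AE y in lborel. norm (v y) \<le> norm (exp B * indicator (cball (0::real ^ 'n) k) y :: real)"
      using v vB by (intro AE_I2) (auto simp: indicator_def)
  qed simp
  let ?Z = "\<integral>y. v y \<partial>lborel" and ?m = "\<integral>x. V x \<partial>law" and ?n = "real CARD('n)"
  have Z: "(\<integral>\<^sup>+y. ennreal (v y) \<partial>lborel) = ennreal ?Z"
    using vint v by (intro nn_integral_eq_integral) auto
  show ?thesis
  proof (cases "0 < ?Z")
    case False
    then show ?thesis unfolding Z by (simp add: ennreal_neg)
  next
    case True
    have step: "(1 - \<epsilon>) * (?n - ?m) + ln ?Z \<le> (\<integral>x. max (g x) (- L) \<partial>law) + \<epsilon> * \<bar>V 0\<bar>"
      if \<epsilon>: "0 < \<epsilon>" "\<epsilon> < 1" for \<epsilon>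
    proof -
      have "cball (0::real ^ 'n) (k / \<epsilon>) \<noteq> {}" using k \<epsilon> divide_nonneg_pos[of k \<epsilon>] by (simp add: not_less)
      then obtain b where b: "\<And>z. z \<in> cball 0 (k / \<epsilon>) \<Longrightarrow> V z \<le> V b"
        using continuous_attains_sup[OF compact_cball _ continuous_on_subset[OF continuous subset_UNIV], of "0::real ^ 'n" "k / \<epsilon>"]
        by blast
      show ?thesis
      proof (rule ln_integral_le_dominated[OF \<epsilon> _ gint vint v(1) True vg, where M = "B + \<epsilon> * V b"])
        fix y
        show "v y \<le> exp (B + \<epsilon> * V b - \<epsilon> * V ((1/\<epsilon>) *\<^sub>R y))"
        proof (cases "k < norm y")
          case True then show ?thesis using v by simp
        next
          case False
          then have "(1/\<epsilon>) *\<^sub>R y \<in> cball 0 (k / \<epsilon>)" using \<epsilon> by (simp add: divide_right_mono)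
          then have "\<epsilon> * V ((1/\<epsilon>) *\<^sub>R y) \<le> \<epsilon> * V b" using b \<epsilon> by (intro mult_left_mono) auto
          then have "exp B \<le> exp (B + \<epsilon> * V b - \<epsilon> * V ((1/\<epsilon>) *\<^sub>R y))" by simp
          then show ?thesis using vB[of y] by linarith
        qed
      qed simp
    qed
    have "(1 - 0) * (?n - ?m) + ln ?Z \<le> (\<integral>x. max (g x) (- L) \<partial>law) + 0 * \<bar>V 0\<bar>"
    proof (rule tendsto_le[of "at_right (0::real)"])
      show "((\<lambda>\<epsilon>. (\<integral>x. max (g x) (- L) \<partial>law) + \<epsilon> * \<bar>V 0\<bar>) \<longlongrightarrow> (\<integral>x. max (g x) (- L) \<partial>law) + 0 * \<bar>V 0\<bar>) (at_right 0)"
        by (intro tendsto_intros)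
      show "((\<lambda>\<epsilon>. (1 - \<epsilon>) * (?n - ?m) + ln ?Z) \<longlongrightarrow> (1 - 0) * (?n - ?m) + ln ?Z) (at_right 0)"
        by (intro tendsto_intros)
      show "\<forall>\<^sub>F \<epsilon> in at_right 0. (1 - \<epsilon>) * (?n - ?m) + ln ?Z \<le> (\<integral>x. max (g x) (- L) \<partial>law) + \<epsilon> * \<bar>V 0\<bar>"
        using eventually_at_right_real[of 0 1] by (auto elim!: eventually_mono intro!: step)
    qed simp
    then have "exp (ln ?Z) \<le> exp ((\<integral>x. max (g x) (- L) \<partial>law) - (?n - ?m))" by simp
    then show ?thesis unfolding Z using True by (simp add: ennreal_leI)
  qed
qed

lemma nn_integral_le_truncated:
  fixes v g :: "real ^ 'n \<Rightarrow> real"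
  assumes [measurable]: "g \<in> borel_measurable borel" "v \<in> borel_measurable borel"
    and gint: "integrable law (\<lambda>x. max (g x) (- L))"
    and v: "\<And>y. 0 \<le> v y"
    and vg: "AE x in lborel. \<forall>y. v y \<le> exp (g x - gradient V x \<bullet> y)"
  shows "(\<integral>\<^sup>+y. ennreal (v y) \<partial>lborel) \<le> ennreal (exp ((\<integral>x. max (g x) (- L) \<partial>law) - (real CARD('n) - (\<integral>x. V x \<partial>law))))"
proof (rule LIMSEQ_le_const2)
  define vk where "vk k y = (if norm y \<le> real k then v y else 0)" for k :: nat and y
  have [measurable]: "vk k \<in> borel_measurable borel" for k unfolding vk_def by measurable
  show "(\<lambda>k. \<integral>\<^sup>+y. ennreal (vk k y) \<partial>lborel) \<longlonglongrightarrow> (\<integral>\<^sup>+y. ennreal (v y) \<partial>lborel)"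
  proof (rule nn_integral_LIMSEQ)
    show "incseq (\<lambda>k y. ennreal (vk k y))" using v by (auto simp: incseq_def le_fun_def vk_def)
    fix y :: "real ^ 'n"
    obtain N :: nat where N: "norm y \<le> real N" using real_arch_simple by blast
    show "(\<lambda>k. ennreal (vk k y)) \<longlonglongrightarrow> ennreal (v y)"
    proof (rule tendsto_eventually)
      show "\<forall>\<^sub>F k in sequentially. ennreal (vk k y) = ennreal (v y)"
        using eventually_ge_at_top[of N]
      proof eventually_elim
        case (elim k)
        then have "norm y \<le> real k" using N by linarith
        then show ?case by (simp add: vk_def)
      qed
    qed
  qed simp
  have "(\<integral>\<^sup>+y. ennreal (vk k y) \<partial>lborel) \<le> ennreal (exp ((\<integral>x. max (g x) (- L) \<partial>law) - (real CARD('n) - (\<integral>x. V x \<partial>law))))" for k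
  proof (rule nn_integral_le_truncated_bounded_support[where k = "real k"])
    show "AE x in lborel. \<forall>y. vk k y \<le> exp (g x - gradient V x \<bullet> y)"
      using vg by eventually_elim (auto simp: vk_def)
  qed (use gint v in \<open>auto simp: vk_def\<close>)
  then show "\<exists>N. \<forall>k\<ge>N. (\<integral>\<^sup>+y. ennreal (vk k y) \<partial>lborel)
     \<le> ennreal (exp ((\<integral>x. max (g x) (- L) \<partial>law) - (real CARD('n) - (\<integral>x. V x \<partial>law))))" by blast
qed

text \<open>The variational inequality of Cordero-Erausquin and Klartag. With \<open>v = exp (- f\<^sup>*)\<close>, \<open>g = f \<circ> \<nabla>V\<close> and
  \<open>H = - \<integral> V\<close> the entropy of the law, it says
  \<open>\<integral> f d\<nu> \<ge> n + H + ln (\<integral> exp (- f\<^sup>*))\<close> for the moment measure \<open>\<nu>\<close>. Finiteness of the positive part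
  of \<open>g\<close> suffices: the lower bounds for the truncations \<open>max g (- L)\<close> are uniform in \<open>L\<close>
  and so force the negative part to be integrable.\<close>

theorem moment_measure_inequality:
  fixes v g :: "real ^ 'n \<Rightarrow> real"
  assumes [measurable]: "g \<in> borel_measurable borel" "v \<in> borel_measurable borel"
    and gint: "integrable law (\<lambda>x. max (g x) 0)"
    and v: "\<And>y. 0 \<le> v y" "0 < (\<integral>\<^sup>+y. ennreal (v y) \<partial>lborel)"
    and vg: "AE x in lborel. \<forall>y. v y \<le> exp (g x - gradient V x \<bullet> y)"
  shows "integrable law g"
    and "(\<integral>\<^sup>+y. ennreal (v y) \<partial>lborel) \<le> ennreal (exp ((\<integral>x. g x \<partial>law) - (real CARD('n) - (\<integral>x. V x \<partial>law))))"
proof -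
  let ?d = "real CARD('n) - (\<integral>x. V x \<partial>law)"
  have int: "integrable law (\<lambda>x. max (g x) (- real L))" for L :: nat
  proof (rule Bochner_Integration.integrable_bound)
    show "integrable law (\<lambda>x. max (g x) 0 + real L)" using gint by simp
    have "norm (max (g x) (- real L)) \<le> norm (max (g x) 0 + real L)" for x by (simp add: max_def)
    then show "AE x in law. norm (max (g x) (- real L)) \<le> norm (max (g x) 0 + real L)" by simp
  qed simp
  have le: "(\<integral>\<^sup>+y. ennreal (v y) \<partial>lborel) \<le> ennreal (exp ((\<integral>x. max (g x) (- real L) \<partial>law) - ?d))" for L :: nat
    by (rule nn_integral_le_truncated) (use int v vg in auto)
  have "(\<integral>\<^sup>+y. ennreal (v y) \<partial>lborel) < top" using le[of 0] by (rule le_less_trans) simp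
  then obtain Z where Z: "(\<integral>\<^sup>+y. ennreal (v y) \<partial>lborel) = ennreal Z" "0 \<le> Z"
    by (cases "\<integral>\<^sup>+y. ennreal (v y) \<partial>lborel") auto
  have Z0: "0 < Z" using v(2) Z by simp
  have lower: "ln Z + ?d \<le> (\<integral>x. max (g x) (- real L) \<partial>law)" for L :: nat
  proof -
    have "Z \<le> exp ((\<integral>x. max (g x) (- real L) \<partial>law) - ?d)" using le[of L] unfolding Z(1) by simp
    then have "ln Z \<le> ln (exp ((\<integral>x. max (g x) (- real L) \<partial>law) - ?d))" using Z0 by (subst ln_le_cancel_iff) auto
    then show ?thesis by simp
  qed
  define h where "h L x = max (g x) 0 - max (g x) (- real L)" for L :: nat and x
  have h: "h L x = min (max (- g x) 0) (real L)" for L x by (auto simp: h_def max_def min_def)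
  have hint: "(\<integral>\<^sup>+x. ennreal (h L x) \<partial>law) \<le> ennreal ((\<integral>x. max (g x) 0 \<partial>law) - (ln Z + ?d))" for L
  proof -
    have "(\<integral>\<^sup>+x. ennreal (h L x) \<partial>law) = ennreal (\<integral>x. h L x \<partial>law)"
    proof (rule nn_integral_eq_integral)
      show "integrable law (h L)" unfolding h_def using gint int by simp
      show "AE x in law. 0 \<le> h L x" unfolding h by simp
    qed
    also have "(\<integral>x. h L x \<partial>law) = (\<integral>x. max (g x) 0 \<partial>law) - (\<integral>x. max (g x) (- real L) \<partial>law)"
      unfolding h_def using gint int by simp
    finally show ?thesis using lower[of L] by (simp add: ennreal_leI)
  qed
  have "(\<integral>\<^sup>+x. ennreal (max (- g x) 0) \<partial>law) \<le> ennreal ((\<integral>x. max (g x) 0 \<partial>law) - (ln Z + ?d))"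
  proof (rule LIMSEQ_le_const2)
    show "(\<lambda>L. \<integral>\<^sup>+x. ennreal (h L x) \<partial>law) \<longlonglongrightarrow> (\<integral>\<^sup>+x. ennreal (max (- g x) 0) \<partial>law)"
    proof (rule nn_integral_LIMSEQ)
      show "incseq (\<lambda>L x. ennreal (h L x))"
        unfolding h by (auto simp: incseq_def le_fun_def intro!: ennreal_leI)
      show "(\<lambda>x. ennreal (h L x)) \<in> borel_measurable law" for L unfolding h_def by measurable
      fix x
      obtain N :: nat where N: "max (- g x) 0 \<le> real N" using real_arch_simple by blast
      show "(\<lambda>L. ennreal (h L x)) \<longlonglongrightarrow> ennreal (max (- g x) 0)"
      proof (rule tendsto_eventually)
        show "\<forall>\<^sub>F L in sequentially. ennreal (h L x) = ennreal (max (- g x) 0)"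
          using eventually_ge_at_top[of N]
        proof eventually_elim
          case (elim L)
          then have "max (- g x) 0 \<le> real L" using N by linarith
          then show ?case unfolding h by (simp only: min_absorb1)
        qed
      qed
    qed
  qed (intro exI[of _ 0] allI impI hint)
  then have "(\<integral>\<^sup>+x. ennreal (max (- g x) 0) \<partial>law) < \<infinity>" by (rule le_less_trans) simp
  then have neg: "integrable law (\<lambda>x. max (- g x) 0)" by (intro integrableI_nonneg) auto
  have "integrable law (\<lambda>x. max (g x) 0 - max (- g x) 0)" using gint neg by simp
  moreover have "(\<lambda>x. max (g x) 0 - max (- g x) 0) = g" by (auto simp: max_def fun_eq_iff)
  ultimately show g: "integrable law g" by simp
  show "(\<integral>\<^sup>+y. ennreal (v y) \<partial>lborel) \<le> ennreal (exp ((\<integral>x. g x \<partial>law) - ?d))"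
  proof (rule LIMSEQ_le_const)
    have "(\<lambda>L. \<integral>x. max (g x) (- real L) \<partial>law) \<longlonglongrightarrow> (\<integral>x. g x \<partial>law)"
    proof (rule integral_dominated_convergence[where w = "\<lambda>x. \<bar>g x\<bar>"])
      have "(\<lambda>L. max (g x) (- real L)) \<longlonglongrightarrow> g x" for x
      proof (rule tendsto_eventually)
        obtain N :: nat where N: "- g x \<le> real N" using real_arch_simple by blast
        show "\<forall>\<^sub>F L in sequentially. max (g x) (- real L) = g x"
          using eventually_ge_at_top[of N]
        proof eventually_elim
          case (elim L)
          then have "- g x \<le> real L" using N by linarith
          then show ?case by simp
        qed
      qed
      then show "AE x in law. (\<lambda>L. max (g x) (- real L)) \<longlonglongrightarrow> g x" by simp
      have "norm (max (g x) (- real L)) \<le> \<bar>g x\<bar>" for L x by (simp add: max_def)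
      then show "AE x in law. norm (max (g x) (- real L)) \<le> \<bar>g x\<bar>" for L by simp
    qed (use g in simp_all)
    then show "(\<lambda>L. ennreal (exp ((\<integral>x. max (g x) (- real L) \<partial>law) - ?d))) \<longlonglongrightarrow> ennreal (exp ((\<integral>x. g x \<partial>law) - ?d))"
      by (intro tendsto_intros)
  qed (intro exI[of _ 0] allI impI le)
qed

text \<open>A moment measure is not carried by a hyperplane. If \<open>a \<bullet> \<nabla>V = b\<close> almost everywhere, the gradient
  inequality in the directions \<open>a\<close> and \<open>- a\<close> makes \<open>V\<close> affine along \<open>a\<close>, which contradicts coercivity.\<close>

lemma interior_nonempty_if_AE_gradient:
  assumes C: "convex C" and AE: "AE x in lborel. gradient V x \<in> C"
  shows "interior C \<noteq> {}"
proof
  assume "interior C = {}"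
  then obtain a b where a: "a \<noteq> 0" "C \<subseteq> {x. a \<bullet> x = b}"
    by (rule empty_interior_subset_hyperplane[OF C])
  have AE': "AE x in lborel. V differentiable (at x) \<and> a \<bullet> gradient V x = b"
    using AE AE_differentiable by eventually_elim (use a in auto)
  have shift: "V x + t * b \<le> V (x + t *\<^sub>R a)" for x t
  proof -
    have "closed {x. V x + t * b \<le> V (x + t *\<^sub>R a)}"
      by (intro closed_Collect_le continuous_intros continuous_on_compose2[OF continuous]) auto
    moreover have "AE x in lborel. x \<in> {x. V x + t * b \<le> V (x + t *\<^sub>R a)}"
      using AE'
    proof eventually_elim
      case (elim x)
      then show ?case
        using gradient_ineq[of x "x + t *\<^sub>R a"] by (simp add: inner_commute)
    qed
    ultimately have "{x. V x + t * b \<le> V (x + t *\<^sub>R a)} = UNIV" by (rule closed_AE_lborel_UNIV)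
    then show ?thesis by blast
  qed
  obtain \<alpha> \<beta> where \<alpha>: "0 < \<alpha>" "\<And>x. \<alpha> * norm x - \<beta> \<le> V x" using coercive by blast
  have V0: "V (t *\<^sub>R a) + V (- (t *\<^sub>R a)) \<le> 2 * V 0" for t
    using shift[of "t *\<^sub>R a" "- t"] shift[of "- (t *\<^sub>R a)" t] by simp
  have "\<alpha> * (2 * (\<bar>t\<bar> * norm a)) \<le> 2 * V 0 + 2 * \<beta>" for t
    using V0[of t] \<alpha>(2)[of "t *\<^sub>R a"] \<alpha>(2)[of "- (t *\<^sub>R a)"] by simp
  from this[of "(\<bar>V 0\<bar> + \<bar>\<beta>\<bar> + 1) / (\<alpha> * norm a)"]
  have "2 * (\<bar>V 0\<bar> + \<bar>\<beta>\<bar> + 1) \<le> 2 * V 0 + 2 * \<beta>" using a(1) \<alpha>(1) by (simp add: abs_mult)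
  then show False using abs_ge_self[of "V 0"] abs_ge_self[of \<beta>] by argo
qed

end

section \<open>Convex conjugates and integrals against moment measures\<close>

lemma lsc_measurable:
  fixes f :: "'a::topological_space \<Rightarrow> ereal"
  assumes "lsc f"
  shows "f \<in> borel_measurable borel"
proof (rule borel_measurableI_greater)
  fix c
  have "open {x. c < f x}"
  proof (subst open_subopen, intro ballI)
    fix x assume "x \<in> {x. c < f x}"
    then have x: "c < f x" by simp
    then have "\<forall>\<^sub>F y in at x. c < f y"
      using assms by (auto simp: lsc_def le_Liminf_iff)
    then obtain S where "open S" "x \<in> S" "\<And>y. y \<in> S \<Longrightarrow> y \<noteq> x \<Longrightarrow> c < f y"
      unfolding eventually_at_topological by blast
    then show "\<exists>T. open T \<and> x \<in> T \<and> T \<subseteq> {x. c < f x}" using x by (intro exI[of _ S]) auto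
  qed
  then show "{x \<in> space borel. c < f x} \<in> sets borel" by simp
qed

lemma exp_neg_measurable:
  assumes [measurable]: "f \<in> borel_measurable M"
  shows "(\<lambda>x. exp_neg (f x)) \<in> borel_measurable M"
  unfolding exp_neg_def by measurable

lemma legendre_ge: "ereal (x \<bullet> y) - f x \<le> legendre f y"
  unfolding legendre_def by (rule SUP_upper) simp

lemma legendre_leI: "(\<And>x. f x \<noteq> \<infinity> \<Longrightarrow> ereal (x \<bullet> y) - f x \<le> c) \<Longrightarrow> legendre f y \<le> c"
  unfolding legendre_def
proof (rule SUP_least)
  fix x
  assume *: "\<And>x. f x \<noteq> \<infinity> \<Longrightarrow> ereal (x \<bullet> y) - f x \<le> c"
  show "ereal (x \<bullet> y) - f x \<le> c" using *[of x] by (cases "f x = \<infinity>") auto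
qed

lemma legendre_not_MInf:
  assumes "f x \<noteq> \<infinity>"
  shows "legendre f y \<noteq> - \<infinity>"
proof
  assume "legendre f y = - \<infinity>"
  then have "ereal (x \<bullet> y) - f x = - \<infinity>" using legendre_ge[of x y f] by simp
  then show False using assms by (cases "f x") auto
qed

lemma fenchel_young:
  assumes "f x \<noteq> \<infinity>" "f x \<noteq> - \<infinity>" "legendre f y \<noteq> \<infinity>"
  shows "x \<bullet> y \<le> real_of_ereal (f x) + real_of_ereal (legendre f y)"
proof -
  obtain r where r: "f x = ereal r" using assms by (cases "f x") auto
  obtain l where l: "legendre f y = ereal l" using assms legendre_not_MInf[of f x y] by (cases "legendre f y") auto
  show ?thesis using legendre_ge[of x y f] by (simp add: r l)
qed

lemma legendre_lsc:
  fixes f :: "real ^ 'n \<Rightarrow> ereal"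
  assumes "\<And>x. f x \<noteq> - \<infinity>"
  shows "lsc (legendre f)"
  unfolding lsc_def
proof
  fix y :: "real ^ 'n"
  show "legendre f y \<le> Liminf (at y) (legendre f)"
    unfolding le_Liminf_iff
  proof (intro allI impI)
    fix c assume "c < legendre f y"
    then obtain x where x: "c < ereal (x \<bullet> y) - f x" unfolding legendre_def less_SUP_iff by blast
    then have "f x \<noteq> \<infinity>" by auto
    then obtain r where r: "f x = ereal r" using assms[of x] by (cases "f x") auto
    have "((\<lambda>z. ereal (x \<bullet> z - r)) \<longlongrightarrow> ereal (x \<bullet> y - r)) (at y)" by (intro tendsto_intros)
    moreover have "c < ereal (x \<bullet> y - r)" using x r by simp
    ultimately have "\<forall>\<^sub>F z in at y. c < ereal (x \<bullet> z - r)" by (rule order_tendstoD)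
    then show "\<forall>\<^sub>F z in at y. c < legendre f z"
    proof eventually_elim
      case (elim z)
      then show ?case using legendre_ge[of x z f] r by simp
    qed
  qed
qed

lemma legendre_convex:
  fixes f :: "real ^ 'n \<Rightarrow> ereal"
  assumes "\<And>x. f x \<noteq> - \<infinity>"
  shows "ereal_convex (legendre f)"
  unfolding ereal_convex_def
proof (intro allI ballI)
  fix x y :: "real ^ 'n" and t :: real assume t: "t \<in> {0..1}"
  show "legendre f ((1 - t) *\<^sub>R x + t *\<^sub>R y) \<le> ereal (1 - t) * legendre f x + ereal t * legendre f y"
  proof (rule legendre_leI)
    fix p assume "f p \<noteq> \<infinity>"
    then obtain r where r: "f p = ereal r" using assms[of p] by (cases "f p") auto
    have "ereal (p \<bullet> ((1 - t) *\<^sub>R x + t *\<^sub>R y)) - f p = ereal (1 - t) * (ereal (p \<bullet> x) - f p) + ereal t * (ereal (p \<bullet> y) - f p)"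
      by (simp add: r inner_add_right algebra_simps)
    also have "\<dots> \<le> ereal (1 - t) * legendre f x + ereal t * legendre f y"
      using t by (intro add_mono ereal_mult_left_mono legendre_ge) auto
    finally show "ereal (p \<bullet> ((1 - t) *\<^sub>R x + t *\<^sub>R y)) - f p \<le> ereal (1 - t) * legendre f x + ereal t * legendre f y" .
  qed
qed

lemma convex_lsc_fnsD:
  assumes "f \<in> convex_lsc_fns"
  shows "f x \<noteq> - \<infinity>" "\<exists>x. f x \<noteq> \<infinity>" "ereal_convex f" "f \<in> borel_measurable borel"
  using assms lsc_measurable by (auto simp: convex_lsc_fns_def)

text \<open>A conjugate is a supremum of affine functions, so only properness has to be checked. This is why
  functions for the inverse Santalo inequality are produced below as conjugates.\<close>

lemma legendre_in_convex_lsc_fns: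
  assumes "\<And>x. f x \<noteq> - \<infinity>" "f x \<noteq> \<infinity>" "legendre f y \<noteq> \<infinity>"
  shows "legendre f \<in> convex_lsc_fns"
  using assms legendre_lsc[of f] legendre_convex[of f] legendre_not_MInf[of f x]
  by (auto simp: convex_lsc_fns_def)

lemma convex_domain:
  assumes "ereal_convex f"
  shows "convex {x. f x \<noteq> \<infinity>}"
proof (rule convexI)
  fix x y and u v :: real assume xy: "x \<in> {x. f x \<noteq> \<infinity>}" "y \<in> {x. f x \<noteq> \<infinity>}" and uv: "0 \<le> u" "0 \<le> v" "u + v = 1"
  have "f ((1 - v) *\<^sub>R x + v *\<^sub>R y) \<le> ereal (1 - v) * f x + ereal v * f y"
    using assms uv by (auto simp: ereal_convex_def)
  moreover have "ereal (1 - v) * f x \<noteq> \<infinity>" "ereal v * f y \<noteq> \<infinity>"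
    using xy uv by (cases "f x"; cases "f y"; auto)+
  moreover have "u = 1 - v" using uv by simp
  ultimately show "u *\<^sub>R x + v *\<^sub>R y \<in> {x. f x \<noteq> \<infinity>}" by auto
qed

context full_log_concave
begin

lemma nn_integral_moment_measure:
  assumes [measurable]: "F \<in> borel_measurable borel"
  shows "(\<integral>\<^sup>+y. F y \<partial>moment_measure V) = (\<integral>\<^sup>+x. F (gradient V x) \<partial>law)"
  unfolding moment_measure_def law_def[symmetric] by (rule nn_integral_distr) auto

lemma ereal_integral_moment_measure_finite:
  assumes [measurable]: "f \<in> borel_measurable borel" and f: "\<And>x. f x \<noteq> - \<infinity>"
    and fin: "ereal_integral (moment_measure V) f \<noteq> \<infinity>"
  shows "AE x in lborel. f (gradient V x) \<noteq> \<infinity>"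
    and "integrable law (\<lambda>x. max (real_of_ereal (f (gradient V x))) 0)"
proof -
  have m: "(\<lambda>y. e2ennreal (f y)) \<in> borel_measurable borel" "(\<lambda>x. e2ennreal (f (gradient V x))) \<in> borel_measurable law"
    by measurable
  have "(\<integral>\<^sup>+y. e2ennreal (f y) \<partial>moment_measure V) \<noteq> \<infinity>"
    using fin unfolding ereal_integral_def by auto
  then have A: "(\<integral>\<^sup>+x. e2ennreal (f (gradient V x)) \<partial>law) \<noteq> \<infinity>"
    by (simp add: nn_integral_moment_measure)
  have "AE x in law. e2ennreal (f (gradient V x)) \<noteq> \<infinity>"
    by (rule nn_integral_PInf_AE[OF m(2) A])
  then have AE: "AE x in law. f (gradient V x) \<noteq> \<infinity>" by eventually_elim auto
  then show "AE x in lborel. f (gradient V x) \<noteq> \<infinity>" by (simp add: AE_law_iff)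
  have "(\<integral>\<^sup>+x. ennreal (max (real_of_ereal (f (gradient V x))) 0) \<partial>law) = (\<integral>\<^sup>+x. e2ennreal (f (gradient V x)) \<partial>law)"
  proof (rule nn_integral_cong_AE)
    show "AE x in law. ennreal (max (real_of_ereal (f (gradient V x))) 0) = e2ennreal (f (gradient V x))"
      using AE
    proof eventually_elim
      case (elim x)
      then obtain r where "f (gradient V x) = ereal r" using f[of "gradient V x"] by (cases "f (gradient V x)") auto
      then show ?case by (simp add: max_def ennreal_neg)
    qed
  qed
  then show "integrable law (\<lambda>x. max (real_of_ereal (f (gradient V x))) 0)"
    using A by (intro integrableI_nonneg) (auto simp: less_top)
qed

lemma ereal_integral_moment_measure_eq:
  assumes [measurable]: "f \<in> borel_measurable borel" and f: "\<And>x. f x \<noteq> - \<infinity>"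
    and AE: "AE x in lborel. f (gradient V x) \<noteq> \<infinity>"
    and int: "integrable law (\<lambda>x. real_of_ereal (f (gradient V x)))"
  shows "ereal_integral (moment_measure V) f = ereal (\<integral>x. real_of_ereal (f (gradient V x)) \<partial>law)"
proof -
  let ?g = "\<lambda>x. real_of_ereal (f (gradient V x))"
  have eq: "AE x in law. f (gradient V x) = ereal (?g x)"
    using AE unfolding AE_law_iff
  proof eventually_elim
    case (elim x) then show ?case using f[of "gradient V x"] by (cases "f (gradient V x)") auto
  qed
  have gen: "e2ennreal (ereal r) = ennreal (max r 0)" for r by (simp add: max_def ennreal_neg)
  have pos: "(\<integral>\<^sup>+y. e2ennreal (f y) \<partial>moment_measure V) = ennreal (\<integral>x. max (?g x) 0 \<partial>law)"
  proof -
    have "(\<integral>\<^sup>+y. e2ennreal (f y) \<partial>moment_measure V) = (\<integral>\<^sup>+x. ennreal (max (?g x) 0) \<partial>law)"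
    proof (subst nn_integral_moment_measure)
      show "(\<integral>\<^sup>+x. e2ennreal (f (gradient V x)) \<partial>law) = (\<integral>\<^sup>+x. ennreal (max (?g x) 0) \<partial>law)"
      proof (rule nn_integral_cong_AE)
        show "AE x in law. e2ennreal (f (gradient V x)) = ennreal (max (?g x) 0)"
          using eq
        proof eventually_elim
          case (elim x)
          have "e2ennreal (ereal (?g x)) = ennreal (max (?g x) 0)" by (rule gen)
          then show ?case by (simp only: elim[symmetric])
        qed
      qed
    qed simp
    also have "\<dots> = ennreal (\<integral>x. max (?g x) 0 \<partial>law)" using int by (intro nn_integral_eq_integral) auto
    finally show ?thesis .
  qed
  have neg: "(\<integral>\<^sup>+y. e2ennreal (- f y) \<partial>moment_measure V) = ennreal (\<integral>x. max (- ?g x) 0 \<partial>law)"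
  proof -
    have "(\<integral>\<^sup>+y. e2ennreal (- f y) \<partial>moment_measure V) = (\<integral>\<^sup>+x. ennreal (max (- ?g x) 0) \<partial>law)"
    proof (subst nn_integral_moment_measure)
      show "(\<integral>\<^sup>+x. e2ennreal (- f (gradient V x)) \<partial>law) = (\<integral>\<^sup>+x. ennreal (max (- ?g x) 0) \<partial>law)"
      proof (rule nn_integral_cong_AE)
        show "AE x in law. e2ennreal (- f (gradient V x)) = ennreal (max (- ?g x) 0)"
          using eq
        proof eventually_elim
          case (elim x)
          have "e2ennreal (- ereal (?g x)) = ennreal (max (- ?g x) 0)" by (simp only: uminus_ereal.simps gen)
          then show ?case by (simp only: elim[symmetric])
        qed
      qed
    qed simp
    also have "\<dots> = ennreal (\<integral>x. max (- ?g x) 0 \<partial>law)" using int by (intro nn_integral_eq_integral) auto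
    finally show ?thesis .
  qed
  have "(\<integral>x. max (?g x) 0 \<partial>law) - (\<integral>x. max (- ?g x) 0 \<partial>law) = (\<integral>x. max (?g x) 0 - max (- ?g x) 0 \<partial>law)"
    using int by (intro Bochner_Integration.integral_diff[symmetric]) auto
  also have "(\<lambda>x. max (?g x) 0 - max (- ?g x) 0) = ?g"
  proof
    have "max r 0 - max (- r) 0 = r" for r :: real by auto
    then show "max (?g x) 0 - max (- ?g x) 0 = ?g x" for x .
  qed
  finally show ?thesis
    unfolding ereal_integral_def pos neg
    by (subst (1 2) enn2ereal_ennreal) (auto intro!: integral_nonneg_AE)
qed

text \<open>Provides the positivity hypotheses of the inverse Santalo inequality: the domain of \<open>h\<close> is convex and
  carries the moment measure, so it has interior.\<close>

lemma exp_neg_integral_pos: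
  assumes [measurable]: "h \<in> borel_measurable borel" and "ereal_convex h"
    and AE: "AE x in lborel. h (gradient V x) \<noteq> \<infinity>"
  shows "0 < (\<integral>\<^sup>+y. exp_neg (h y) \<partial>lborel)"
proof (rule ccontr)
  note [measurable] = exp_neg_measurable
  assume "\<not> 0 < (\<integral>\<^sup>+y. exp_neg (h y) \<partial>lborel)"
  then have "(\<integral>\<^sup>+y. exp_neg (h y) \<partial>lborel) = 0" by simp
  then have "AE y in lborel. exp_neg (h y) = 0" by (subst (asm) nn_integral_0_iff_AE) auto
  then have "AE y in lborel. y \<in> - interior {x. h x \<noteq> \<infinity>}"
  proof eventually_elim
    case (elim y)
    then have "h y = \<infinity>" by (auto simp: exp_neg_def split: if_splits)
    then show ?case using interior_subset[of "{x. h x \<noteq> \<infinity>}"] by blast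
  qed
  then have "- interior {x. h x \<noteq> \<infinity>} = UNIV" by (intro closed_AE_lborel_UNIV) auto
  moreover have "interior {x. h x \<noteq> \<infinity>} \<noteq> {}"
    using convex_domain[OF assms(2)] AE by (intro interior_nonempty_if_AE_gradient) auto
  ultimately show False by blast
qed

text \<open>The variational inequality for extended-valued \<open>\<phi>\<close>, with the Fenchel inequality as hypothesis. That
  \<open>\<phi>\<close> may be any function satisfying it allows \<open>f\<close> and its conjugate to exchange roles.\<close>

lemma exp_neg_integral_le:
  fixes g :: "real ^ 'n \<Rightarrow> real" and \<phi> :: "real ^ 'n \<Rightarrow> ereal"
  assumes [measurable]: "g \<in> borel_measurable borel" "\<phi> \<in> borel_measurable borel"
    and gint: "integrable law (\<lambda>x. max (g x) 0)"
    and \<phi>: "\<And>y. \<phi> y \<noteq> - \<infinity>" "0 < (\<integral>\<^sup>+y. exp_neg (\<phi> y) \<partial>lborel)"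
    and AE: "AE x in lborel. \<forall>y. \<phi> y \<noteq> \<infinity> \<longrightarrow> gradient V x \<bullet> y \<le> g x + real_of_ereal (\<phi> y)"
  shows "integrable law g"
    and "(\<integral>\<^sup>+y. exp_neg (\<phi> y) \<partial>lborel) \<le> ennreal (exp ((\<integral>x. g x \<partial>law) - (real CARD('n) - (\<integral>x. V x \<partial>law))))"
proof -
  define v where "v y = (if \<phi> y = \<infinity> then 0 else exp (- real_of_ereal (\<phi> y)))" for y
  have v: "exp_neg (\<phi> y) = ennreal (v y)" for y using \<phi>(1)[of y] by (simp add: exp_neg_def v_def)
  have [measurable]: "v \<in> borel_measurable borel" unfolding v_def by measurable
  have v0: "0 \<le> v y" for y by (simp add: v_def)
  have "AE x in lborel. \<forall>y. v y \<le> exp (g x - gradient V x \<bullet> y)"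
    using AE
  proof eventually_elim
    case (elim x)
    show ?case
    proof
      fix y
      show "v y \<le> exp (g x - gradient V x \<bullet> y)"
        using elim[rule_format, of y] by (cases "\<phi> y = \<infinity>") (auto simp: v_def)
    qed
  qed
  note * = moment_measure_inequality[OF _ _ gint v0 _ this]
  show "integrable law g" by (rule *(1)) (use \<phi>(2) v in auto)
  show "(\<integral>\<^sup>+y. exp_neg (\<phi> y) \<partial>lborel) \<le> ennreal (exp ((\<integral>x. g x \<partial>law) - (real CARD('n) - (\<integral>x. V x \<partial>law))))"
    unfolding v by (rule *(2)) (use \<phi>(2) v in auto)
qed

end

section \<open>Symmetries given by sign changes\<close>

lemma sign_vectors_mult_self: "\<epsilon> \<in> sign_vectors \<Longrightarrow> \<epsilon> $ i * \<epsilon> $ i = 1"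
  unfolding sign_vectors_def by (metis (mono_tags, lifting) insertE mem_Collect_eq mult_minus_left mult_minus_right mult_1 minus_minus singletonD)

lemma sign_change_sign_change:
  "\<epsilon> \<in> sign_vectors \<Longrightarrow> sign_change \<epsilon> (sign_change \<epsilon> x) = x"
  by (simp add: sign_change_def vec_eq_iff sign_vectors_mult_self flip: mult.assoc)

lemma sign_change_inner: "sign_change \<epsilon> x \<bullet> y = x \<bullet> sign_change \<epsilon> y"
  by (simp add: sign_change_def inner_vec_def mult_ac)

lemma sign_change_inner_sign_change:
  "\<epsilon> \<in> sign_vectors \<Longrightarrow> sign_change \<epsilon> x \<bullet> sign_change \<epsilon> y = x \<bullet> y"
  by (simp add: sign_change_inner sign_change_sign_change)

lemma sign_change_compose: "sign_change \<delta> (sign_change \<epsilon> x) = sign_change (sign_change \<delta> \<epsilon>) x"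
  by (simp add: sign_change_def vec_eq_iff mult.assoc)

lemma bounded_linear_sign_change: "bounded_linear (sign_change \<epsilon>)"
  by (intro linear_conv_bounded_linear[THEN iffD1] linearI)
    (simp_all add: sign_change_def vec_eq_iff algebra_simps)

lemma sign_change_measurable[measurable]: "sign_change \<epsilon> \<in> borel_measurable borel"
  by (intro borel_measurable_continuous_onI linear_continuous_on bounded_linear_sign_change)

text \<open>A sign change is a diagonal map with determinant of absolute value 1.\<close>

lemma distr_lborel_sign_change:
  fixes \<epsilon> :: "real ^ 'n"
  assumes \<epsilon>: "\<epsilon> \<in> sign_vectors"
  shows "distr lborel borel (sign_change \<epsilon>) = lborel"
proof -
  have abs: "\<bar>\<epsilon> \<bullet> j\<bar> = 1" if j: "j \<in> Basis" for j
  proof -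
    obtain i where "j = axis i 1" using j by (auto simp: Basis_vec_def)
    then have "\<epsilon> \<bullet> j = \<epsilon> $ i" by (simp add: inner_axis)
    moreover have "\<epsilon> $ i = - 1 \<or> \<epsilon> $ i = 1" using \<epsilon> by (simp add: sign_vectors_def)
    ultimately show ?thesis by auto
  qed
  have "(\<lambda>x. 0 + (\<Sum>j\<in>Basis. ((\<epsilon> \<bullet> j) * (x \<bullet> j)) *\<^sub>R j)) = sign_change \<epsilon>"
  proof
    fix x :: "real ^ 'n"
    have "(\<epsilon> \<bullet> j) * (x \<bullet> j) = sign_change \<epsilon> x \<bullet> j" if j: "j \<in> Basis" for j
    proof -
      obtain i where "j = axis i 1" using j by (auto simp: Basis_vec_def)
      then show ?thesis by (simp add: inner_axis sign_change_def)
    qed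
    then have "(\<Sum>j\<in>Basis. ((\<epsilon> \<bullet> j) * (x \<bullet> j)) *\<^sub>R j) = (\<Sum>j\<in>Basis. (sign_change \<epsilon> x \<bullet> j) *\<^sub>R j)"
      by simp
    then show "0 + (\<Sum>j\<in>Basis. ((\<epsilon> \<bullet> j) * (x \<bullet> j)) *\<^sub>R j) = sign_change \<epsilon> x"
      by (simp add: euclidean_representation)
  qed
  then have "lborel = density (distr lborel borel (sign_change \<epsilon>)) (\<lambda>_. ennreal (\<Prod>j\<in>Basis. \<bar>\<epsilon> \<bullet> j\<bar>))"
    using lborel_affine_euclidean[of "\<lambda>j. \<epsilon> \<bullet> j" 0] abs by fastforce
  also have "(\<Prod>j\<in>Basis. \<bar>\<epsilon> \<bullet> j\<bar>) = 1" using abs by simp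
  finally show ?thesis by (simp add: density_1)
qed

lemma finite_sign_vectors: "finite (sign_vectors :: (real ^ 'n) set)"
proof (rule finite_subset)
  show "sign_vectors \<subseteq> vec_lambda ` ((UNIV :: 'n set) \<rightarrow>\<^sub>E {-1, 1::real})"
  proof
    fix x :: "real ^ 'n" assume "x \<in> sign_vectors"
    then have "vec_nth x \<in> (UNIV :: 'n set) \<rightarrow>\<^sub>E {-1, 1}" by (auto simp: sign_vectors_def)
    then show "x \<in> vec_lambda ` ((UNIV :: 'n set) \<rightarrow>\<^sub>E {-1, 1::real})" by (intro image_eqI[of _ _ "vec_nth x"]) auto
  qed
  show "finite (vec_lambda ` ((UNIV :: 'n set) \<rightarrow>\<^sub>E {-1, 1::real}))" by (intro finite_imageI finite_PiE) auto
qed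

text \<open>Closure under composition is expressed through \<open>sign_change\<close> itself, since the componentwise product
  of two sign vectors is one applied to the other. Inverses come for free, every sign change being an involution.\<close>

definition sign_group :: "(real ^ 'n) set \<Rightarrow> bool" where
  "sign_group \<Gamma> \<longleftrightarrow> \<Gamma> \<noteq> {} \<and> \<Gamma> \<subseteq> sign_vectors \<and> (\<forall>\<delta>\<in>\<Gamma>. \<forall>\<epsilon>\<in>\<Gamma>. sign_change \<delta> \<epsilon> \<in> \<Gamma>)"

lemma sign_group_finite: "sign_group \<Gamma> \<Longrightarrow> finite \<Gamma>"
  unfolding sign_group_def using finite_sign_vectors finite_subset by blast

lemma sign_group_sum:
  assumes \<Gamma>: "sign_group \<Gamma>" and \<delta>: "\<delta> \<in> \<Gamma>"
  shows "(\<Sum>\<epsilon>\<in>\<Gamma>. h (sign_change \<epsilon> (sign_change \<delta> x))) = (\<Sum>\<epsilon>\<in>\<Gamma>. h (sign_change \<epsilon> x))"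
proof -
  have comm: "sign_change \<epsilon> \<delta> = sign_change \<delta> \<epsilon>" for \<epsilon> by (simp add: sign_change_def mult.commute)
  have inv: "sign_change \<delta> (sign_change \<delta> \<epsilon>) = \<epsilon>" for \<epsilon>
    using \<Gamma> \<delta> by (intro sign_change_sign_change) (auto simp: sign_group_def)
  have mem: "sign_change \<delta> \<epsilon> \<in> \<Gamma>" if "\<epsilon> \<in> \<Gamma>" for \<epsilon>
    using that \<Gamma> \<delta> by (auto simp: sign_group_def)
  have eq: "h (sign_change (sign_change \<delta> \<epsilon>) x) = h (sign_change \<epsilon> (sign_change \<delta> x))" for \<epsilon>
    by (simp add: sign_change_compose comm)
  show ?thesis
    by (rule sum.reindex_bij_witness[of _ "sign_change \<delta>" "sign_change \<delta>"]) (use inv mem eq in auto)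
qed

lemma sign_change_neg_one: "sign_change (\<chi> i. -1) x = - x"
  by (simp add: sign_change_def vec_eq_iff)

lemma sign_change_one: "sign_change (\<chi> i. 1) x = x"
  by (simp add: sign_change_def vec_eq_iff)

context full_log_concave
begin

text \<open>Invariance of the law gives equality of densities almost everywhere, and continuity of \<open>V\<close> makes it
  hold everywhere.\<close>

lemma potential_invariant:
  assumes \<epsilon>: "\<epsilon> \<in> sign_vectors" and inv: "distr law borel (sign_change \<epsilon>) = law"
  shows "V (sign_change \<epsilon> x) = V x"
proof -
  let ?S = "sign_change \<epsilon>"
  let ?f = "\<lambda>x. ennreal (exp (- V x))"
  have "law = distr (density lborel (\<lambda>x. ?f (?S (?S x)))) borel ?S"
    using \<epsilon> by (simp add: sign_change_sign_change inv flip: law_def)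
  also have "\<dots> = density (distr lborel borel ?S) (\<lambda>x. ?f (?S x))"
    by (rule density_distr[symmetric]) auto
  also have "\<dots> = density lborel (\<lambda>x. ?f (?S x))" by (simp add: distr_lborel_sign_change[OF \<epsilon>])
  finally have "density lborel ?f = density lborel (\<lambda>x. ?f (?S x))" by (simp add: law_def)
  then have "AE x in lborel. ?f x = ?f (?S x)"
    by (intro sigma_finite_measure.density_unique[OF sigma_finite_lborel]) auto
  then have "AE x in lborel. x \<in> {x. V (?S x) = V x}" by eventually_elim simp
  moreover have "closed {x. V (?S x) = V x}"
    by (intro closed_Collect_eq continuous continuous_on_compose2[OF continuous]
        linear_continuous_on bounded_linear_sign_change) auto
  ultimately have "{x. V (?S x) = V x} = UNIV" by (intro closed_AE_lborel_UNIV)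
  then show ?thesis by blast
qed

lemma distr_law_sign_change:
  assumes \<epsilon>: "\<epsilon> \<in> sign_vectors" and inv: "\<And>x. V (sign_change \<epsilon> x) = V x"
  shows "distr law borel (sign_change \<epsilon>) = law"
proof -
  have "distr law borel (sign_change \<epsilon>)
     = distr (density lborel (\<lambda>x. ennreal (exp (- V (sign_change \<epsilon> x))))) borel (sign_change \<epsilon>)"
    by (simp add: law_def inv)
  also have "\<dots> = density (distr lborel borel (sign_change \<epsilon>)) (\<lambda>x. ennreal (exp (- V x)))"
    by (rule density_distr[symmetric]) auto
  also have "\<dots> = law" by (simp add: distr_lborel_sign_change[OF \<epsilon>] law_def)
  finally show ?thesis .
qed

text \<open>The gradient of an invariant function is equivariant, so the moment measure inherits the symmetries
  of the law.\<close>

lemma gradient_sign_change: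
  assumes \<epsilon>: "\<epsilon> \<in> sign_vectors" and inv: "\<And>x. V (sign_change \<epsilon> x) = V x"
    and d: "V differentiable (at x)"
  shows "gradient V (sign_change \<epsilon> x) = sign_change \<epsilon> (gradient V x)"
proof (rule gradient_eqI)
  let ?S = "sign_change \<epsilon>"
  have 1: "(?S has_derivative ?S) (at (?S x))"
    by (rule bounded_linear_imp_has_derivative[OF bounded_linear_sign_change])
  have 2: "(V has_derivative (\<lambda>h. h \<bullet> gradient V x)) (at (?S (?S x)))"
    using GDERIV_gradient[OF d] by (simp add: gderiv_def sign_change_sign_change[OF \<epsilon>])
  have "((\<lambda>z. V (?S z)) has_derivative (\<lambda>h. ?S h \<bullet> gradient V x)) (at (?S x))"
    by (rule has_derivative_compose[OF 1 2])
  then show "GDERIV V (?S x) :> ?S (gradient V x)"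
    by (simp add: gderiv_def inv sign_change_inner)
qed

lemma AE_lborel_sign_change:
  assumes \<epsilon>: "\<epsilon> \<in> sign_vectors" and [measurable]: "Measurable.pred borel P" and AE: "AE x in lborel. P x"
  shows "AE x in lborel. P (sign_change \<epsilon> x)"
proof -
  have "AE x in distr lborel borel (sign_change \<epsilon>). P x" using AE by (subst distr_lborel_sign_change[OF \<epsilon>])
  then show ?thesis by (subst (asm) AE_distr_iff) auto
qed

lemma AE_gradient_orbit:
  assumes \<Gamma>: "sign_group \<Gamma>" and inv: "\<And>\<epsilon> x. \<epsilon> \<in> \<Gamma> \<Longrightarrow> V (sign_change \<epsilon> x) = V x"
    and [measurable]: "f \<in> borel_measurable borel" and AE: "AE x in lborel. f (gradient V x) \<noteq> (\<infinity>::ereal)"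
  shows "AE x in lborel. \<forall>\<epsilon>\<in>\<Gamma>. gradient V (sign_change \<epsilon> x) = sign_change \<epsilon> (gradient V x)
    \<and> f (gradient V (sign_change \<epsilon> x)) \<noteq> \<infinity>"
proof (rule AE_finite_allI[OF sign_group_finite[OF \<Gamma>]])
  fix \<epsilon> assume "\<epsilon> \<in> \<Gamma>"
  then have \<epsilon>: "\<epsilon> \<in> sign_vectors" using \<Gamma> by (auto simp: sign_group_def)
  have "AE x in lborel. f (gradient V (sign_change \<epsilon> x)) \<noteq> \<infinity>"
    by (rule AE_lborel_sign_change[OF \<epsilon> _ AE]) measurable
  then show "AE x in lborel. gradient V (sign_change \<epsilon> x) = sign_change \<epsilon> (gradient V x)
    \<and> f (gradient V (sign_change \<epsilon> x)) \<noteq> \<infinity>"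
    using AE_differentiable by eventually_elim (use gradient_sign_change[OF \<epsilon> inv[OF \<open>\<epsilon> \<in> \<Gamma>\<close>]] in auto)
qed

lemma integral_orbit_average:
  assumes \<Gamma>: "sign_group \<Gamma>" and inv: "\<And>\<epsilon> x. \<epsilon> \<in> \<Gamma> \<Longrightarrow> V (sign_change \<epsilon> x) = V x"
    and g: "integrable law g"
  shows "integrable law (\<lambda>x. \<Sum>\<epsilon>\<in>\<Gamma>. g (sign_change \<epsilon> x))"
    and "(\<integral>x. (\<Sum>\<epsilon>\<in>\<Gamma>. g (sign_change \<epsilon> x)) \<partial>law) = real (card \<Gamma>) * (\<integral>x. g x \<partial>law)"
proof -
  have [measurable]: "g \<in> borel_measurable borel" using borel_measurable_integrable[OF g] by simp
  have one: "integrable law (\<lambda>x. g (sign_change \<epsilon> x))" "(\<integral>x. g (sign_change \<epsilon> x) \<partial>law) = (\<integral>x. g x \<partial>law)"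
    if "\<epsilon> \<in> \<Gamma>" for \<epsilon>
  proof -
    have d: "distr law borel (sign_change \<epsilon>) = law"
      using that \<Gamma> by (intro distr_law_sign_change inv) (auto simp: sign_group_def)
    have m: "sign_change \<epsilon> \<in> law \<rightarrow>\<^sub>M borel" by measurable
    show "integrable law (\<lambda>x. g (sign_change \<epsilon> x))" 
      using integrable_distr_eq[OF m, of g] g by (simp add: d)
    show "(\<integral>x. g (sign_change \<epsilon> x) \<partial>law) = (\<integral>x. g x \<partial>law)"
      using integral_distr[OF m, of g] by (simp add: d)
  qed
  show "integrable law (\<lambda>x. \<Sum>\<epsilon>\<in>\<Gamma>. g (sign_change \<epsilon> x))" using one by auto
  show "(\<integral>x. (\<Sum>\<epsilon>\<in>\<Gamma>. g (sign_change \<epsilon> x)) \<partial>law) = real (card \<Gamma>) * (\<integral>x. g x \<partial>law)"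
    using one by (subst Bochner_Integration.integral_sum) auto
qed

text \<open>The density is \<open>exp (- V)\<close>, so the relative entropy with respect to Lebesgue measure is \<open>- \<integral> V\<close>.\<close>

lemma entropy_power_eq:
  assumes X: "distributed M lborel X (\<lambda>x. ennreal (exp (- V x)))"
  shows "entropy_power M X = 1 / (2 * pi * exp 1) * exp (2 / real CARD('n) * (\<integral>x. V x \<partial>law))"
proof -
  have "KL_divergence (exp 1) lborel (distr M lborel X) = KL_divergence (exp 1) lborel (density lborel (\<lambda>x. exp (- V x)))"
    using distributed_distr_eq_density[OF X] by simp
  also have "\<dots> = (\<integral>x. exp (- V x) * log (exp 1) (exp (- V x)) \<partial>lborel)"
    by (rule lborel.KL_density) auto
  also have "\<dots> = (\<integral>x. - (exp (- V x) * V x) \<partial>lborel)" by (simp add: log_def)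
  also have "\<dots> = - (\<integral>x. V x \<partial>law)"
    unfolding law_def by (subst integral_real_density) auto
  finally show ?thesis by (simp add: entropy_power_def)
qed

lemma distr_borel_eq_law:
  assumes X: "distributed M lborel X (\<lambda>x. ennreal (exp (- V x)))"
  shows "distr M borel X = law"
  using distributed_distr_eq_density[OF X] unfolding law_def by (simp cong: distr_cong)

end

lemma full_log_concave_if_distributed:
  fixes V :: "real ^ 'n \<Rightarrow> real"
  assumes "prob_space M" "convex_on UNIV V" and X: "distributed M lborel X (\<lambda>x. ennreal (exp (- V x)))"
  shows "full_log_concave V"
proof
  interpret prob_space M by fact
  have "X \<in> M \<rightarrow>\<^sub>M lborel" using X by (rule distributed_measurable)
  then interpret X: prob_space "distr M lborel X" by (rule prob_space_distr)
  have "continuous_on UNIV V" using assms(2) by (intro convex_on_continuous) auto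
  then have [measurable]: "V \<in> borel_measurable borel" by (rule borel_measurable_continuous_onI)
  have "emeasure (distr M lborel X) UNIV = 1" using X.emeasure_space_1 by simp
  then show "(\<integral>\<^sup>+x. ennreal (exp (- V x)) \<partial>lborel) = 1"
    unfolding distributed_distr_eq_density[OF X] by (subst (asm) emeasure_density) auto
qed fact

section \<open>The entropy--transport inequality\<close>

text \<open>Lower bound for each competitor \<open>f\<close> in the transport cost. If an integral is infinite there is nothing
  to prove; otherwise \<open>f\<close> is finite almost everywhere for the first moment measure and its conjugate for the
  second. The inverse Santalo inequality is applied to the conjugate \<open>F\<close> of \<open>k\<close>, the average of the
  conjugate of \<open>f\<close> over the orbits of \<open>\<Gamma>\<close>, divided by \<open>\<tau>\<close>. \<open>F\<close> is invariant, and the variational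
  inequality bounds both \<open>\<integral> exp (- F)\<close> and \<open>\<integral> exp (- F\<^sup>*)\<close> by the integrals of \<open>f\<close> and its
  conjugate. The factor \<open>\<tau>\<close> exploits the homogeneity of the cost: without it only an additive bound
  on the cost would result, and the chosen value is the one that optimizes the multiplicative bound.\<close>

lemma transport_pair_ge:
  fixes V\<^sub>1 V\<^sub>2 :: "real ^ 'n \<Rightarrow> real" and f :: "real ^ 'n \<Rightarrow> ereal"
  assumes V1: "full_log_concave V\<^sub>1" and V2: "full_log_concave V\<^sub>2" and c: "0 < c"
    and \<Gamma>: "sign_group \<Gamma>"
    and inv1: "\<And>\<epsilon> x. \<epsilon> \<in> \<Gamma> \<Longrightarrow> V\<^sub>1 (sign_change \<epsilon> x) = V\<^sub>1 x"
    and inv2: "\<And>\<epsilon> x. \<epsilon> \<in> \<Gamma> \<Longrightarrow> V\<^sub>2 (sign_change \<epsilon> x) = V\<^sub>2 x"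
    and IS: "inverse_santalo (convex_lsc_fns \<inter> {f. \<forall>\<epsilon>\<in>\<Gamma>. \<forall>x. f (sign_change \<epsilon> x) = f x}) c"
    and f: "f \<in> convex_lsc_fns"
  defines "m \<equiv> (\<integral>x. V\<^sub>1 x \<partial>full_log_concave.law V\<^sub>1) + (\<integral>x. V\<^sub>2 x \<partial>full_log_concave.law V\<^sub>2)"
  shows "ereal (real CARD('n) * (c * exp (1 - m / real CARD('n))))
    \<le> ereal_integral (moment_measure V\<^sub>1) f + ereal_integral (moment_measure V\<^sub>2) (legendre f)"
proof (cases "ereal_integral (moment_measure V\<^sub>1) f = \<infinity> \<or> ereal_integral (moment_measure V\<^sub>2) (legendre f) = \<infinity>")
  case True
  then show ?thesis by auto
next
  case False
  interpret L1: full_log_concave V\<^sub>1 by fact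
  interpret L2: full_log_concave V\<^sub>2 by fact
  note [measurable] = exp_neg_measurable
  let ?n = "real CARD('n)"
  have f_fin: "f x \<noteq> - \<infinity>" for x using convex_lsc_fnsD(1)[OF f] .
  obtain x0 where x0: "f x0 \<noteq> \<infinity>" using convex_lsc_fnsD(2)[OF f] by blast
  have fs_fin: "legendre f y \<noteq> - \<infinity>" for y by (rule legendre_not_MInf[where f = f, OF x0])
  have [measurable]: "f \<in> borel_measurable borel" "legendre f \<in> borel_measurable borel"
    using convex_lsc_fnsD(4)[OF f] lsc_measurable[OF legendre_lsc[of f]] f_fin by auto
  define g1 where "g1 x = real_of_ereal (f (gradient V\<^sub>1 x))" for x
  define g2 where "g2 x = real_of_ereal (legendre f (gradient V\<^sub>2 x))" for x
  have [measurable]: "g1 \<in> borel_measurable borel" "g2 \<in> borel_measurable borel"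
    unfolding g1_def g2_def by measurable
  have fin1: "AE x in lborel. f (gradient V\<^sub>1 x) \<noteq> \<infinity>" "integrable L1.law (\<lambda>x. max (g1 x) 0)"
    unfolding g1_def using L1.ereal_integral_moment_measure_finite[where f = f, OF _ f_fin] False by auto
  have fin2: "AE x in lborel. legendre f (gradient V\<^sub>2 x) \<noteq> \<infinity>" "integrable L2.law (\<lambda>x. max (g2 x) 0)"
    unfolding g2_def using L2.ereal_integral_moment_measure_finite[where f = "legendre f", OF _ fs_fin] False by auto
  have pos: "0 < (\<integral>\<^sup>+y. exp_neg (f y) \<partial>lborel)" "0 < (\<integral>\<^sup>+y. exp_neg (legendre f y) \<partial>lborel)"
    using L1.exp_neg_integral_pos[where h = f, OF _ convex_lsc_fnsD(3)[OF f] fin1(1)]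
      L2.exp_neg_integral_pos[where h = "legendre f", OF _ legendre_convex[where f = f, OF f_fin] fin2(1)] by auto
  have int1: "integrable L1.law g1"
  proof (rule L1.exp_neg_integral_le(1)[where g = g1 and \<phi> = "legendre f", OF _ _ fin1(2) fs_fin pos(2)])
    show "AE x in lborel. \<forall>y. legendre f y \<noteq> \<infinity> \<longrightarrow> gradient V\<^sub>1 x \<bullet> y \<le> g1 x + real_of_ereal (legendre f y)"
      using fin1(1) by eventually_elim (simp add: g1_def fenchel_young f_fin)
  qed auto
  have int2: "integrable L2.law g2"
  proof (rule L2.exp_neg_integral_le(1)[where g = g2 and \<phi> = f, OF _ _ fin2(2) f_fin pos(1)])
    show "AE x in lborel. \<forall>y. f y \<noteq> \<infinity> \<longrightarrow> gradient V\<^sub>2 x \<bullet> y \<le> g2 x + real_of_ereal (f y)"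
      using fin2(1)
    proof eventually_elim
      case (elim x)
      show ?case
      proof (intro allI impI)
        fix y assume "f y \<noteq> \<infinity>"
        then show "gradient V\<^sub>2 x \<bullet> y \<le> g2 x + real_of_ereal (f y)"
          using fenchel_young[of f y "gradient V\<^sub>2 x"] f_fin elim by (simp add: g2_def inner_commute)
      qed
    qed
  qed auto
  define a where "a = (\<integral>x. g1 x \<partial>L1.law) + (\<integral>x. g2 x \<partial>L2.law)"
  have cost: "ereal_integral (moment_measure V\<^sub>1) f + ereal_integral (moment_measure V\<^sub>2) (legendre f) = ereal a"
    using L1.ereal_integral_moment_measure_eq[where f = f, OF _ f_fin fin1(1)] int1
      L2.ereal_integral_moment_measure_eq[where f = "legendre f", OF _ fs_fin fin2(1)] int2
    by (simp add: a_def flip: g1_def g2_def)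

  (* with this value n ln tau - 2 n + m = n ln c - n, so the final estimate reads n <= a / tau *)
  define \<tau> where "\<tau> = c * exp (1 - m / ?n)"
  have \<tau>: "0 < \<tau>" using c by (simp add: \<tau>_def)
  define N where "N = real (card \<Gamma>)"
  have finG: "finite \<Gamma>" by (rule sign_group_finite[OF \<Gamma>])
  have G_sign: "\<epsilon> \<in> sign_vectors" if "\<epsilon> \<in> \<Gamma>" for \<epsilon> using \<Gamma> that by (auto simp: sign_group_def)
  have N: "0 < N" using \<Gamma> finG by (auto simp: N_def sign_group_def card_gt_0_iff)
  define c0 where "c0 = 1 / (N * \<tau>)"
  have c0: "0 < c0" "c0 * N = 1 / \<tau>" using N \<tau> by (auto simp: c0_def)
  (* k is the orbit average of the conjugate of f divided by tau, with real values on dom *)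
  define dom where "dom = {y. \<forall>\<epsilon>\<in>\<Gamma>. legendre f (sign_change \<epsilon> y) \<noteq> \<infinity>}"
  define kr where "kr y = c0 * (\<Sum>\<epsilon>\<in>\<Gamma>. real_of_ereal (legendre f (sign_change \<epsilon> y)))" for y
  define k where "k y = (if y \<in> dom then ereal (kr y) else \<infinity>)" for y
  have k_MInf: "k y \<noteq> - \<infinity>" for y by (simp add: k_def)
  define F where "F = legendre k"
  have k_inv: "k (sign_change \<delta> y) = k y" if \<delta>: "\<delta> \<in> \<Gamma>" for \<delta> y
  proof -
    have "sign_change \<delta> y \<in> dom \<longleftrightarrow> y \<in> dom"
    proof -
      have "(\<Sum>\<epsilon>\<in>\<Gamma>. if legendre f (sign_change \<epsilon> (sign_change \<delta> y)) = \<infinity> then 1 else 0 :: nat) =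
        (\<Sum>\<epsilon>\<in>\<Gamma>. if legendre f (sign_change \<epsilon> y) = \<infinity> then 1 else 0)"
        by (rule sign_group_sum[OF \<Gamma> \<delta>])
      then have "(\<Sum>\<epsilon>\<in>\<Gamma>. if legendre f (sign_change \<epsilon> (sign_change \<delta> y)) = \<infinity> then 1 else 0 :: nat) = 0 \<longleftrightarrow>
        (\<Sum>\<epsilon>\<in>\<Gamma>. if legendre f (sign_change \<epsilon> y) = \<infinity> then 1 else 0 :: nat) = 0" by simp
      then show ?thesis unfolding sum_eq_0_iff[OF finG] by (auto simp: dom_def)
    qed
    moreover have "kr (sign_change \<delta> y) = kr y"
      unfolding kr_def by (subst sign_group_sum[OF \<Gamma> \<delta>]) simp
    ultimately show ?thesis by (simp add: k_def)
  qed
  have F_inv: "F (sign_change \<delta> y) = F y" if \<delta>: "\<delta> \<in> \<Gamma>" for \<delta> y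
  proof -
    have le: "F (sign_change \<delta> y) \<le> F y" for y
      unfolding F_def
    proof (rule legendre_leI)
      fix x
      have "ereal (x \<bullet> sign_change \<delta> y) - k x = ereal (sign_change \<delta> x \<bullet> y) - k (sign_change \<delta> x)"
        by (simp add: k_inv[OF \<delta>] sign_change_inner)
      also have "\<dots> \<le> legendre k y" by (rule legendre_ge)
      finally show "ereal (x \<bullet> sign_change \<delta> y) - k x \<le> legendre k y" .
    qed
    have "F y = F (sign_change \<delta> (sign_change \<delta> y))" using G_sign[OF \<delta>] by (simp add: sign_change_sign_change)
    also have "\<dots> \<le> F (sign_change \<delta> y)" by (rule le)
    finally show ?thesis using le[of y] by simp
  qed

  define h1 where "h1 x = c0 * (\<Sum>\<epsilon>\<in>\<Gamma>. g1 (sign_change \<epsilon> x))" for x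
  define h2 where "h2 x = c0 * (\<Sum>\<epsilon>\<in>\<Gamma>. g2 (sign_change \<epsilon> x))" for x
  have [measurable]: "h1 \<in> borel_measurable borel" "h2 \<in> borel_measurable borel"
    unfolding h1_def h2_def by measurable
  have h1: "integrable L1.law h1" "(\<integral>x. h1 x \<partial>L1.law) = (\<integral>x. g1 x \<partial>L1.law) / \<tau>"
    using L1.integral_orbit_average[OF \<Gamma> inv1 int1] c0(2)
    by (simp_all add: h1_def[abs_def] N_def[symmetric] mult.assoc[symmetric])
  have h2: "integrable L2.law h2" "(\<integral>x. h2 x \<partial>L2.law) = (\<integral>x. g2 x \<partial>L2.law) / \<tau>"
    using L2.integral_orbit_average[OF \<Gamma> inv2 int2] c0(2)
    by (simp_all add: h2_def[abs_def] N_def[symmetric] mult.assoc[symmetric])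

  (* by the Fenchel inequality, F at the gradient divided by tau is at most the orbit average of f, divided by tau *)
  have F_le: "AE x in lborel. F ((1/\<tau>) *\<^sub>R gradient V\<^sub>1 x) \<le> ereal (h1 x)"
    using L1.AE_gradient_orbit[where f = f, OF \<Gamma> inv1 _ fin1(1), simplified]
  proof eventually_elim
    case (elim x)
    define p where "p = gradient V\<^sub>1 x"
    have orb: "f (sign_change \<epsilon> p) \<noteq> \<infinity>" "g1 (sign_change \<epsilon> x) = real_of_ereal (f (sign_change \<epsilon> p))" if "\<epsilon> \<in> \<Gamma>" for \<epsilon>
      using elim that by (auto simp: p_def g1_def)
    show ?case
      unfolding F_def p_def[symmetric]
    proof (rule legendre_leI)
      fix y assume "k y \<noteq> \<infinity>"
      then have y: "y \<in> dom" by (auto simp: k_def split: if_splits)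
      have "(p \<bullet> y) / \<tau> = c0 * (\<Sum>\<epsilon>\<in>\<Gamma>. p \<bullet> y)" using c0(2) by (simp add: N_def[symmetric] mult.assoc[symmetric])
      also have "\<dots> \<le> c0 * (\<Sum>\<epsilon>\<in>\<Gamma>. g1 (sign_change \<epsilon> x) + real_of_ereal (legendre f (sign_change \<epsilon> y)))"
      proof (intro mult_left_mono sum_mono)
        fix \<epsilon> assume \<epsilon>: "\<epsilon> \<in> \<Gamma>"
        have "sign_change \<epsilon> p \<bullet> sign_change \<epsilon> y \<le> real_of_ereal (f (sign_change \<epsilon> p)) + real_of_ereal (legendre f (sign_change \<epsilon> y))"
          using orb(1)[OF \<epsilon>] y \<epsilon> by (intro fenchel_young f_fin) (auto simp: dom_def)
        then show "p \<bullet> y \<le> g1 (sign_change \<epsilon> x) + real_of_ereal (legendre f (sign_change \<epsilon> y))"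
          by (simp add: orb(2)[OF \<epsilon>] sign_change_inner_sign_change[OF G_sign[OF \<epsilon>]])
      qed (use c0 in simp)
      also have "\<dots> = h1 x + kr y" by (simp add: h1_def kr_def sum.distrib distrib_left)
      finally have "(y \<bullet> p) / \<tau> \<le> h1 x + kr y" by (simp add: inner_commute)
      then show "ereal (y \<bullet> (1/\<tau>) *\<^sub>R p) - k y \<le> ereal (h1 x)" using y by (simp add: k_def)
    qed
  qed
  have k_eq: "AE x in lborel. k (gradient V\<^sub>2 x) = ereal (h2 x)"
    using L2.AE_gradient_orbit[where f = "legendre f", OF \<Gamma> inv2 _ fin2(1), simplified]
  proof eventually_elim
    case (elim x)
    then have "gradient V\<^sub>2 x \<in> dom" by (auto simp: dom_def)
    moreover have "h2 x = kr (gradient V\<^sub>2 x)"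
      unfolding h2_def kr_def g2_def using elim by (intro arg_cong[where f = "\<lambda>z. c0 * z"] sum.cong) auto
    ultimately show ?case by (simp add: k_def)
  qed

  obtain p0 where p0: "F p0 \<noteq> \<infinity>"
  proof -
    have "AE x in L1.law. F ((1/\<tau>) *\<^sub>R gradient V\<^sub>1 x) \<le> ereal (h1 x)" using F_le by (simp add: L1.AE_law_iff)
    then obtain x where "F ((1/\<tau>) *\<^sub>R gradient V\<^sub>1 x) \<le> ereal (h1 x)"
      using eventually_happens'[OF L1.law.ae_filter_bot] by blast
    then have "F ((1/\<tau>) *\<^sub>R gradient V\<^sub>1 x) \<noteq> \<infinity>" by auto
    then show ?thesis by (rule that)
  qed
  obtain y0 where y0: "k y0 \<noteq> \<infinity>"
  proof -
    have "AE x in L2.law. k (gradient V\<^sub>2 x) = ereal (h2 x)" using k_eq by (simp add: L2.AE_law_iff)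
    then obtain x where "k (gradient V\<^sub>2 x) = ereal (h2 x)"
      using eventually_happens'[OF L2.law.ae_filter_bot] by blast
    then have "k (gradient V\<^sub>2 x) \<noteq> \<infinity>" by auto
    then show ?thesis by (rule that)
  qed
  have F: "F \<in> convex_lsc_fns" unfolding F_def by (rule legendre_in_convex_lsc_fns[where f = k, OF k_MInf y0 p0[unfolded F_def]])
  have F_MInf: "F x \<noteq> - \<infinity>" for x by (rule convex_lsc_fnsD(1)[OF F])
  have Fs_MInf: "legendre F y \<noteq> - \<infinity>" for y by (rule legendre_not_MInf[where f = F, OF p0])
  have [measurable]: "F \<in> borel_measurable borel" "legendre F \<in> borel_measurable borel"
    using convex_lsc_fnsD(4)[OF F] lsc_measurable[OF legendre_lsc[of F]] F_MInf by auto
  (* the easy half of biconjugation *)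
  have Fs_le: "legendre F p \<le> k p" for p
  proof (rule legendre_leI)
    fix y
    assume "F y \<noteq> \<infinity>"
    then obtain r where r: "F y = ereal r" using F_MInf[of y] by (cases "F y") auto
    have "ereal (p \<bullet> y) - k p \<le> F y" unfolding F_def by (rule legendre_ge)
    then show "ereal (y \<bullet> p) - F y \<le> k p" using k_MInf[of p] by (cases "k p") (auto simp: r inner_commute)
  qed

  (* rescaling the conjugate of F undoes the factor 1 / tau in the argument of F in F_le *)
  define \<Phi> where "\<Phi> y = legendre F (\<tau> *\<^sub>R y)" for y
  have [measurable]: "\<Phi> \<in> borel_measurable borel" unfolding \<Phi>_def by measurable
  have scale: "(\<integral>\<^sup>+y. exp_neg (\<Phi> y) \<partial>lborel) = ennreal (1 / \<tau> ^ CARD('n)) * (\<integral>\<^sup>+y. exp_neg (legendre F y) \<partial>lborel)"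
    unfolding \<Phi>_def using nn_integral_lborel_scaleR[of "\<lambda>y. exp_neg (legendre F y)" \<tau>] \<tau> by simp

  have pos_F: "0 < (\<integral>\<^sup>+y. exp_neg (F y) \<partial>lborel)"
  proof -
    (* the domain of F carries the image of the first moment measure under scaling by 1 / tau *)
    define Fl where "Fl y = F ((1/\<tau>) *\<^sub>R y)" for y
    have [measurable]: "Fl \<in> borel_measurable borel" unfolding Fl_def by measurable
    have "ereal_convex Fl"
      unfolding ereal_convex_def
    proof (intro allI ballI)
      fix x y :: "real ^ 'n" and t :: real assume "t \<in> {0..1}"
      then have "F ((1 - t) *\<^sub>R ((1/\<tau>) *\<^sub>R x) + t *\<^sub>R ((1/\<tau>) *\<^sub>R y))
          \<le> ereal (1 - t) * F ((1/\<tau>) *\<^sub>R x) + ereal t * F ((1/\<tau>) *\<^sub>R y)"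
        using convex_lsc_fnsD(3)[OF F] unfolding ereal_convex_def by blast
      then show "Fl ((1 - t) *\<^sub>R x + t *\<^sub>R y) \<le> ereal (1 - t) * Fl x + ereal t * Fl y"
        unfolding Fl_def by (simp add: scaleR_add_right)
    qed
    moreover have "AE x in lborel. Fl (gradient V\<^sub>1 x) \<noteq> \<infinity>"
      using F_le by eventually_elim (auto simp: Fl_def)
    ultimately have "0 < (\<integral>\<^sup>+y. exp_neg (Fl y) \<partial>lborel)" by (intro L1.exp_neg_integral_pos) auto
    also have "(\<integral>\<^sup>+y. exp_neg (Fl y) \<partial>lborel) = ennreal (1 / (1/\<tau>) ^ CARD('n)) * (\<integral>\<^sup>+y. exp_neg (F y) \<partial>lborel)"
      unfolding Fl_def using nn_integral_lborel_scaleR[of "\<lambda>y. exp_neg (F y)" "1/\<tau>"] \<tau> by simp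
    finally show ?thesis by (auto simp: zero_less_iff_neq_zero)
  qed
  have pos_Fs: "0 < (\<integral>\<^sup>+y. exp_neg (legendre F y) \<partial>lborel)"
  proof (rule L2.exp_neg_integral_pos[where h = "legendre F", OF _ legendre_convex[where f = F, OF F_MInf]])
    show "AE x in lborel. legendre F (gradient V\<^sub>2 x) \<noteq> \<infinity>"
      using k_eq
    proof eventually_elim
      case (elim x)
      then show ?case using Fs_le[of "gradient V\<^sub>2 x"] by auto
    qed
  qed simp

  have le2: "(\<integral>\<^sup>+y. exp_neg (F y) \<partial>lborel) \<le> ennreal (exp ((\<integral>x. h2 x \<partial>L2.law) - (?n - (\<integral>x. V\<^sub>2 x \<partial>L2.law))))"
  proof (rule L2.exp_neg_integral_le(2)[where g = h2 and \<phi> = F, OF _ _ _ F_MInf pos_F])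
    show "integrable L2.law (\<lambda>x. max (h2 x) 0)" using h2(1) by simp
    show "AE x in lborel. \<forall>y. F y \<noteq> \<infinity> \<longrightarrow> gradient V\<^sub>2 x \<bullet> y \<le> h2 x + real_of_ereal (F y)"
      using k_eq
    proof eventually_elim
      case (elim x)
      then show ?case
        using fenchel_young[of k "gradient V\<^sub>2 x"] by (auto simp: F_def)
    qed
  qed auto
  have le1: "(\<integral>\<^sup>+y. exp_neg (\<Phi> y) \<partial>lborel) \<le> ennreal (exp ((\<integral>x. h1 x \<partial>L1.law) - (?n - (\<integral>x. V\<^sub>1 x \<partial>L1.law))))"
  proof (rule L1.exp_neg_integral_le(2))
    show "integrable L1.law (\<lambda>x. max (h1 x) 0)" using h1(1) by simp
    show "\<Phi> y \<noteq> - \<infinity>" for y using Fs_MInf by (simp add: \<Phi>_def)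
    show "0 < (\<integral>\<^sup>+y. exp_neg (\<Phi> y) \<partial>lborel)"
      unfolding scale using pos_Fs \<tau> by (simp add: zero_less_iff_neq_zero)
    show "AE x in lborel. \<forall>y. \<Phi> y \<noteq> \<infinity> \<longrightarrow> gradient V\<^sub>1 x \<bullet> y \<le> h1 x + real_of_ereal (\<Phi> y)"
      using F_le
    proof eventually_elim
      case (elim x)
      let ?p = "(1/\<tau>) *\<^sub>R gradient V\<^sub>1 x"
      have "F ?p \<noteq> \<infinity>" using elim by auto
      then obtain r where r: "F ?p = ereal r" using F_MInf[of ?p] by (cases "F ?p") auto
      show ?case
      proof (intro allI impI)
        fix y assume "\<Phi> y \<noteq> \<infinity>"
        then have "?p \<bullet> (\<tau> *\<^sub>R y) \<le> real_of_ereal (F ?p) + real_of_ereal (legendre F (\<tau> *\<^sub>R y))"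
          using r by (intro fenchel_young) (auto simp: \<Phi>_def)
        then show "gradient V\<^sub>1 x \<bullet> y \<le> h1 x + real_of_ereal (\<Phi> y)"
          using elim \<tau> by (simp add: r \<Phi>_def)
      qed
    qed
  qed auto

  let ?e1 = "(\<integral>x. h1 x \<partial>L1.law) - (?n - (\<integral>x. V\<^sub>1 x \<partial>L1.law))"
  let ?e2 = "(\<integral>x. h2 x \<partial>L2.law) - (?n - (\<integral>x. V\<^sub>2 x \<partial>L2.law))"
  have sum: "?e1 + ?e2 = a / \<tau> - 2 * ?n + m"
    unfolding h1(2) h2(2) a_def m_def by (simp add: add_divide_distrib)
  have "ennreal (c ^ CARD('n)) \<le> (\<integral>\<^sup>+y. exp_neg (F y) \<partial>lborel) * (\<integral>\<^sup>+y. exp_neg (legendre F y) \<partial>lborel)"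
    using IS F F_inv pos_F pos_Fs unfolding inverse_santalo_def by blast
  also have "(\<integral>\<^sup>+y. exp_neg (legendre F y) \<partial>lborel) = ennreal (\<tau> ^ CARD('n)) * (\<integral>\<^sup>+y. exp_neg (\<Phi> y) \<partial>lborel)"
    unfolding scale using \<tau> by (simp add: mult.assoc[symmetric] flip: ennreal_mult)
  also have "(\<integral>\<^sup>+y. exp_neg (F y) \<partial>lborel) * (ennreal (\<tau> ^ CARD('n)) * (\<integral>\<^sup>+y. exp_neg (\<Phi> y) \<partial>lborel))
    \<le> ennreal (exp ?e2) * (ennreal (\<tau> ^ CARD('n)) * ennreal (exp ?e1))"
    by (intro mult_mono le1 le2) auto
  also have "\<dots> = ennreal (\<tau> ^ CARD('n) * exp (a / \<tau> - 2 * ?n + m))"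
    using \<tau> unfolding sum[symmetric] exp_add by (simp add: mult_ac flip: ennreal_mult)
  finally have "c ^ CARD('n) \<le> \<tau> ^ CARD('n) * exp (a / \<tau> - 2 * ?n + m)"
    using \<tau> by (simp add: ennreal_le_iff)
  then have "ln (c ^ CARD('n)) \<le> ln (\<tau> ^ CARD('n) * exp (a / \<tau> - 2 * ?n + m))"
    using c \<tau> by (subst ln_le_cancel_iff) auto
  then have "?n * ln c \<le> ?n * ln \<tau> + (a / \<tau> - 2 * ?n + m)"
    using c \<tau> by (simp add: ln_mult ln_realpow)
  moreover have "?n * ln \<tau> = ?n * ln c + ?n - m"
  proof -
    have "ln \<tau> = ln c + (1 - m / ?n)" using c by (simp add: \<tau>_def ln_mult)
    then have "?n * ln \<tau> = ?n * (ln c + (1 - m / ?n))" by simp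
    also have "\<dots> = ?n * ln c + ?n - m" by (simp add: distrib_left right_diff_distrib)
    finally show ?thesis .
  qed
  ultimately have "?n \<le> a / \<tau>" by simp
  then have "?n * \<tau> \<le> a" using \<tau> by (simp add: pos_le_divide_eq)
  then show ?thesis unfolding cost by (simp add: \<tau>_def)
qed

text \<open>The common form of the three cases, which differ only in the group of sign changes.\<close>

lemma entropy_transport_inequality:
  fixes X\<^sub>1 :: "'a \<Rightarrow> real ^ 'n" and X\<^sub>2 :: "'b \<Rightarrow> real ^ 'n"
  assumes V1: "full_log_concave V\<^sub>1" and V2: "full_log_concave V\<^sub>2" and c: "0 < c"
    and X1: "distributed M\<^sub>1 lborel X\<^sub>1 (\<lambda>x. ennreal (exp (- V\<^sub>1 x)))"
    and X2: "distributed M\<^sub>2 lborel X\<^sub>2 (\<lambda>x. ennreal (exp (- V\<^sub>2 x)))"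
    and \<Gamma>: "sign_group \<Gamma>"
    and inv1: "\<And>\<epsilon>. \<epsilon> \<in> \<Gamma> \<Longrightarrow> distr (distr M\<^sub>1 borel X\<^sub>1) borel (sign_change \<epsilon>) = distr M\<^sub>1 borel X\<^sub>1"
    and inv2: "\<And>\<epsilon>. \<epsilon> \<in> \<Gamma> \<Longrightarrow> distr (distr M\<^sub>2 borel X\<^sub>2) borel (sign_change \<epsilon>) = distr M\<^sub>2 borel X\<^sub>2"
    and IS: "inverse_santalo (convex_lsc_fns \<inter> {f. \<forall>\<epsilon>\<in>\<Gamma>. \<forall>x. f (sign_change \<epsilon> x) = f x}) c"
  shows "ereal ((real CARD('n) * c / (2 * pi))\<^sup>2) \<le> ereal (entropy_power M\<^sub>1 X\<^sub>1 * entropy_power M\<^sub>2 X\<^sub>2)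
        * (transport_cost (moment_measure V\<^sub>1) (moment_measure V\<^sub>2))\<^sup>2"
proof -
  interpret L1: full_log_concave V\<^sub>1 by fact
  interpret L2: full_log_concave V\<^sub>2 by fact
  let ?n = "real CARD('n)"
  let ?T = "transport_cost (moment_measure V\<^sub>1) (moment_measure V\<^sub>2)"
  have G_sign: "\<epsilon> \<in> sign_vectors" if "\<epsilon> \<in> \<Gamma>" for \<epsilon> using \<Gamma> that by (auto simp: sign_group_def)
  define m where "m = (\<integral>x. V\<^sub>1 x \<partial>L1.law) + (\<integral>x. V\<^sub>2 x \<partial>L2.law)"
  define t where "t = ?n * (c * exp (1 - m / ?n))"
  have t: "0 < t" using c by (simp add: t_def)
  have T: "ereal t \<le> ?T"
    unfolding transport_cost_def
  proof (rule INF_greatest)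
    fix f :: "real ^ 'n \<Rightarrow> ereal" assume "f \<in> convex_lsc_fns"
    then show "ereal t \<le> ereal_integral (moment_measure V\<^sub>1) f + ereal_integral (moment_measure V\<^sub>2) (legendre f)"
      unfolding t_def m_def
      using L1.potential_invariant L2.potential_invariant G_sign inv1 inv2
        L1.distr_borel_eq_law[OF X1] L2.distr_borel_eq_law[OF X2]
      by (intro transport_pair_ge[OF V1 V2 c \<Gamma> _ _ IS]) auto
  qed
  define Q where "Q = entropy_power M\<^sub>1 X\<^sub>1 * entropy_power M\<^sub>2 X\<^sub>2"
  have Q: "Q = (1 / (2 * pi * exp 1))\<^sup>2 * exp (2 * (m / ?n))"
    unfolding Q_def L1.entropy_power_eq[OF X1] L2.entropy_power_eq[OF X2] m_def
    by (simp add: power2_eq_square add_divide_distrib distrib_left exp_add)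
  have Q0: "0 < Q" unfolding Q by simp
  have Qt: "Q * t\<^sup>2 = (?n * c / (2 * pi))\<^sup>2"
  proof -
    have "exp (2 * (m / ?n)) = (exp (m / ?n))\<^sup>2" using exp_double[of "m / ?n"] by simp
    moreover have "exp (1 - m / ?n) = exp 1 / exp (m / ?n)" by (simp add: exp_diff)
    ultimately show ?thesis unfolding Q t_def by (simp add: power_mult_distrib power_divide)
  qed
  show ?thesis
  proof (cases ?T)
    case (real r)
    then have "t \<le> r" using T by simp
    then have "Q * t\<^sup>2 \<le> Q * r\<^sup>2" using t Q0 by (intro mult_left_mono power_mono) auto
    then show ?thesis unfolding Q_def[symmetric] Qt[symmetric] real by (simp add: power2_eq_square)
  next
    case PInf
    then show ?thesis unfolding Q_def[symmetric] PInf using Q0 by (simp add: power2_eq_square)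
  next
    case MInf
    then show ?thesis using T by simp
  qed
qed

theorem corollary4:
  fixes c :: real
    and M\<^sub>1 :: "'a measure" and M\<^sub>2 :: "'b measure"
    and X\<^sub>1 :: "'a \<Rightarrow> real ^ 'n" and X\<^sub>2 :: "'b \<Rightarrow> real ^ 'n"
    and V\<^sub>1 V\<^sub>2 :: "real ^ 'n \<Rightarrow> real"
  assumes "c > 0"
    and "prob_space M\<^sub>1" and "prob_space M\<^sub>2"
    and "convex_on UNIV V\<^sub>1" and "convex_on UNIV V\<^sub>2"
    and "distributed M\<^sub>1 lborel X\<^sub>1 (\<lambda>x. ennreal (exp (- V\<^sub>1 x)))"
    and "distributed M\<^sub>2 lborel X\<^sub>2 (\<lambda>x. ennreal (exp (- V\<^sub>2 x)))"
  shows "let ineq =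
      ereal (entropy_power M\<^sub>1 X\<^sub>1 * entropy_power M\<^sub>2 X\<^sub>2)
        * (transport_cost (moment_measure V\<^sub>1) (moment_measure V\<^sub>2))\<^sup>2
      \<ge> ereal ((real CARD('n) * c / (2 * pi))\<^sup>2)
    in
    (inverse_santalo (convex_lsc_fns :: (real ^ 'n \<Rightarrow> ereal) set) c \<longrightarrow> ineq) \<and>
    (inverse_santalo (convex_lsc_fns \<inter> symmetric_fns :: (real ^ 'n \<Rightarrow> ereal) set) c \<and>
       symmetric_law (distr M\<^sub>1 borel X\<^sub>1) \<and> symmetric_law (distr M\<^sub>2 borel X\<^sub>2) \<longrightarrow> ineq) \<and>
    (inverse_santalo (convex_lsc_fns \<inter> unconditional_fns :: (real ^ 'n \<Rightarrow> ereal) set) c \<and>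
       unconditional_law (distr M\<^sub>1 borel X\<^sub>1) \<and> unconditional_law (distr M\<^sub>2 borel X\<^sub>2) \<longrightarrow> ineq)"
proof -
  have V: "full_log_concave V\<^sub>1" "full_log_concave V\<^sub>2"
    using full_log_concave_if_distributed assms by blast+
  note ineq = entropy_transport_inequality[OF V \<open>c > 0\<close> assms(6,7)]
  have trivial: "sign_group {(\<chi> i. 1) :: real ^ 'n}"
    by (simp add: sign_group_def sign_vectors_def sign_change_one)
  have reflection: "sign_group {(\<chi> i. 1), (\<chi> i. -1) :: real ^ 'n}"
    by (auto simp: sign_group_def sign_vectors_def sign_change_def)
  have all_signs: "sign_group (sign_vectors :: (real ^ 'n) set)"
    unfolding sign_group_def
  proof (intro conjI ballI)
    have "(\<chi> i. 1) \<in> (sign_vectors :: (real ^ 'n) set)" by (simp add: sign_vectors_def)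
    then show "(sign_vectors :: (real ^ 'n) set) \<noteq> {}" by blast
    show "sign_change \<delta> \<epsilon> \<in> sign_vectors" if "\<delta> \<in> sign_vectors" "\<epsilon> \<in> sign_vectors" for \<delta> \<epsilon> :: "real ^ 'n"
    proof -
      have "\<delta> $ i * \<epsilon> $ i \<in> {-1, 1}" for i
      proof -
        have "\<delta> $ i = -1 \<or> \<delta> $ i = 1" "\<epsilon> $ i = -1 \<or> \<epsilon> $ i = 1"
          using that by (simp_all add: sign_vectors_def)
        then show ?thesis by auto
      qed
      then show ?thesis by (simp add: sign_vectors_def sign_change_def)
    qed
  qed simp
  have id: "sign_change (\<chi> i. 1) = (\<lambda>x :: real ^ 'n. x)" and neg: "sign_change (\<chi> i. -1) = (uminus :: real ^ 'n \<Rightarrow> _)"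
    by (auto simp: sign_change_one sign_change_neg_one)
  have distr_id: "distr (distr M borel X) borel (\<lambda>x. x) = distr M borel X" for M :: "'c measure" and X :: "'c \<Rightarrow> real ^ 'n"
    by (rule distr_id2) simp
  show ?thesis
    unfolding Let_def
  proof (intro conjI impI; (elim conjE)?)
    assume IS: "inverse_santalo (convex_lsc_fns :: (real ^ 'n \<Rightarrow> ereal) set) c"
    show "ereal ((real CARD('n) * c / (2 * pi))\<^sup>2) \<le> ereal (entropy_power M\<^sub>1 X\<^sub>1 * entropy_power M\<^sub>2 X\<^sub>2)
        * (transport_cost (moment_measure V\<^sub>1) (moment_measure V\<^sub>2))\<^sup>2"
      by (rule ineq[OF trivial]) (use IS in \<open>simp_all add: id distr_id\<close>)
  next
    assume IS: "inverse_santalo (convex_lsc_fns \<inter> symmetric_fns :: (real ^ 'n \<Rightarrow> ereal) set) c"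
      and sym: "symmetric_law (distr M\<^sub>1 borel X\<^sub>1)" "symmetric_law (distr M\<^sub>2 borel X\<^sub>2)"
    show "ereal ((real CARD('n) * c / (2 * pi))\<^sup>2) \<le> ereal (entropy_power M\<^sub>1 X\<^sub>1 * entropy_power M\<^sub>2 X\<^sub>2)
        * (transport_cost (moment_measure V\<^sub>1) (moment_measure V\<^sub>2))\<^sup>2"
      by (rule ineq[OF reflection])
        (use IS sym in \<open>auto simp: id neg distr_id symmetric_law_def symmetric_fns_def\<close>)
  next
    assume IS: "inverse_santalo (convex_lsc_fns \<inter> unconditional_fns :: (real ^ 'n \<Rightarrow> ereal) set) c"
      and unc: "unconditional_law (distr M\<^sub>1 borel X\<^sub>1)" "unconditional_law (distr M\<^sub>2 borel X\<^sub>2)"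
    show "ereal ((real CARD('n) * c / (2 * pi))\<^sup>2) \<le> ereal (entropy_power M\<^sub>1 X\<^sub>1 * entropy_power M\<^sub>2 X\<^sub>2)
        * (transport_cost (moment_measure V\<^sub>1) (moment_measure V\<^sub>2))\<^sup>2"
      by (rule ineq[OF all_signs])
        (use IS unc in \<open>auto simp: unconditional_law_def unconditional_fns_def\<close>)
  qed
qed

end
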